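(* Let $X=(x_0,x_1)$ be a bounded interval, $\zeta\in C_+(X)$, and set $\alpha=-\zeta'/(2\zeta)$. Let $y\in(x_0,x_1]$ and set $R(\omega)=g^\omega_{\zeta|_{(x_0,y)}}(0)$. Then: (i) $R=\mathrm{Th}_\alpha^{(x_0,y)}$; (ii) for every $\omega\in\mathbb{R}$, $\bigl|\mathrm{Th}_\alpha^{(x_0,y)}(\omega)\bigr|\le\tanh\int_{x_0}^y|\alpha|$; (iii) $g_{\zeta|_{(x_0,y)}}^\omega(\xi)$ is $C^\infty$ with respect to $\omega$, and $g_{\zeta|_{(x_0,y)}}^\omega(\xi)=\mu\frac{\xi+\rho}{1+\overline{\rho}\xi}$ $(\xi\in\mathbb{D})$, where $$\mu=e^{2i(y-x_0)\omega}\,\frac{\overline{E_{\alpha}^{(x_0,y)}(\omega)+E_{-\alpha}^{(x_0,y)}(\omega)}}{E_{\alpha}^{(x_0,y)}(\omega)+E_{-\alpha}^{(x_0,y)}(\omega)},\qquad \rho=e^{-2i(y-x_0)\omega}\,\frac{E_{\alpha}^{(x_0,y)}(\omega)-E_{-\alpha}^{(x_0,y)}(\omega)}{\overline{E_{\alpha}^{(x_0,y)}(\omega)+E_{-\alpha}^{(x_0,y)}(\omega)}};$$ (iv) if $\alpha\in L^2(X)$, then $$\int_{-\infty}^\infty-\log\Bigl(1-\bigl|\mathrm{Th}_{\alpha}^{(x_0,y)}(\omega)\bigr|^2\Bigr)d\omega\le\pi\int_{x_0}^y|\alpha|^2.$$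
   Context: $\mathbb{D}$ is the open unit disk. For a bounded interval $X$, a function on $X$ is regulated if it is a uniform limit of step functions (piecewise-constant functions with finitely many discontinuities). $\mathrm{Reg}_+(X)$ is the set of regulated $f$ with $f>\varepsilon$ on $X$ for some $\varepsilon>0$. $C_+(X)\subset\mathrm{Reg}_+(X)$ is the set of absolutely continuous positive functions on $X$ that are bounded away from $0$; for $\zeta\in C_+(X)$, $\alpha=-\zeta'/(2\zeta)\in L^1_{\mathbb{R}}(X)$ (real-valued integrable functions). Harmonic exponential: for real-valued $\alpha\in L^1$ and $\omega\in\mathbb{R}$, $$E^{(x_0,y)}_\alpha(\omega)=1+\sum_{j=1}^\infty\ \int\limits_{x_0<s_1<\cdots<s_j<y}\exp\Bigl(2i\omega\sum_{\nu=1}^j(-1)^{j-\nu}(s_\nu-x_0)\Bigr)\prod_{\nu=1}^j\alpha(s_\nu)\,ds_1\cdots ds_j .$$ Hyperbolic tangent operator: $\mathrm{Th}^{(x_0,y)}_\alpha=\dfrac{E^{(x_0,y)}_\alpha-E^{(x_0,y)}_{-\alpha}}{E^{(x_0,y)}_\alpha+E^{(x_0,y)}_{-\alpha}}$ (the denominator is bounded away from $0$ on $\mathbb{R}$). Generalized reflection coefficient: for $\omega\in\mathbb{R}\setminus\{0\}$ put $u^{\ell}=\frac12\bigl(u-\frac{1}{i\omega}u'\bigr)$, $u^{\rm r}=\frac12\bigl(u+\frac{1}{i\omega}u'\bigr)$. For $\eta\in\mathrm{Reg}_+((a,b))$, for all $\omega\in\mathbb{R}$ outside a countable set (containing $0$)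 and every $\xi\in\mathbb{D}$, the problem $(\eta u')'+\omega^2\eta u=0$ on $(a,b)$, $u^{\rm r}(a+)=1$, $u^{\ell}(b-)=\xi u^{\rm r}(b-)$ has a unique solution $u$ with $u$ and $\eta u'$ absolutely continuous (equation holding a.e.); $g_\eta^\omega(\xi)=u^{\ell}(a+)$. As a function of $\omega$, $g_\eta^\omega$ is regarded as defined almost everywhere, and identities and smoothness in $\omega$ are understood up to equality almost everywhere. *)

theory Defs
  imports "HOL-Analysis.Analysis"
begin

text \<open>The notion \<^const>\<open>absolutely_continuous\<close> of HOL-Analysis concerns measures. The
  following is the usual notion for functions on an interval \<open>S\<close>, for which
  the segments between the chosen end points lie in \<open>S\<close>.\<close>

definition absolutely_continuous_on :: "real set \<Rightarrow> (real \<Rightarrow> 'a::real_normed_vector) \<Rightarrow> bool" where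
  "absolutely_continuous_on S f \<longleftrightarrow>
     (\<forall>\<epsilon>>0. \<exists>\<delta>>0. \<forall>(n::nat) a b.
        (\<forall>k<n. a k \<in> S \<and> b k \<in> S \<and> a k \<le> b k) \<and>
        disjoint_family_on (\<lambda>k. {a k<..<b k}) {..<n} \<and>
        (\<Sum>k<n. b k - a k) < \<delta> \<longrightarrow>
        (\<Sum>k<n. norm (f (b k) - f (a k))) < \<epsilon>)"

definition C_plus :: "real set \<Rightarrow> (real \<Rightarrow> real) set" where
  "C_plus X = {\<zeta>. absolutely_continuous_on X \<zeta> \<and> (\<exists>\<epsilon>>0. \<forall>x\<in>X. \<zeta> x > \<epsilon>)}"

definition smooth :: "(real \<Rightarrow> complex) \<Rightarrow> bool" where
  "smooth f \<longleftrightarrow> (\<exists>D :: nat \<Rightarrow> real \<Rightarrow> complex. D 0 = f \<and>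
     (\<forall>n x. (D n has_vector_derivative D (Suc n) x) (at x)))"

text \<open>The factors of the product measure are \<^const>\<open>lebesgue\<close> rather than \<^const>\<open>lborel\<close>,
  so that \<open>\<alpha>\<close> may be any representative of an \<open>L\<^sup>1\<close> class.\<close>

definition harmonic_exp_term ::
  "(real \<Rightarrow> real) \<Rightarrow> real \<Rightarrow> real \<Rightarrow> real \<Rightarrow> nat \<Rightarrow> complex" where
  "harmonic_exp_term \<alpha> x0 y \<omega> j =
     (LINT s:{s. strict_mono_on {1..j} s \<and> (\<forall>\<nu>\<in>{1..j}. x0 < s \<nu> \<and> s \<nu> < y)}
        |PiM {1..j} (\<lambda>_. lebesgue).
        exp (2 * \<i> * complex_of_real (\<omega> * (\<Sum>\<nu>=1..j. (- 1) ^ (j - \<nu>) * (s \<nu> - x0))))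
          * complex_of_real (\<Prod>\<nu>=1..j. \<alpha> (s \<nu>)))"

definition harmonic_exp :: "(real \<Rightarrow> real) \<Rightarrow> real \<Rightarrow> real \<Rightarrow> real \<Rightarrow> complex" where
  "harmonic_exp \<alpha> x0 y \<omega> = 1 + (\<Sum>j. harmonic_exp_term \<alpha> x0 y \<omega> (Suc j))"

definition Th :: "(real \<Rightarrow> real) \<Rightarrow> real \<Rightarrow> real \<Rightarrow> real \<Rightarrow> complex" where
  "Th \<alpha> x0 y \<omega> =
     (harmonic_exp \<alpha> x0 y \<omega> - harmonic_exp (\<lambda>x. - \<alpha> x) x0 y \<omega>) /
     (harmonic_exp \<alpha> x0 y \<omega> + harmonic_exp (\<lambda>x. - \<alpha> x) x0 y \<omega>)"

definition left_part :: "real \<Rightarrow> (real \<Rightarrow> complex) \<Rightarrow> (real \<Rightarrow> complex) \<Rightarrow> real \<Rightarrow> complex" where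
  "left_part \<omega> u u' x = (u x - u' x / (\<i> * of_real \<omega>)) / 2"

definition right_part :: "real \<Rightarrow> (real \<Rightarrow> complex) \<Rightarrow> (real \<Rightarrow> complex) \<Rightarrow> real \<Rightarrow> complex" where
  "right_part \<omega> u u' x = (u x + u' x / (\<i> * of_real \<omega>)) / 2"

text \<open>Here \<open>u'\<close> is the representative of the (almost everywhere defined) derivative of \<open>u\<close>
  for which \<open>\<eta> u'\<close> is absolutely continuous on all of \<open>(a, b)\<close>. If \<open>\<eta>\<close> is regulated and
  bounded away from zero, this \<open>u'\<close> has one-sided limits, including at \<open>a\<close> and \<open>b\<close>.\<close>

definition bvp_solution ::
  "(real \<Rightarrow> real) \<Rightarrow> real \<Rightarrow> real \<Rightarrow> real \<Rightarrow> complex \<Rightarrow>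
   (real \<Rightarrow> complex) \<Rightarrow> (real \<Rightarrow> complex) \<Rightarrow> bool" where
  "bvp_solution \<eta> a b \<omega> \<xi> u u' \<longleftrightarrow>
     absolutely_continuous_on {a<..<b} u \<and>
     (AE x in lebesgue_on {a<..<b}. (u has_vector_derivative u' x) (at x)) \<and>
     absolutely_continuous_on {a<..<b} (\<lambda>x. of_real (\<eta> x) * u' x) \<and>
     (AE x in lebesgue_on {a<..<b}. \<exists>d.
        ((\<lambda>x. of_real (\<eta> x) * u' x) has_vector_derivative d) (at x) \<and>
        d + of_real (\<omega>\<^sup>2 * \<eta> x) * u x = 0) \<and>
     (right_part \<omega> u u' \<longlongrightarrow> 1) (at_right a) \<and>
     (\<exists>l r. (left_part \<omega> u u' \<longlongrightarrow> l) (at_left b) \<and>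
            (right_part \<omega> u u' \<longlongrightarrow> r) (at_left b) \<and> l = \<xi> * r)"

definition reflection_coeff ::
  "(real \<Rightarrow> real) \<Rightarrow> real \<Rightarrow> real \<Rightarrow> real \<Rightarrow> complex \<Rightarrow> complex" where
  "reflection_coeff \<eta> a b \<omega> \<xi> =
     (THE z. \<exists>u u'. bvp_solution \<eta> a b \<omega> \<xi> u u' \<and>
                    (left_part \<omega> u u' \<longlongrightarrow> z) (at_right a))"

end

theory Submission
  imports Defs "HOL-Complex_Analysis.Complex_Analysis"
begin

text \<open>Differentiating the series term by term shows that \<open>E = E\<^sub>\<alpha>\<close> satisfies
  \<open>E' = c cnj E\<close> in \<open>y\<close>, where \<open>c s = \<alpha> s exp (2 \<i> \<omega> (s - x\<^sub>0))\<close>. Hence \<open>S = E\<^sub>\<alpha> + E\<^bsub>-\<alpha>\<^esub>\<close> and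
  \<open>D = E\<^sub>\<alpha> - E\<^bsub>-\<alpha>\<^esub>\<close> satisfy \<open>S' = c cnj D\<close> and \<open>D' = c cnj S\<close>, so that \<open>|S|\<^sup>2 - |D|\<^sup>2 = 4\<close>; together with
  \<open>|S| \<le> 2 cosh (\<integral>|\<alpha>|)\<close> this gives the bound by the hyperbolic tangent. The right and left parts of a
  solution \<open>u\<close> of the boundary value problem satisfy the same system up to explicit factors, and two
  conserved quantities express the reflection coefficient through \<open>S\<close> and \<open>D\<close>. Smoothness follows
  because the series extend to entire functions of \<open>\<omega>\<close>.

  For the energy inequality the phase in \<open>c\<close> is frozen on \<open>N\<close> layers of width \<open>h\<close>. Then \<open>S / 2\<close> is a
  polynomial in \<open>exp (2 \<i> \<omega> h)\<close> that has no zeros in the closed unit disc and constant term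
  \<open>\<Prod> cosh \<beta>\<^sub>k\<close>, where \<open>\<beta>\<^sub>k\<close> is the integral of \<open>\<alpha>\<close> over the \<open>k\<close>-th layer. By the mean value property the
  integral of \<open>ln |S / 2|\<close> over one period is \<open>(\<pi> / h) \<Sum> ln cosh \<beta>\<^sub>k \<le> (\<pi> / 2) \<integral>\<alpha>\<^sup>2\<close>, and Fatou's
  lemma yields the limit \<open>h \<rightarrow> 0\<close>.\<close>

section \<open>Absolutely continuous functions\<close>

text \<open>The equations hold only almost everywhere, and \<zeta> is known only through the
  epsilon-delta form of absolute continuity. The argument therefore rests on two facts: an
  absolutely continuous function has an integrable derivative almost everywhere, and it is recovered
  by integrating that derivative. The second fact makes a quantity with vanishing derivative
  constant; such conserved quantities replace uniqueness theorems for the differential equations. In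
  the energy inequality only the phase is frozen, not \<alpha>: the layer integrals of \<alpha> meet
  its L^2 norm through Cauchy-Schwarz. The constant survives because -ln (1 - |D / S|^2) = 2 ln |S /
  2|, because ln cosh x <= x^2 / 2, and because the factor h from Cauchy-Schwarz cancels the 1 / h
  in the period pi / h. Freezing makes the energy periodic in \<omega>, so only one period is kept,
  whose length grows like 1 / h; Fatou's lemma then asks for no more than pointwise
  convergence.\<close>

lemma absolutely_continuous_on_subset:
  "absolutely_continuous_on S f \<Longrightarrow> T \<subseteq> S \<Longrightarrow> absolutely_continuous_on T f"
  unfolding absolutely_continuous_on_def by (meson subsetD)

text \<open>Frees the definition from the index sets \<open>{..<n}\<close>: in
  \<open>ac_deriv_has_integral\<close> the families are indexed by tagged intervals. The index type
  \<open>'i\<close> is instantiated at each use.\<close>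

lemma absolutely_continuous_on_finite_family:
  assumes "absolutely_continuous_on S f" "\<epsilon> > 0"
  obtains \<delta> where "\<delta> > 0"
    "\<And>(I::'i set) a b. finite I \<Longrightarrow> (\<And>i. i \<in> I \<Longrightarrow> a i \<in> S \<and> b i \<in> S \<and> a i \<le> b i) \<Longrightarrow>
       disjoint_family_on (\<lambda>i. {a i<..<b i}) I \<Longrightarrow> (\<Sum>i\<in>I. b i - a i) < \<delta> \<Longrightarrow>
       (\<Sum>i\<in>I. norm (f (b i) - f (a i))) < \<epsilon>"
proof -
  obtain \<delta> where "\<delta> > 0" and \<delta>: "\<And>(n::nat) a b.
        (\<forall>k<n. a k \<in> S \<and> b k \<in> S \<and> a k \<le> b k) \<Longrightarrow>
        disjoint_family_on (\<lambda>k. {a k<..<b k}) {..<n} \<Longrightarrow>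
        (\<Sum>k<n. b k - a k) < \<delta> \<Longrightarrow>
        (\<Sum>k<n. norm (f (b k) - f (a k))) < \<epsilon>"
    using assms unfolding absolutely_continuous_on_def by meson
  show ?thesis
  proof (rule that[of \<delta>])
    fix I :: "'i set" and a b
    assume fin: "finite I" and mem: "\<And>i. i \<in> I \<Longrightarrow> a i \<in> S \<and> b i \<in> S \<and> a i \<le> b i"
      and dis: "disjoint_family_on (\<lambda>i. {a i<..<b i}) I" and len: "(\<Sum>i\<in>I. b i - a i) < \<delta>"
    obtain h where h: "bij_betw h {..<card I} I"
      using ex_bij_betw_nat_finite[OF fin] by (auto simp: atLeast0LessThan)
    have "(\<Sum>k<card I. norm (f ((b \<circ> h) k) - f ((a \<circ> h) k))) < \<epsilon>"
    proof (rule \<delta>)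
      show "\<forall>k<card I. (a \<circ> h) k \<in> S \<and> (b \<circ> h) k \<in> S \<and> (a \<circ> h) k \<le> (b \<circ> h) k"
        using mem h bij_betwE by fastforce
      show "disjoint_family_on (\<lambda>k. {(a \<circ> h) k<..<(b \<circ> h) k}) {..<card I}"
        unfolding disjoint_family_on_def
      proof (intro ballI impI)
        fix m n assume "m \<in> {..<card I}" "n \<in> {..<card I}" "m \<noteq> n"
        then have "h m \<in> I" "h n \<in> I" "h m \<noteq> h n"
          using h by (auto simp: bij_betw_def inj_on_def)
        then show "{(a \<circ> h) m<..<(b \<circ> h) m} \<inter> {(a \<circ> h) n<..<(b \<circ> h) n} = {}"
          using dis by (simp add: disjoint_family_on_def)
      qed
      have "(\<Sum>k<card I. (b \<circ> h) k - (a \<circ> h) k) = (\<Sum>i\<in>I. b i - a i)"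
        using sum.reindex_bij_betw[OF h, of "\<lambda>i. b i - a i"] by simp
      then show "(\<Sum>k<card I. (b \<circ> h) k - (a \<circ> h) k) < \<delta>" using len by simp
    qed
    moreover have "(\<Sum>k<card I. norm (f ((b \<circ> h) k) - f ((a \<circ> h) k))) = (\<Sum>i\<in>I. norm (f (b i) - f (a i)))"
      using sum.reindex_bij_betw[OF h, of "\<lambda>i. norm (f (b i) - f (a i))"] by simp
    ultimately show "(\<Sum>i\<in>I. norm (f (b i) - f (a i))) < \<epsilon>" by simp
  qed fact
qed

text \<open>Common source of the closure properties: for Lipschitz images, sums and products, only
  the estimate of a single increment remains to be checked.\<close>

lemma absolutely_continuous_on_dominated:
  fixes f :: "real \<Rightarrow> 'a::real_normed_vector" and g :: "real \<Rightarrow> 'b::real_normed_vector"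
    and h :: "real \<Rightarrow> 'c::real_normed_vector"
  assumes f: "absolutely_continuous_on S f" and g: "absolutely_continuous_on S g"
    and le: "\<And>x y. x \<in> S \<Longrightarrow> y \<in> S \<Longrightarrow> norm (h y - h x) \<le> K * norm (f y - f x) + L * norm (g y - g x)"
  shows "absolutely_continuous_on S h"
  unfolding absolutely_continuous_on_def
proof (intro allI impI)
  fix \<epsilon> :: real assume "\<epsilon> > 0"
  \<comment> \<open>K and L carry no sign condition; M is a positive bound for both.\<close>
  define M where "M = 1 + \<bar>K\<bar> + \<bar>L\<bar>"
  have M: "M > 0" "K \<le> M" "L \<le> M" unfolding M_def by auto
  define e where "e = \<epsilon> / (2 * M)"
  have "e > 0" unfolding e_def using \<open>\<epsilon> > 0\<close> M by simp
  obtain d1 where d1: "d1 > 0" "\<And>(n::nat) a b.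
        (\<forall>k<n. a k \<in> S \<and> b k \<in> S \<and> a k \<le> b k) \<Longrightarrow>
        disjoint_family_on (\<lambda>k. {a k<..<b k}) {..<n} \<Longrightarrow>
        (\<Sum>k<n. b k - a k) < d1 \<Longrightarrow>
        (\<Sum>k<n. norm (f (b k) - f (a k))) < e"
    using f \<open>e > 0\<close> unfolding absolutely_continuous_on_def by meson
  obtain d2 where d2: "d2 > 0" "\<And>(n::nat) a b.
        (\<forall>k<n. a k \<in> S \<and> b k \<in> S \<and> a k \<le> b k) \<Longrightarrow>
        disjoint_family_on (\<lambda>k. {a k<..<b k}) {..<n} \<Longrightarrow>
        (\<Sum>k<n. b k - a k) < d2 \<Longrightarrow>
        (\<Sum>k<n. norm (g (b k) - g (a k))) < e"
    using g \<open>e > 0\<close> unfolding absolutely_continuous_on_def by meson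
  show "\<exists>\<delta>>0. \<forall>(n::nat) a b. (\<forall>k<n. a k \<in> S \<and> b k \<in> S \<and> a k \<le> b k) \<and>
         disjoint_family_on (\<lambda>k. {a k<..<b k}) {..<n} \<and> (\<Sum>k<n. b k - a k) < \<delta> \<longrightarrow>
         (\<Sum>k<n. norm (h (b k) - h (a k))) < \<epsilon>"
  proof (intro exI[of _ "min d1 d2"] conjI allI impI)
    fix n :: nat and a b
    assume H: "(\<forall>k<n. a k \<in> S \<and> b k \<in> S \<and> a k \<le> b k) \<and>
         disjoint_family_on (\<lambda>k. {a k<..<b k}) {..<n} \<and> (\<Sum>k<n. b k - a k) < min d1 d2"
    have "(\<Sum>k<n. norm (h (b k) - h (a k))) \<le>
      (\<Sum>k<n. M * norm (f (b k) - f (a k)) + M * norm (g (b k) - g (a k)))"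
    proof (rule sum_mono)
      fix k assume "k \<in> {..<n}"
      then have "norm (h (b k) - h (a k)) \<le> K * norm (f (b k) - f (a k)) + L * norm (g (b k) - g (a k))"
        using H le by auto
      also have "\<dots> \<le> M * norm (f (b k) - f (a k)) + M * norm (g (b k) - g (a k))"
        using M by (intro add_mono mult_right_mono) auto
      finally show "norm (h (b k) - h (a k)) \<le> M * norm (f (b k) - f (a k)) + M * norm (g (b k) - g (a k))" .
    qed
    also have "\<dots> = M * (\<Sum>k<n. norm (f (b k) - f (a k))) + M * (\<Sum>k<n. norm (g (b k) - g (a k)))"
      by (simp add: sum.distrib sum_distrib_left)
    also have "\<dots> < M * e + M * e"
      using d1(2)[of n a b] d2(2)[of n a b] H M by (intro add_strict_mono mult_strict_left_mono) auto
    also have "\<dots> = \<epsilon>" unfolding e_def using M by (simp add: field_simps)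
    finally show "(\<Sum>k<n. norm (h (b k) - h (a k))) < \<epsilon>" .
  qed (use d1 d2 in auto)
qed

lemma absolutely_continuous_on_lipschitz_compose:
  fixes f :: "real \<Rightarrow> 'a::real_normed_vector"
  assumes "absolutely_continuous_on S f"
    and "\<And>x y. x \<in> S \<Longrightarrow> y \<in> S \<Longrightarrow> norm (h y - h x) \<le> K * norm (f y - f x)"
  shows "absolutely_continuous_on S h"
  by (rule absolutely_continuous_on_dominated[OF assms(1) assms(1), of h K 0]) (use assms(2) in auto)

lemma absolutely_continuous_on_ident: "absolutely_continuous_on S (\<lambda>x::real. x)"
  unfolding absolutely_continuous_on_def
  by (intro allI impI) (rule_tac x=\<epsilon> in exI, auto)

lemma absolutely_continuous_on_lipschitz:
  assumes "\<And>x y. x \<in> S \<Longrightarrow> y \<in> S \<Longrightarrow> norm (h y - h x) \<le> K * \<bar>y - x\<bar>"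
  shows "absolutely_continuous_on S h"
  by (rule absolutely_continuous_on_lipschitz_compose[OF absolutely_continuous_on_ident, of _ _ K])
     (use assms in auto)

lemma absolutely_continuous_on_const: "absolutely_continuous_on S (\<lambda>x. c)"
  by (rule absolutely_continuous_on_lipschitz[of _ _ 0]) auto

lemma absolutely_continuous_on_add:
  "absolutely_continuous_on S f \<Longrightarrow> absolutely_continuous_on S g \<Longrightarrow>
   absolutely_continuous_on S (\<lambda>x. f x + g x)"
  by (rule absolutely_continuous_on_dominated[of S f g _ 1 1])
     (auto intro: order_trans[OF _ norm_triangle_ineq] simp: algebra_simps)

lemma absolutely_continuous_on_bounded_linear:
  assumes "bounded_linear h" "absolutely_continuous_on S f"
  shows "absolutely_continuous_on S (\<lambda>x. h (f x))"
proof -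
  obtain K where "\<And>x. norm (h x) \<le> norm x * K"
    using bounded_linear.bounded[OF assms(1)] by blast
  then show ?thesis
    by (intro absolutely_continuous_on_lipschitz_compose[OF assms(2), of _ K])
       (metis assms(1) bounded_linear.linear linear_diff mult.commute)
qed

lemma absolutely_continuous_on_imp_uniformly_continuous:
  assumes f: "absolutely_continuous_on S f"
  shows "uniformly_continuous_on S f"
  unfolding uniformly_continuous_on_def
proof (intro allI impI)
  fix e :: real assume "e > 0"
  obtain \<delta> where \<delta>: "\<delta> > 0"
    "\<And>(I::nat set) a b. finite I \<Longrightarrow> (\<And>i. i \<in> I \<Longrightarrow> a i \<in> S \<and> b i \<in> S \<and> a i \<le> b i) \<Longrightarrow>
       disjoint_family_on (\<lambda>i. {a i<..<b i}) I \<Longrightarrow> (\<Sum>i\<in>I. b i - a i) < \<delta> \<Longrightarrow>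
       (\<Sum>i\<in>I. norm (f (b i) - f (a i))) < e"
    using absolutely_continuous_on_finite_family[OF f \<open>e > 0\<close>, where ?'i = nat] by blast
  show "\<exists>d>0. \<forall>x\<in>S. \<forall>x'\<in>S. dist x' x < d \<longrightarrow> dist (f x') (f x) < e"
  proof (intro exI[of _ \<delta>] conjI ballI impI)
    fix x x' assume H: "x \<in> S" "x' \<in> S" "dist x' x < \<delta>"
    \<comment> \<open>A family consisting of one interval; \<open>min\<close> and \<open>max\<close>
      put the two points in order.\<close>
    have "(\<Sum>i\<in>{0::nat}. norm (f (max x x') - f (min x x'))) < e"
      by (rule \<delta>(2)) (use H in \<open>auto simp: disjoint_family_on_def dist_real_def max_def min_def\<close>)
    then show "dist (f x') (f x) < e"
      by (simp add: max_def min_def dist_norm norm_minus_commute split: if_splits)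
  qed (use \<delta> in auto)
qed

lemma absolutely_continuous_on_imp_continuous_on:
  "absolutely_continuous_on S f \<Longrightarrow> continuous_on S f"
  by (intro uniformly_continuous_imp_continuous absolutely_continuous_on_imp_uniformly_continuous)

lemma absolutely_continuous_on_imp_bounded:
  fixes f :: "real \<Rightarrow> 'a::euclidean_space"
  shows "absolutely_continuous_on S f \<Longrightarrow> bounded S \<Longrightarrow> bounded (f ` S)"
  by (intro bounded_uniformly_continuous_image absolutely_continuous_on_imp_uniformly_continuous)

lemma absolutely_continuous_on_mult:
  fixes f g :: "real \<Rightarrow> 'a::{real_normed_algebra,euclidean_space}"
  assumes f: "absolutely_continuous_on S f" and g: "absolutely_continuous_on S g" and S: "bounded S"
  shows "absolutely_continuous_on S (\<lambda>x. f x * g x)"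
proof -
  obtain K where K: "\<And>x. x \<in> S \<Longrightarrow> norm (f x) \<le> K"
    using absolutely_continuous_on_imp_bounded[OF f S] by (auto simp: bounded_iff)
  obtain L where L: "\<And>x. x \<in> S \<Longrightarrow> norm (g x) \<le> L"
    using absolutely_continuous_on_imp_bounded[OF g S] by (auto simp: bounded_iff)
  show ?thesis
  proof (rule absolutely_continuous_on_dominated[OF f g, of _ L K])
    fix x y assume H: "x \<in> S" "y \<in> S"
    have "f y * g y - f x * g x = (f y - f x) * g y + f x * (g y - g x)"
      by (simp add: algebra_simps)
    also have "norm \<dots> \<le> norm (f y - f x) * norm (g y) + norm (f x) * norm (g y - g x)"
      by (intro norm_triangle_le add_mono norm_mult_ineq)
    also have "\<dots> \<le> norm (f y - f x) * L + K * norm (g y - g x)"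
      using H K L by (intro add_mono mult_left_mono mult_right_mono) auto
    finally show "norm (f y * g y - f x * g x) \<le> L * norm (f y - f x) + K * norm (g y - g x)"
      by (simp add: mult.commute)
  qed
qed

lemma absolutely_continuous_on_inverse:
  fixes f :: "real \<Rightarrow> real"
  assumes f: "absolutely_continuous_on S f" and e: "e > 0" "\<And>x. x \<in> S \<Longrightarrow> f x > e"
  shows "absolutely_continuous_on S (\<lambda>x. 1 / f x)"
proof (rule absolutely_continuous_on_lipschitz_compose[OF f, of _ "1 / e\<^sup>2"])
  fix x y assume H: "x \<in> S" "y \<in> S"
  then have p: "f x > e" "f y > e" "f x > 0" "f y > 0" using e by (auto intro: less_trans[OF e(1) e(2)])
  have "norm (1 / f y - 1 / f x) = norm (f y - f x) / (f x * f y)"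
    using p by (simp add: field_simps abs_if)
  also have "\<dots> \<le> norm (f y - f x) / e\<^sup>2"
    unfolding power2_eq_square using p e by (intro divide_left_mono mult_mono mult_pos_pos) auto
  finally show "norm (1 / f y - 1 / f x) \<le> 1 / e\<^sup>2 * norm (f y - f x)" by simp
qed

section \<open>The fundamental theorem of calculus for absolutely continuous functions\<close>

lemma sum_lengths_le_measure:
  fixes a b :: "'i \<Rightarrow> real"
  assumes "finite I" "\<And>i. i \<in> I \<Longrightarrow> a i \<le> b i" "disjoint_family_on (\<lambda>i. {a i<..<b i}) I"
    and "\<And>i. i \<in> I \<Longrightarrow> {a i<..<b i} \<subseteq> G" "G \<in> lmeasurable"
  shows "(\<Sum>i\<in>I. b i - a i) \<le> measure lebesgue G"
proof -
  have "(\<Sum>i\<in>I. b i - a i) = (\<Sum>i\<in>I. measure lebesgue {a i<..<b i})"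
    using assms by (intro sum.cong) auto
  also have "\<dots> = measure lebesgue (\<Union>i\<in>I. {a i<..<b i})"
    using assms by (intro measure_finite_Union[symmetric]) auto
  also have "\<dots> \<le> measure lebesgue G"
    using assms by (intro measure_mono_fmeasurable) auto
  finally show ?thesis .
qed

text \<open>The exceptional set is an explicit null set, so that exceptional sets of several
  functions are combined by unions. The derivative is two-sided even on a closed interval; end
  points where it fails are put into the null set.\<close>

definition ac_deriv :: "real set \<Rightarrow> (real \<Rightarrow> 'a::real_normed_vector) \<Rightarrow> (real \<Rightarrow> 'a) \<Rightarrow> bool" where
  "ac_deriv S f f' \<longleftrightarrow> absolutely_continuous_on S f \<and>
     (\<exists>N. negligible N \<and> (\<forall>x\<in>S - N. (f has_vector_derivative f' x) (at x)))"

lemma open_superset_small_measure: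
  fixes N :: "real set"
  assumes "negligible N" "e > 0"
  obtains G where "open G" "N \<subseteq> G" "G \<in> lmeasurable" "measure lebesgue G < e"
proof -
  have N: "N \<in> sets lebesgue" using assms(1) by (simp add: negligible_imp_sets)
  obtain T where T: "open T" "N \<subseteq> T" "(T - N) \<in> lmeasurable" "emeasure lebesgue (T - N) < ennreal e"
    using sets_lebesgue_outer_open[OF N assms(2)] .
  have "T = (T - N) \<union> N" using T by auto
  moreover have "N \<in> lmeasurable" "measure lebesgue N = 0"
    using assms(1) by (auto simp: negligible_iff_measure)
  ultimately have "T \<in> lmeasurable" using T(3) by (metis fmeasurable.Un)
  moreover have "measure lebesgue T \<le> measure lebesgue (T - N) + measure lebesgue N"
    using \<open>T = (T - N) \<union> N\<close> T(3) \<open>N \<in> lmeasurable\<close> measure_Un_le[of "T - N" lebesgue N]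
    by (metis fmeasurableD)
  moreover have "measure lebesgue (T - N) < e"
    using T(3,4) assms(2) by (simp add: emeasure_eq_measure2 ennreal_less_iff)
  ultimately show ?thesis using that[of T] T \<open>measure lebesgue N = 0\<close> by auto
qed

text \<open>The gauge is chosen so that the intervals tagged in the exceptional null set lie in an open
  set of small measure; absolute continuity bounds the increments over them.\<close>

lemma ac_deriv_has_integral:
  fixes f :: "real \<Rightarrow> 'a::banach"
  assumes f: "ac_deriv {a..b} f f'" and "a \<le> b"
  shows "(f' has_integral (f b - f a)) {a..b}"
proof -
  obtain N0 where N0: "negligible N0" "\<And>x. x \<in> {a..b} - N0 \<Longrightarrow> (f has_vector_derivative f' x) (at x)"
    and ac: "absolutely_continuous_on {a..b} f"
    using f unfolding ac_deriv_def by blast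
  \<comment> \<open>With value 0 on the exceptional set, a term of the Riemann sum tagged there
    reduces to an increment of f, which absolute continuity controls.\<close>
  define g where "g x = (if x \<in> N0 then 0 else f' x)" for x
  have "(g has_integral (f b - f a)) (cbox a b)"
    unfolding has_integral
  proof safe
    fix e :: real assume "e > 0"
    \<comment> \<open>The terms with good tags contribute at most e1 * (b - a), which is at most e /
      4; the summand 1 keeps the quotient meaningful for a = b.\<close>
    define e1 where "e1 = e / (4 * (b - a + 1))"
    have "e1 > 0" unfolding e1_def using \<open>e > 0\<close> \<open>a \<le> b\<close> by auto
    obtain \<delta> where \<delta>: "\<delta> > 0"
      "\<And>(I::(real \<times> real set) set) a' b'. finite I \<Longrightarrow> (\<And>i. i \<in> I \<Longrightarrow> a' i \<in> {a..b} \<and> b' i \<in> {a..b} \<and> a' i \<le> b' i) \<Longrightarrow>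
       disjoint_family_on (\<lambda>i. {a' i<..<b' i}) I \<Longrightarrow> (\<Sum>i\<in>I. b' i - a' i) < \<delta> \<Longrightarrow>
       (\<Sum>i\<in>I. norm (f (b' i) - f (a' i))) < e / 2"
      using absolutely_continuous_on_finite_family[OF ac, of "e/2", where ?'i = "real \<times> real set"] \<open>e > 0\<close> by auto
    obtain G where G: "open G" "N0 \<subseteq> G" "G \<in> lmeasurable" "measure lebesgue G < \<delta>"
      using open_superset_small_measure[OF N0(1) \<delta>(1)] .
    have "\<forall>x. \<exists>d>0. (x \<in> N0 \<longrightarrow> ball x d \<subseteq> G) \<and> (x \<in> {a..b} - N0 \<longrightarrow>
        (\<forall>y. norm (y-x) < d \<longrightarrow> norm (f y - f x - (y-x) *\<^sub>R f' x) \<le> e1 * norm (y-x)))"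
    proof
      fix x
      consider "x \<in> N0" | "x \<in> {a..b} - N0" | "x \<notin> N0" "x \<notin> {a..b} - N0" by blast
      then show "\<exists>d>0. (x \<in> N0 \<longrightarrow> ball x d \<subseteq> G) \<and> (x \<in> {a..b} - N0 \<longrightarrow>
        (\<forall>y. norm (y-x) < d \<longrightarrow> norm (f y - f x - (y-x) *\<^sub>R f' x) \<le> e1 * norm (y-x)))"
      proof cases
        case 1
        then show ?thesis using G by (meson DiffD2 open_contains_ball subsetD)
      next
        case 2
        then have "(f has_derivative (\<lambda>h. h *\<^sub>R f' x)) (at x)"
          using N0(2) by (simp add: has_vector_derivative_def)
        then show ?thesis using 2 \<open>e1 > 0\<close> unfolding has_derivative_at_alt by blast
      qed (auto intro: exI[of _ 1])
    qed
    then obtain d where d: "\<And>x. d x > 0" "\<And>x. x \<in> N0 \<Longrightarrow> ball x (d x) \<subseteq> G"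
      "\<And>x y. x \<in> {a..b} - N0 \<Longrightarrow> norm (y-x) < d x \<Longrightarrow> norm (f y - f x - (y-x) *\<^sub>R f' x) \<le> e1 * norm (y-x)"
      by metis
    show "\<exists>\<gamma>. gauge \<gamma> \<and> (\<forall>\<D>. \<D> tagged_division_of cbox a b \<and> \<gamma> fine \<D> \<longrightarrow>
          norm ((\<Sum>(x, k)\<in>\<D>. measure lborel k *\<^sub>R g x) - (f b - f a)) < e)"
    proof (rule exI[of _ "\<lambda>x. ball x (d x)"], safe)
      show "gauge (\<lambda>x. ball x (d x))" using d(1) gauge_ball_dependent by blast
    next
      fix p
      assume ptag: "p tagged_division_of cbox a b" and fine: "(\<lambda>x. ball x (d x)) fine p"
      have fin: "finite p" using ptag by blast
      have fab: "f b - f a = (\<Sum>(x,K)\<in>p. f (Sup K) - f (Inf K))" and ba: "b - a = (\<Sum>(x,K)\<in>p. Sup K - Inf K)"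
        using additive_tagged_division_1[OF \<open>a \<le> b\<close>, of p f]
          additive_tagged_division_1[OF \<open>a \<le> b\<close>, of p "\<lambda>x. x"] ptag by auto
      have K: "K = {Inf K..Sup K}" "Inf K \<le> x" "x \<le> Sup K" "Inf K \<in> {a..b}" "Sup K \<in> {a..b}"
          "measure lborel K = Sup K - Inf K" "K \<subseteq> ball x (d x)" "Inf K \<in> K" "Sup K \<in> K"
        if pK: "(x,K) \<in> p" for x K
      proof -
        obtain u v where uv: "K = cbox u v"
          using tagged_division_ofD(4)[OF ptag pK] by blast
        have "x \<in> K" "K \<subseteq> cbox a b"
          using tagged_division_ofD(2,3)[OF ptag pK] by auto
        then have "u \<le> x" "x \<le> v" "a \<le> u" "v \<le> b" using uv by auto
        then show "K = {Inf K..Sup K}" "Inf K \<le> x" "x \<le> Sup K" "Inf K \<in> {a..b}" "Sup K \<in> {a..b}"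
          "measure lborel K = Sup K - Inf K" "Inf K \<in> K" "Sup K \<in> K" using uv by auto
        show "K \<subseteq> ball x (d x)" using fine pK by blast
      qed
      let ?P = "{q\<in>p. fst q \<in> N0}" and ?Q = "{q\<in>p. fst q \<notin> N0}"
      have bad: "(\<Sum>q\<in>?P. norm (f (Sup (snd q)) - f (Inf (snd q)))) < e / 2"
      proof (rule \<delta>(2))
        show "disjoint_family_on (\<lambda>i. {Inf (snd i)<..<Sup (snd i)}) ?P"
          unfolding disjoint_family_on_def
        proof (intro ballI impI)
          fix q r assume qr: "q \<in> ?P" "r \<in> ?P" "q \<noteq> r"
          obtain x K y L where eq: "q = (x,K)" "r = (y,L)" by (cases q, cases r)
          have "interior K \<inter> interior L = {}"
            using tagged_division_ofD(5)[OF ptag, of x K y L] qr eq by auto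
          moreover have "interior K = {Inf K<..<Sup K}" "interior L = {Inf L<..<Sup L}"
            using K(1)[of x K] K(1)[of y L] qr eq by (metis (no_types, lifting) mem_Collect_eq interior_atLeastAtMost_real)+
          ultimately show "{Inf (snd q)<..<Sup (snd q)} \<inter> {Inf (snd r)<..<Sup (snd r)} = {}"
            using eq by simp
        qed
        then have "(\<Sum>i\<in>?P. Sup (snd i) - Inf (snd i)) \<le> measure lebesgue G"
        proof (rule sum_lengths_le_measure[rotated 2])
          fix q assume q: "q \<in> ?P"
          then show "{Inf (snd q)<..<Sup (snd q)} \<subseteq> G"
            using K(1,7)[of "fst q" "snd q"] d(2)[of "fst q"]
            by (metis (no_types, lifting) atLeastAtMost_iff greaterThanLessThan_subseteq_atLeastAtMost_iff mem_Collect_eq order_refl prod.collapse subset_trans)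
          show "Inf (snd q) \<le> Sup (snd q)" using K(2,3)[of "fst q" "snd q"] q by simp
        qed (use fin G in auto)
        then show "(\<Sum>i\<in>?P. Sup (snd i) - Inf (snd i)) < \<delta>" using G by simp
        fix q assume q: "q \<in> ?P"
        show "Inf (snd q) \<in> {a..b} \<and> Sup (snd q) \<in> {a..b} \<and> Inf (snd q) \<le> Sup (snd q)"
          using K[of "fst q" "snd q"] q by auto
      qed (use fin in auto)
      have good: "(\<Sum>q\<in>?Q. norm (measure lborel (snd q) *\<^sub>R g (fst q) - (f (Sup (snd q)) - f (Inf (snd q))))) \<le> (\<Sum>q\<in>?Q. e1 * (Sup (snd q) - Inf (snd q)))"
      proof (rule sum_mono)
        fix q assume q: "q \<in> ?Q"
        obtain x L where eq: "q = (x,L)" by (cases q)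
        then have L: "(x,L) \<in> p" "x \<notin> N0" using q by auto
        note KL = K[OF L(1)]
        define u v where "u = Inf L" and "v = Sup L"
        have x: "x \<in> {a..b} - N0" using KL L by auto
        have "norm (u - x) < d x" "norm (v - x) < d x"
          using KL(7,8,9) unfolding u_def v_def by (auto simp: subset_iff dist_norm norm_minus_commute)
        note b = d(3)[OF x this(1)] d(3)[OF x this(2)]
        \<comment> \<open>Straddle estimate: the tag x lies between u and v, so the two errors e1 |u
          - x| and e1 |v - x| add up to e1 (v - u).\<close>
        have "measure lborel L *\<^sub>R g x - (f v - f u) = (f u - f x - (u-x) *\<^sub>R f' x) - (f v - f x - (v-x) *\<^sub>R f' x)"
          using L unfolding u_def v_def g_def KL(6) by (simp add: algebra_simps)
        also have "norm \<dots> \<le> e1 * norm (u-x) + e1 * norm (v-x)"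
          by (rule order_trans[OF norm_triangle_ineq4 add_mono[OF b]])
        also have "\<dots> = e1 * (v - u)" using KL(2,3) unfolding u_def v_def by (simp add: algebra_simps)
        finally show "norm (measure lborel (snd q) *\<^sub>R g (fst q) - (f (Sup (snd q)) - f (Inf (snd q)))) \<le> e1 * (Sup (snd q) - Inf (snd q))"
          using eq u_def v_def by simp
      qed
      also have "\<dots> \<le> (\<Sum>q\<in>p. e1 * (Sup (snd q) - Inf (snd q)))"
      proof (rule sum_mono2)
        show "\<And>q. q \<in> p - ?Q \<Longrightarrow> 0 \<le> e1 * (Sup (snd q) - Inf (snd q))"
          using K(2,3) \<open>e1 > 0\<close> by (force intro!: mult_nonneg_nonneg)
      qed (use fin in auto)
      also have "\<dots> = e1 * (b - a)"
        by (simp add: ba split_def sum_distrib_left)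
      also have "\<dots> \<le> e1 * (b - a + 1)" using \<open>e1 > 0\<close> by simp
      also have "\<dots> = e / 4" unfolding e1_def using \<open>a \<le> b\<close> by (simp add: divide_simps)
      also have "\<dots> < e / 2" using \<open>e > 0\<close> by simp
      finally have good: "(\<Sum>q\<in>?Q. norm (measure lborel (snd q) *\<^sub>R g (fst q) - (f (Sup (snd q)) - f (Inf (snd q))))) < e / 2" .
      have "(\<Sum>(x, k)\<in>p. measure lborel k *\<^sub>R g x) - (f b - f a) = (\<Sum>q\<in>p. measure lborel (snd q) *\<^sub>R g (fst q) - (f (Sup (snd q)) - f (Inf (snd q))))"
        unfolding fab by (simp add: split_def sum_subtractf)
      also have "norm \<dots> \<le> (\<Sum>q\<in>p. norm (measure lborel (snd q) *\<^sub>R g (fst q) - (f (Sup (snd q)) - f (Inf (snd q)))))"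
        by (rule norm_sum)
      also have "\<dots> = (\<Sum>q\<in>?P. norm (measure lborel (snd q) *\<^sub>R g (fst q) - (f (Sup (snd q)) - f (Inf (snd q)))))
        + (\<Sum>q\<in>?Q. norm (measure lborel (snd q) *\<^sub>R g (fst q) - (f (Sup (snd q)) - f (Inf (snd q)))))"
        using fin by (subst sum.union_disjoint[symmetric]) (auto intro!: sum.cong)
      also have "(\<Sum>q\<in>?P. norm (measure lborel (snd q) *\<^sub>R g (fst q) - (f (Sup (snd q)) - f (Inf (snd q)))))
         = (\<Sum>q\<in>?P. norm (f (Sup (snd q)) - f (Inf (snd q))))"
        by (intro sum.cong) (auto simp: g_def norm_minus_commute)
      finally show "norm ((\<Sum>(x, k)\<in>p. measure lborel k *\<^sub>R g x) - (f b - f a)) < e"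
        using bad good by linarith
    qed
  qed
  then have "(g has_integral (f b - f a)) {a..b}" by simp
  then show ?thesis
    by (rule has_integral_spike[OF N0(1), rotated]) (auto simp: g_def)
qed

section \<open>Lebesgue differentiation\<close>

text \<open>By Henstock's lemma, disjoint short intervals over which the increment of the indefinite integral
  differs from its linear approximation by more than a fixed proportion have small total length;
  Vitali's theorem covers the points of non-differentiability by such intervals.\<close>

lemma bad_points_of_indefinite_integral_negligible:
  fixes f :: "real \<Rightarrow> 'a::euclidean_space"
  assumes f: "f integrable_on {a..b}" and "c > 0"
  shows "negligible {x\<in>{a<..<b}. \<forall>d>0. \<exists>u v. u < v \<and> u \<in> {a..b} \<and> v \<in> {a..b} \<and> v - u < d \<and> (x = u \<or> x = v) \<and>
     norm (integral {u..v} f - (v - u) *\<^sub>R f x) > c * (v - u)}" (is "negligible ?E")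
  unfolding negligible_outer_le
proof (intro allI impI)
  fix \<epsilon> :: real assume "\<epsilon> > 0"
  \<comment> \<open>Every selected interval contributes more than c times its length to the Henstock
    sum, so the threshold c * \<epsilon> bounds the total length by \<epsilon>.\<close>
  then have e: "c * \<epsilon> > 0" using \<open>c > 0\<close> by simp
  obtain \<gamma> where g: "gauge \<gamma>"
    and \<gamma>: "\<And>p. \<lbrakk>p tagged_partial_division_of (cbox a b); \<gamma> fine p\<rbrakk> \<Longrightarrow>
             sum (\<lambda>(x,k). norm(measure lborel k *\<^sub>R f x - integral k f)) p < c * \<epsilon>"
    using Henstock_lemma[of f a b, OF _ e] f by auto
  define K where "K = {(x,u,v). u < v \<and> u \<in> {a..b} \<and> v \<in> {a..b} \<and> (x = u \<or> x = v) \<and> {u..v} \<subseteq> \<gamma> x \<and>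
     norm (integral {u..v} f - (v - u) *\<^sub>R f x) > c * (v - u)}"
  have KD: "fst (snd i) < snd (snd i)" "fst (snd i) \<in> {a..b}" "snd (snd i) \<in> {a..b}"
     "fst i = fst (snd i) \<or> fst i = snd (snd i)" "{fst (snd i)..snd (snd i)} \<subseteq> \<gamma> (fst i)"
     "norm (integral {fst (snd i)..snd (snd i)} f - (snd (snd i) - fst (snd i)) *\<^sub>R f (fst i)) > c * (snd (snd i) - fst (snd i))"
    if "i \<in> K" for i
    using that unfolding K_def by (cases i; simp)+
  \<comment> \<open>Vitali's theorem is applied in its version for closed balls, so each interval is
    recoded by its midpoint and half its length.\<close>
  let ?c = "\<lambda>(x::real,u,v). (u+v)/2 :: real" and ?r = "\<lambda>(x::real,u,v). (v-u)/2 :: real"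
  have ball: "cball (?c i) (?r i) = {fst (snd i)..snd (snd i)}" for i
    by (auto simp: cball_eq_atLeastAtMost split_def field_simps)
  obtain C where C: "countable C" "C \<subseteq> K"
     "pairwise (\<lambda>i j. disjnt (cball (?c i) (?r i)) (cball (?c j) (?r j))) C"
     "negligible(?E - (\<Union>i \<in> C. cball (?c i) (?r i)))"
  proof (rule Vitali_covering_theorem_cballs[of K ?r ?E ?c])
    show "\<And>i. i \<in> K \<Longrightarrow> 0 < ?r i" by (auto simp: K_def)
  next
    fix x d assume x: "x \<in> ?E" and "(0::real) < d"
    obtain \<eta> where \<eta>: "\<eta> > 0" "ball x \<eta> \<subseteq> \<gamma> x"
      using g unfolding gauge_def by (meson open_contains_ball)
    have "0 < min d \<eta>" using \<open>0 < d\<close> \<eta> by simp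
    then obtain u v where uv: "u < v" "u \<in> {a..b}" "v \<in> {a..b}" "v - u < min d \<eta>" "x = u \<or> x = v"
       "norm (integral {u..v} f - (v - u) *\<^sub>R f x) > c * (v - u)"
      using x by blast
    have "{u..v} \<subseteq> ball x \<eta>" using uv by (auto simp: dist_real_def)
    then have "{u..v} \<subseteq> \<gamma> x" using \<eta> by blast
    then have "(x,u,v) \<in> K" using uv by (simp add: K_def)
    moreover have "x \<in> cball (?c (x,u,v)) (?r (x,u,v))" unfolding ball using uv by auto
    moreover have "?r (x,u,v) < d" using uv by simp
    ultimately show "\<exists>i. i \<in> K \<and> x \<in> cball (?c i) (?r i) \<and> ?r i < d" by blast
  qed blast
  have fin: "(\<Sum>i\<in>F. snd (snd i) - fst (snd i)) \<le> \<epsilon>" if F: "finite F" "F \<subseteq> C" for F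
  proof -
    let ?h = "\<lambda>i. (fst i, {fst (snd i)..snd (snd i)})"
    let ?p = "?h ` F"
    have FK: "i \<in> K" if "i \<in> F" for i using that F C by blast
    have inj: "inj_on ?h F"
    proof (rule inj_onI)
      fix i j assume ij: "i \<in> F" "j \<in> F" "?h i = ?h j"
      have "fst (snd i) < snd (snd i)" "fst (snd j) < snd (snd j)" using ij FK KD(1) by blast+
      then show "i = j" using ij(3) by (auto simp: prod_eq_iff Icc_eq_Icc)
    qed
    have part: "?p tagged_partial_division_of (cbox a b)"
      unfolding tagged_partial_division_of_def
    proof (intro conjI allI impI)
      show "finite ?p" using F by simp
    next
      fix x k assume "(x,k) \<in> ?p"
      then obtain i where i: "i \<in> F" "x = fst i" "k = {fst (snd i)..snd (snd i)}" by auto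
      then show "x \<in> k" "k \<subseteq> cbox a b" "\<exists>a b. k = cbox a b" using KD[OF FK[OF i(1)]]
        by auto
    next
      fix x1 k1 x2 k2 assume xk: "(x1,k1) \<in> ?p \<and> (x2,k2) \<in> ?p \<and> (x1,k1) \<noteq> (x2,k2)"
      obtain i where i: "i \<in> F" "(x1,k1) = ?h i" using xk by blast
      obtain j where j: "j \<in> F" "(x2,k2) = ?h j" using xk by blast
      have ij: "i \<in> F" "j \<in> F" "i \<noteq> j" "k1 = {fst (snd i)..snd (snd i)}" "k2 = {fst (snd j)..snd (snd j)}"
        using i j xk by auto
      then have "disjnt k1 k2" using C(3) F(2) unfolding pairwise_def ball by blast
      then show "interior k1 \<inter> interior k2 = {}"
        using interior_subset[of k1] interior_subset[of k2] unfolding disjnt_def by blast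
    qed
    have "\<gamma> fine ?p" unfolding fine_def using FK KD(5) by auto
    then have lt: "sum (\<lambda>(x,k). norm(measure lborel k *\<^sub>R f x - integral k f)) ?p < c * \<epsilon>"
      using \<gamma>[OF part] by simp
    have eq: "sum (\<lambda>(x,k). norm(measure lborel k *\<^sub>R f x - integral k f)) ?p
       = (\<Sum>i\<in>F. norm((snd (snd i) - fst (snd i)) *\<^sub>R f (fst i) - integral {fst (snd i)..snd (snd i)} f))"
      unfolding sum.reindex[OF inj]
    proof (rule sum.cong)
      fix i assume "i \<in> F"
      then have "fst (snd i) < snd (snd i)" using FK KD(1) by blast
      then show "((\<lambda>(x,k). norm(measure lborel k *\<^sub>R f x - integral k f)) \<circ> ?h) i
        = norm((snd (snd i) - fst (snd i)) *\<^sub>R f (fst i) - integral {fst (snd i)..snd (snd i)} f)"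
        by simp
    qed simp
    have "(\<Sum>i\<in>F. c * (snd (snd i) - fst (snd i))) \<le> (\<Sum>i\<in>F. norm((snd (snd i) - fst (snd i)) *\<^sub>R f (fst i) - integral {fst (snd i)..snd (snd i)} f))"
    proof (rule sum_mono)
      fix i assume "i \<in> F"
      then have "i \<in> K" using FK by simp
      then show "c * (snd (snd i) - fst (snd i)) \<le> norm((snd (snd i) - fst (snd i)) *\<^sub>R f (fst i) - integral {fst (snd i)..snd (snd i)} f)"
        using KD(6)[of i] by (simp add: norm_minus_commute)
    qed
    then have "c * (\<Sum>i\<in>F. snd (snd i) - fst (snd i)) < c * \<epsilon>"
      using lt unfolding eq by (simp add: sum_distrib_left)
    then show ?thesis using \<open>c > 0\<close> by simp
  qed
  let ?U = "\<Union>i \<in> C. cball (?c i) (?r i)"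
  have meas1: "cball (?c i) (?r i) \<in> lmeasurable" for i unfolding ball by simp
  have meas2: "measure lebesgue (\<Union>i\<in>F. cball (?c i) (?r i)) \<le> \<epsilon>" if F: "F \<subseteq> C" "finite F" for F
  proof -
    have "measure lebesgue (\<Union>i\<in>F. cball (?c i) (?r i)) \<le> (\<Sum>i\<in>F. measure lebesgue (cball (?c i) (?r i)))"
      by (intro measure_UNION_le F) (use meas1 in auto)
    also have "\<dots> = (\<Sum>i\<in>F. snd (snd i) - fst (snd i))"
    proof (rule sum.cong)
      fix i assume "i \<in> F"
      then have "i \<in> K" using F C by blast
      then show "measure lebesgue (cball (?c i) (?r i)) = snd (snd i) - fst (snd i)"
        unfolding ball using KD(1)[of i] by simp
    qed simp
    finally show ?thesis using fin F by force
  qed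
  have meas: "?U \<in> lmeasurable" "measure lebesgue ?U \<le> \<epsilon>"
    using fmeasurable_UN_bound[OF C(1) meas1 meas2] measure_UN_bound[OF C(1) meas1 meas2] by auto
  have "measure lebesgue (?U \<union> (?E - ?U)) \<le> measure lebesgue ?U + measure lebesgue (?E - ?U)"
    using meas C(4) by (intro measure_Un_le) (auto simp: negligible_imp_sets fmeasurableD)
  moreover have "measure lebesgue (?E - ?U) = 0" using C(4) by (rule negligible_imp_measure0)
  moreover have "?U \<union> (?E - ?U) \<in> lmeasurable"
    by (intro fmeasurable.Un meas negligible_imp_measurable C(4))
  ultimately show "\<exists>T. ?E \<subseteq> T \<and> T \<in> lmeasurable \<and> measure lebesgue T \<le> \<epsilon>"
    using meas by (intro exI[of _ "?U \<union> (?E - ?U)"]) auto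
qed

text \<open>The bad sets for the proportions 1 / (n + 1) have a null union, and off this union every
  error of the difference quotient is eventually below each proportion. The end points are discarded
  because the derivative is two-sided.\<close>

lemma indefinite_integral_has_derivative_ae:
  fixes f :: "real \<Rightarrow> 'a::euclidean_space"
  assumes f: "f integrable_on {a..b}"
  shows "\<exists>N. negligible N \<and> (\<forall>x\<in>{a..b} - N. ((\<lambda>x. integral {a..x} f) has_vector_derivative f x) (at x))"
proof -
  let ?P = "\<lambda>c x. \<forall>d>0. \<exists>u v. u < v \<and> u \<in> {a..b} \<and> v \<in> {a..b} \<and> v - u < d \<and> (x = u \<or> x = v) \<and>
     norm (integral {u..v} f - (v - u) *\<^sub>R f x) > c * (v - u)"
  define E where "E n = {x\<in>{a<..<b}. ?P (inverse (real (Suc n))) x}" for n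
  have "negligible (E n)" for n
    unfolding E_def by (rule bad_points_of_indefinite_integral_negligible[OF f]) simp
  then have N: "negligible (\<Union> (range E) \<union> {a,b})"
    by (intro negligible_Un negligible_countable_Union) auto
  show ?thesis
  proof (intro exI conjI ballI)
    fix x assume x: "x \<in> {a..b} - (\<Union> (range E) \<union> {a,b})"
    then have xab: "a < x" "x < b" by auto
    show "((\<lambda>x. integral {a..x} f) has_vector_derivative f x) (at x)"
      unfolding has_vector_derivative_def has_derivative_at_alt
    proof (intro conjI allI impI)
      fix e :: real assume "e > 0"
      then obtain n where n: "inverse (real (Suc n)) < e" using reals_Archimedean by blast
      have "\<not> ?P (inverse (real (Suc n))) x"
        using x xab by (auto simp: E_def)
      then obtain d where d: "d > 0" "\<And>u v. u < v \<Longrightarrow> u \<in> {a..b} \<Longrightarrow> v \<in> {a..b} \<Longrightarrow> v - u < d \<Longrightarrow> x = u \<or> x = v \<Longrightarrow>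
          norm (integral {u..v} f - (v - u) *\<^sub>R f x) \<le> inverse (real (Suc n)) * (v - u)"
        by (meson not_less)
      show "\<exists>d>0. \<forall>y. norm (y - x) < d \<longrightarrow>
         norm (integral {a..y} f - integral {a..x} f - (y - x) *\<^sub>R f x) \<le> e * norm (y - x)"
      proof (intro exI[of _ "min d (min (x - a) (b - x))"] conjI allI impI)
        fix y assume y: "norm (y - x) < min d (min (x - a) (b - x))"
        have split: "integral {a..u} f + integral {u..v} f = integral {a..v} f" if "a \<le> u" "u \<le> v" "v \<le> b" for u v
          using that integrable_subinterval_real[OF f, of a v]
          by (intro Henstock_Kurzweil_Integration.integral_combine) auto
        consider "y = x" | "y < x" | "x < y" by linarith
        then show "norm (integral {a..y} f - integral {a..x} f - (y - x) *\<^sub>R f x) \<le> e * norm (y - x)"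
        proof cases
          case 2
          have "integral {a..y} f - integral {a..x} f - (y - x) *\<^sub>R f x = - (integral {y..x} f - (x - y) *\<^sub>R f x)"
            using split[of y x] 2 y xab by (simp add: algebra_simps)
          then have "norm (integral {a..y} f - integral {a..x} f - (y - x) *\<^sub>R f x) = norm (integral {y..x} f - (x - y) *\<^sub>R f x)"
            by (simp only: norm_minus_cancel)
          also have "\<dots> \<le> inverse (real (Suc n)) * (x - y)" using 2 y xab by (intro d(2)) auto
          also have "\<dots> \<le> e * (x - y)" using 2 n by (intro mult_right_mono) auto
          finally show ?thesis using 2 by simp
        next
          case 3
          have "integral {a..y} f - integral {a..x} f - (y - x) *\<^sub>R f x = integral {x..y} f - (y - x) *\<^sub>R f x"
            using split[of x y] 3 y xab by (simp add: algebra_simps)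
          then have "norm (integral {a..y} f - integral {a..x} f - (y - x) *\<^sub>R f x) = norm (integral {x..y} f - (y - x) *\<^sub>R f x)"
            by simp
          also have "\<dots> \<le> inverse (real (Suc n)) * (y - x)" using 3 y xab by (intro d(2)) auto
          also have "\<dots> \<le> e * (y - x)" using 3 n by (intro mult_right_mono) auto
          finally show ?thesis using 3 by simp
        qed simp
      qed (use d xab in auto)
    qed (auto intro: bounded_linear_scaleR_left)
  qed (use N in simp)
qed

text \<open>Truncation at height n: what exceeds n has integral below e / 2 by dominated
  convergence, and the rest contributes at most n times the measure of A, which the choice d = e /
  (2 (n + 1)) keeps below e / 2.\<close>

lemma absolutely_integrable_small_on_small_sets:
  fixes f :: "real \<Rightarrow> 'a::euclidean_space"
  assumes f: "f absolutely_integrable_on S" and S: "S \<in> sets lebesgue" and "e > 0"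
  obtains d where "d > 0" "\<And>A. A \<subseteq> S \<Longrightarrow> A \<in> lmeasurable \<Longrightarrow> measure lebesgue A < d \<Longrightarrow> (LINT x:A|lebesgue. norm (f x)) < e"
proof -
  define g where "g x = indicator S x *\<^sub>R norm (f x)" for x
  have g: "integrable lebesgue g"
    using set_integrable_norm[OF f] unfolding set_integrable_def g_def .
  have g0: "0 \<le> g x" for x by (simp add: g_def)
  have gS: "x \<in> S \<Longrightarrow> norm (f x) = g x" for x by (simp add: g_def)
  have gm: "g \<in> borel_measurable lebesgue" using g by (rule borel_measurable_integrable)
  have "(\<lambda>n. LINT x|lebesgue. min (g x) (real n)) \<longlonglongrightarrow> (LINT x|lebesgue. g x)"
  proof (rule integral_dominated_convergence[where w=g])
    show "AE x in lebesgue. (\<lambda>n. min (g x) (real n)) \<longlonglongrightarrow> g x"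
    proof (rule AE_I2)
      fix x
      have "eventually (\<lambda>n. min (g x) (real n) = g x) sequentially"
        using eventually_ge_at_top[of "nat \<lceil>g x\<rceil>"] by eventually_elim linarith
      then show "(\<lambda>n. min (g x) (real n)) \<longlonglongrightarrow> g x" by (rule tendsto_eventually)
    qed
    show "(\<lambda>x. min (g x) (real n)) \<in> borel_measurable lebesgue" for n by (intro borel_measurable_min gm borel_measurable_const)
    show "AE x in lebesgue. norm (min (g x) (real n)) \<le> g x" for n using g0 by (auto simp: min_def)
  qed (fact g gm)+
  then have "eventually (\<lambda>n. dist (LINT x|lebesgue. min (g x) (real n)) (LINT x|lebesgue. g x) < e/2) sequentially"
    using \<open>e > 0\<close> by (intro tendstoD) auto
  then obtain n where n: "dist (LINT x|lebesgue. min (g x) (real n)) (LINT x|lebesgue. g x) < e/2"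
    using eventually_happens'[OF sequentially_bot] by blast
  have gn: "integrable lebesgue (\<lambda>x. min (g x) (real n))"
  proof (rule Bochner_Integration.integrable_bound[OF g])
    show "(\<lambda>x. min (g x) (real n)) \<in> borel_measurable lebesgue" by (intro borel_measurable_min gm borel_measurable_const)
    show "AE x in lebesgue. norm (min (g x) (real n)) \<le> norm (g x)" using g0 by (auto simp: min_def)
  qed
  show ?thesis
  proof (rule that[of "e / (2 * (real n + 1))"])
    fix A assume A: "A \<subseteq> S" "A \<in> lmeasurable" "measure lebesgue A < e / (2 * (real n + 1))"
    have As: "A \<in> sets lebesgue" using A(2) by (rule fmeasurableD)
    have iA: "integrable lebesgue (\<lambda>x. real n * indicator A x)"
      using A by (intro integrable_mult_right integrable_real_indicator) (auto simp: fmeasurable_def)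
    have "(LINT x:A|lebesgue. norm (f x)) = (LINT x|lebesgue. indicator A x *\<^sub>R g x)"
      unfolding set_lebesgue_integral_def using A(1) gS by (intro Bochner_Integration.integral_cong) (auto simp: indicator_def)
    also have "\<dots> \<le> (LINT x|lebesgue. (g x - min (g x) (real n)) + real n * indicator A x)"
    proof (rule integral_mono)
      show "integrable lebesgue (\<lambda>x. indicator A x *\<^sub>R g x)"
        by (rule integrable_mult_indicator[OF As g])
      show "integrable lebesgue (\<lambda>x. (g x - min (g x) (real n)) + real n * indicator A x)"
        by (intro Bochner_Integration.integrable_add Bochner_Integration.integrable_diff g gn iA)
      show "indicator A x *\<^sub>R g x \<le> (g x - min (g x) (real n)) + real n * indicator A x" for x
        using g0[of x] by (auto simp: indicator_def min_def)
    qed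
    also have "\<dots> = (LINT x|lebesgue. g x) - (LINT x|lebesgue. min (g x) (real n)) + real n * measure lebesgue A"
      using As iA by (simp add: Bochner_Integration.integral_add[OF Bochner_Integration.integrable_diff[OF g gn] iA]
        Bochner_Integration.integral_diff[OF g gn])
    also have "\<dots> < e / 2 + e / 2"
    proof (rule add_less_le_mono)
      show "(LINT x|lebesgue. g x) - (LINT x|lebesgue. min (g x) (real n)) < e / 2"
        using n unfolding dist_real_def by linarith
      have "real n * measure lebesgue A \<le> real n * (e / (2 * (real n + 1)))"
        using A by (intro mult_left_mono) auto
      also have "\<dots> \<le> e / 2" using \<open>e > 0\<close> by (simp add: field_simps)
      finally show "real n * measure lebesgue A \<le> e / 2" .
    qed
    finally show "(LINT x:A|lebesgue. norm (f x)) < e" by simp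
  qed (use \<open>e > 0\<close> in auto)
qed

lemma absolutely_continuous_on_indefinite_integral:
  fixes f :: "real \<Rightarrow> 'a::euclidean_space"
  assumes f: "f absolutely_integrable_on {a..b}"
  shows "absolutely_continuous_on {a..b} (\<lambda>x. integral {a..x} f)"
  unfolding absolutely_continuous_on_def
proof (intro allI impI)
  fix e :: real assume "e > 0"
  obtain d where d: "d > 0" "\<And>A. A \<subseteq> {a..b} \<Longrightarrow> A \<in> lmeasurable \<Longrightarrow> measure lebesgue A < d \<Longrightarrow> (LINT x:A|lebesgue. norm (f x)) < e"
    using absolutely_integrable_small_on_small_sets[OF f _ \<open>e > 0\<close>] by auto
  show "\<exists>\<delta>>0. \<forall>(n::nat) u v. (\<forall>k<n. u k \<in> {a..b} \<and> v k \<in> {a..b} \<and> u k \<le> v k) \<and>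
      disjoint_family_on (\<lambda>k. {u k<..<v k}) {..<n} \<and> (\<Sum>k<n. v k - u k) < \<delta> \<longrightarrow>
      (\<Sum>k<n. norm (integral {a..v k} f - integral {a..u k} f)) < e"
  proof (intro exI[of _ d] conjI allI impI)
    fix n :: nat and u v
    assume H: "(\<forall>k<n. u k \<in> {a..b} \<and> v k \<in> {a..b} \<and> u k \<le> v k) \<and>
      disjoint_family_on (\<lambda>k. {u k<..<v k}) {..<n} \<and> (\<Sum>k<n. v k - u k) < d"
    let ?A = "\<Union>k<n. {u k<..<v k}"
    have fn: "set_integrable lebesgue {u k<..<v k} (\<lambda>x. norm (f x))" if "k < n" for k
      using H that by (intro set_integrable_subset[OF set_integrable_norm[OF f]]) auto
    have "(\<Sum>k<n. norm (integral {a..v k} f - integral {a..u k} f)) \<le> (\<Sum>k<n. LINT x:{u k<..<v k}|lebesgue. norm (f x))"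
    proof (rule sum_mono)
      fix k assume "k \<in> {..<n}"
      then have k: "a \<le> u k" "u k \<le> v k" "v k \<le> b" "k < n" using H by auto
      have fk: "f absolutely_integrable_on {u k<..<v k}"
        using k by (intro set_integrable_subset[OF f]) auto
      have "f integrable_on {a..v k}" using f k
        by (meson absolutely_integrable_on_def atLeastatMost_subset_iff integrable_subinterval_real order_refl)
      then have "integral {a..v k} f - integral {a..u k} f = integral {u k..v k} f"
        using k Henstock_Kurzweil_Integration.integral_combine[of a "u k" "v k" f] by (simp add: algebra_simps)
      also have "\<dots> = integral {u k<..<v k} f"
        using integral_open_interval_real[of "u k" "v k" f] by simp
      also have "\<dots> = (LINT x:{u k<..<v k}|lebesgue. f x)"
        using set_lebesgue_integral_eq_integral(2)[OF fk] by simp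
      also have "norm \<dots> \<le> (LINT x:{u k<..<v k}|lebesgue. norm (f x))"
        by (rule set_integral_norm_bound[OF fk])
      finally show "norm (integral {a..v k} f - integral {a..u k} f) \<le> (LINT x:{u k<..<v k}|lebesgue. norm (f x))" .
    qed
    also have "\<dots> = (LINT x:?A|lebesgue. norm (f x))"
      using H fn by (intro set_integral_finite_Union[symmetric]) auto
    also have "\<dots> < e"
    proof (rule d(2))
      have "measure lebesgue ?A = (\<Sum>k<n. measure lebesgue {u k<..<v k})"
        using H by (intro measure_finite_Union) auto
      also have "\<dots> = (\<Sum>k<n. v k - u k)" using H by (intro sum.cong) auto
      finally show "measure lebesgue ?A < d" using H by simp
      show "?A \<in> lmeasurable" by (intro fmeasurable.finite_UN) auto
      show "?A \<subseteq> {a..b}" using H by fastforce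
    qed
    finally show "(\<Sum>k<n. norm (integral {a..v k} f - integral {a..u k} f)) < e" .
  qed (use d in auto)
qed

lemma ac_deriv_indefinite_integral:
  fixes f :: "real \<Rightarrow> 'a::euclidean_space"
  assumes f: "f absolutely_integrable_on {a..b}"
  shows "ac_deriv {a..b} (\<lambda>x. integral {a..x} f) f"
  unfolding ac_deriv_def
  using absolutely_continuous_on_indefinite_integral[OF f]
    indefinite_integral_has_derivative_ae[of f a b] f
  by (auto simp: absolutely_integrable_on_def)

section \<open>Variation and differentiability almost everywhere\<close>

text \<open>S need not be an interval: later the variation inside an open set of small measure is
  needed. The closed intervals lie in S while only the open ones are disjoint, so neighbouring
  intervals may share end points.\<close>

definition variation_sums :: "(real \<Rightarrow> real) \<Rightarrow> real set \<Rightarrow> real set" where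
  "variation_sums f S = {s. \<exists>(n::nat) a b. (\<forall>k<n. a k \<le> b k \<and> {a k..b k} \<subseteq> S) \<and>
     disjoint_family_on (\<lambda>k. {a k<..<b k}) {..<n} \<and> s = (\<Sum>k<n. \<bar>f (b k) - f (a k)\<bar>)}"

lemma variation_sumsI:
  assumes "finite (I::'i set)" "\<And>i. i \<in> I \<Longrightarrow> a i \<le> b i \<and> {a i..b i} \<subseteq> S" "disjoint_family_on (\<lambda>i. {a i<..<b i}) I"
  shows "(\<Sum>i\<in>I. \<bar>f (b i) - f (a i)\<bar>) \<in> variation_sums f S"
proof -
  obtain h where h: "bij_betw h {..<card I} I"
    using ex_bij_betw_nat_finite[OF assms(1)] by (auto simp: atLeast0LessThan)
  have inI: "h k \<in> I" if "k < card I" for k using h that by (auto simp: bij_betw_def)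
  have "disjoint_family_on (\<lambda>k. {(a \<circ> h) k<..<(b \<circ> h) k}) {..<card I}"
    unfolding disjoint_family_on_def
  proof (intro ballI impI)
    fix m n assume "m \<in> {..<card I}" "n \<in> {..<card I}" "m \<noteq> n"
    then have "h m \<in> I" "h n \<in> I" "h m \<noteq> h n"
      using h by (auto simp: bij_betw_def inj_on_def)
    then show "{(a \<circ> h) m<..<(b \<circ> h) m} \<inter> {(a \<circ> h) n<..<(b \<circ> h) n} = {}"
      using assms(3) by (simp add: disjoint_family_on_def)
  qed
  moreover have "(\<Sum>i\<in>I. \<bar>f (b i) - f (a i)\<bar>) = (\<Sum>k<card I. \<bar>f ((b \<circ> h) k) - f ((a \<circ> h) k)\<bar>)"
    using sum.reindex_bij_betw[OF h, of "\<lambda>i. \<bar>f (b i) - f (a i)\<bar>"] by simp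
  ultimately show ?thesis
    unfolding variation_sums_def mem_Collect_eq using inI assms(2)
    by (intro exI[of _ "card I"] exI[of _ "a \<circ> h"] exI[of _ "b \<circ> h"]) auto
qed

lemma variation_sums_zero: "0 \<in> variation_sums f S"
  using variation_sumsI[of "{}::nat set" "\<lambda>_. 0" "\<lambda>_. 0" S f] by (simp add: disjoint_family_on_def)

lemma variation_sums_mono: "S \<subseteq> T \<Longrightarrow> variation_sums f S \<subseteq> variation_sums f T"
  unfolding variation_sums_def by blast

text \<open>Yields superadditivity of the suprema: since S lies to the left of u, the interval from
  u to v cannot overlap the given family.\<close>

lemma variation_sums_append:
  assumes s: "s \<in> variation_sums f S" and S: "S \<subseteq> {..u}" and "u \<le> v" "{u..v} \<subseteq> T" "S \<subseteq> T"
  shows "s + \<bar>f v - f u\<bar> \<in> variation_sums f T"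
proof -
  obtain n :: nat and a b where ab: "\<And>k. k<n \<Longrightarrow> a k \<le> b k \<and> {a k..b k} \<subseteq> S"
     "disjoint_family_on (\<lambda>k. {a k<..<b k}) {..<n}" "s = (\<Sum>k<n. \<bar>f (b k) - f (a k)\<bar>)"
    using s unfolding variation_sums_def by blast
  have bu: "b k \<le> u" if "k < n" for k using ab(1)[OF that] S by (auto simp: subset_iff)
  let ?a = "a(n := u)" and ?b = "b(n := v)"
  have "(\<Sum>k<Suc n. \<bar>f (?b k) - f (?a k)\<bar>) \<in> variation_sums f T"
  proof (rule variation_sumsI)
    show "?a i \<le> ?b i \<and> {?a i..?b i} \<subseteq> T" if "i \<in> {..<Suc n}" for i
      using that ab(1)[of i] assms(3-5) by (cases "i = n") auto
    show "disjoint_family_on (\<lambda>i. {?a i<..<?b i}) {..<Suc n}"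
      unfolding disjoint_family_on_def
    proof (intro ballI impI)
      fix i j assume ij: "i \<in> {..<Suc n}" "j \<in> {..<Suc n}" "i \<noteq> j"
      consider "i < n" "j < n" | "i = n" "j < n" | "i < n" "j = n" using ij by fastforce
      then show "{?a i<..<?b i} \<inter> {?a j<..<?b j} = {}"
      proof cases
        case 1 then show ?thesis using ab(2) ij unfolding disjoint_family_on_def by simp
      next
        case 2 then show ?thesis using bu[of j] by auto
      next
        case 3 then show ?thesis using bu[of i] by auto
      qed
    qed
  qed simp
  also have "(\<Sum>k<Suc n. \<bar>f (?b k) - f (?a k)\<bar>) = s + \<bar>f v - f u\<bar>" using ab by simp
  finally show ?thesis .
qed

text \<open>Every interval of the family is cut at \<open>w\<close> by clipping its end points.\<close>

lemma variation_sums_split: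
  assumes s: "s \<in> variation_sums f {u..v}" and w: "u \<le> w" "w \<le> v"
  obtains s1 s2 where "s1 \<in> variation_sums f {u..w}" "s2 \<in> variation_sums f {w..v}" "s \<le> s1 + s2"
proof -
  obtain n :: nat and a b where ab: "\<And>k. k<n \<Longrightarrow> a k \<le> b k \<and> {a k..b k} \<subseteq> {u..v}"
     "disjoint_family_on (\<lambda>k. {a k<..<b k}) {..<n}" "s = (\<Sum>k<n. \<bar>f (b k) - f (a k)\<bar>)"
    using s unfolding variation_sums_def by blast
  have ab': "a k \<le> b k" "u \<le> a k" "b k \<le> v" if "k < n" for k using ab(1)[OF that] by auto
  show ?thesis
  proof
    show "(\<Sum>k<n. \<bar>f (min (b k) w) - f (min (a k) w)\<bar>) \<in> variation_sums f {u..w}"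
    proof (rule variation_sumsI)
      show "disjoint_family_on (\<lambda>i. {min (a i) w<..<min (b i) w}) {..<n}"
        unfolding disjoint_family_on_def
      proof (intro ballI impI)
        fix i j assume "i \<in> {..<n}" "j \<in> {..<n}" "i \<noteq> j"
        then have "{a i<..<b i} \<inter> {a j<..<b j} = {}" using ab(2) unfolding disjoint_family_on_def by blast
        moreover have "{min (a k) w<..<min (b k) w} \<subseteq> {a k<..<b k}" for k by (auto simp: min_def split: if_splits)
        ultimately show "{min (a i) w<..<min (b i) w} \<inter> {min (a j) w<..<min (b j) w} = {}" by blast
      qed
    qed (use ab' w in \<open>force simp: min_def\<close>)+
    show "(\<Sum>k<n. \<bar>f (max (b k) w) - f (max (a k) w)\<bar>) \<in> variation_sums f {w..v}"
    proof (rule variation_sumsI)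
      show "disjoint_family_on (\<lambda>i. {max (a i) w<..<max (b i) w}) {..<n}"
        unfolding disjoint_family_on_def
      proof (intro ballI impI)
        fix i j assume "i \<in> {..<n}" "j \<in> {..<n}" "i \<noteq> j"
        then have "{a i<..<b i} \<inter> {a j<..<b j} = {}" using ab(2) unfolding disjoint_family_on_def by blast
        moreover have "{max (a k) w<..<max (b k) w} \<subseteq> {a k<..<b k}" for k by (auto simp: max_def split: if_splits)
        ultimately show "{max (a i) w<..<max (b i) w} \<inter> {max (a j) w<..<max (b j) w} = {}" by blast
      qed
    qed (use ab' w in \<open>force simp: max_def\<close>)+
    \<comment> \<open>If w lies inside an interval this is the triangle inequality through f w;
      otherwise one of the two clipped intervals is a point.\<close>
    show "s \<le> (\<Sum>k<n. \<bar>f (min (b k) w) - f (min (a k) w)\<bar>) + (\<Sum>k<n. \<bar>f (max (b k) w) - f (max (a k) w)\<bar>)"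
      unfolding ab(3) sum.distrib[symmetric]
      by (rule sum_mono) (use ab' in \<open>force simp: min_def max_def\<close>)
  qed
qed

text \<open>The form in which absolute continuity is used below: disjoint intervals inside G have
  total length at most the measure of G.\<close>

lemma variation_sums_small:
  assumes f: "absolutely_continuous_on {a..b} f" and "e > 0"
  obtains d where "d > 0"
    "\<And>G s. G \<in> lmeasurable \<Longrightarrow> measure lebesgue G < d \<Longrightarrow> s \<in> variation_sums f (G \<inter> {a..b}) \<Longrightarrow> s < e"
proof -
  obtain \<delta> where "\<delta> > 0" and \<delta>: "\<And>(n::nat) u v.
        (\<forall>k<n. u k \<in> {a..b} \<and> v k \<in> {a..b} \<and> u k \<le> v k) \<Longrightarrow>
        disjoint_family_on (\<lambda>k. {u k<..<v k}) {..<n} \<Longrightarrow>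
        (\<Sum>k<n. v k - u k) < \<delta> \<Longrightarrow>
        (\<Sum>k<n. norm (f (v k) - f (u k))) < e"
    using assms unfolding absolutely_continuous_on_def by meson
  show ?thesis
  proof (rule that[OF \<open>\<delta> > 0\<close>])
    fix G s assume G: "G \<in> lmeasurable" "measure lebesgue G < \<delta>" and s: "s \<in> variation_sums f (G \<inter> {a..b})"
    obtain n :: nat and u v where uv: "\<And>k. k<n \<Longrightarrow> u k \<le> v k \<and> {u k..v k} \<subseteq> G \<inter> {a..b}"
       "disjoint_family_on (\<lambda>k. {u k<..<v k}) {..<n}" "s = (\<Sum>k<n. \<bar>f (v k) - f (u k)\<bar>)"
      using s unfolding variation_sums_def by blast
    have "(\<Sum>k<n. v k - u k) \<le> measure lebesgue G"
    proof (rule sum_lengths_le_measure)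
      show "{u i<..<v i} \<subseteq> G" if "i \<in> {..<n}" for i
        using uv(1)[of i] that by (auto simp: subset_iff)
    qed (use uv G in auto)
    then have "(\<Sum>k<n. norm (f (v k) - f (u k))) < e"
      using G uv by (intro \<delta>) fastforce+
    then show "s < e" using uv(3) by simp
  qed
qed

lemma variation_sums_bdd_above:
  assumes f: "absolutely_continuous_on {a..b} f"
  shows "bdd_above (variation_sums f {a..b})"
proof (cases "a \<le> b")
  case True
  obtain d where d: "d > 0"
    "\<And>G s. G \<in> lmeasurable \<Longrightarrow> measure lebesgue G < d \<Longrightarrow> s \<in> variation_sums f (G \<inter> {a..b}) \<Longrightarrow> s < 1"
    using variation_sums_small[OF f, of 1] by auto
  \<comment> \<open>N steps of length d / 2 exhaust the interval, and on each step the variation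
    stays below 1.\<close>
  obtain N :: nat where N: "b - a < real N * (d/2)"
    using reals_Archimedean3[of "d/2"] d(1) by (metis half_gt_zero)
  have "\<forall>s \<in> variation_sums f {a..min b (a + real n * (d/2))}. s \<le> real (Suc n)" for n
  proof (induction n)
    case 0
    show ?case
    proof
      fix s assume "s \<in> variation_sums f {a..min b (a + real 0 * (d/2))}"
      then have "s \<in> variation_sums f ({a} \<inter> {a..b})" using True by simp
      moreover have "{a} \<in> lmeasurable" by (simp add: negligible_imp_measurable)
      ultimately show "s \<le> real (Suc 0)" using d(1) d(2)[of "{a}" s] by simp
    qed
  next
    case (Suc n)
    show ?case
    proof
      fix s assume s: "s \<in> variation_sums f {a..min b (a + real (Suc n) * (d/2))}"
      define w v where "w = min b (a + real n * (d/2))" and "v = min b (a + real (Suc n) * (d/2))"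
      have w: "a \<le> w" "w \<le> v" "v - w \<le> d/2" "v \<le> b"
        unfolding w_def v_def using True d(1) by (auto simp: min_def field_simps)
      from s have "s \<in> variation_sums f {a..v}" unfolding v_def .
      from variation_sums_split[OF this w(1,2)] obtain s1 s2 where
        12: "s1 \<in> variation_sums f {a..w}" "s2 \<in> variation_sums f {w..v}" "s \<le> s1 + s2" .
      have "{w..v} \<inter> {a..b} = {w..v}" using w by auto
      then have "s2 < 1" using d(2)[of "{w..v}" s2] 12(2) w d(1) by simp
      moreover have "s1 \<le> real (Suc n)" using Suc 12 unfolding w_def by blast
      ultimately show "s \<le> real (Suc (Suc n))" using 12(3) by simp
    qed
  qed
  from this[of N] have "\<forall>s \<in> variation_sums f {a..b}. s \<le> real (Suc N)"
    using N by (simp add: min_def split: if_splits)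
  then show ?thesis by (auto simp: bdd_above_def)
next
  case False
  show ?thesis
  proof (rule bdd_aboveI)
    fix s assume s: "s \<in> variation_sums f {a..b}"
    obtain n :: nat and u v where uv: "\<And>k. k<n \<Longrightarrow> u k \<le> v k \<and> {u k..v k} \<subseteq> {a..b}"
       "s = (\<Sum>k<n. \<bar>f (v k) - f (u k)\<bar>)"
      using s unfolding variation_sums_def by blast
    \<comment> \<open>A member of the family would be a nonempty closed interval inside the empty
      set.\<close>
    have "n = 0"
    proof (rule ccontr)
      assume "n \<noteq> 0" then show False using uv(1)[of 0] False by auto
    qed
    then show "s \<le> 0" using uv by simp
  qed
qed

text \<open>A supremum argument: the loss on the exceptional set is absorbed by the variation
  of \<open>k\<close> inside an open set of small measure.\<close>

lemma absolutely_continuous_on_nondecreasing: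
  assumes k: "absolutely_continuous_on {a..b} k" and "a \<le> b" and N: "negligible N"
    and step: "\<And>x e. x \<in> {a<..<b} - N \<Longrightarrow> e > 0 \<Longrightarrow> \<exists>h>0. x + h \<le> b \<and> k (x + h) \<ge> k x - e * h"
  shows "k a \<le> k b"
proof (rule field_le_epsilon)
  fix e0 :: real assume "e0 > 0"
  \<comment> \<open>The final loss is e per unit of length plus e for the exceptional set, and e (b
    - a) + e = e0.\<close>
  define e where "e = e0 / (b - a + 1)"
  have e: "e > 0" "e * (b - a) + e = e0"
    unfolding e_def using \<open>e0 > 0\<close> \<open>a \<le> b\<close> by (auto simp: divide_simps) (simp add: algebra_simps)
  obtain d where d: "d > 0"
    "\<And>G s. G \<in> lmeasurable \<Longrightarrow> measure lebesgue G < d \<Longrightarrow> s \<in> variation_sums k (G \<inter> {a..b}) \<Longrightarrow> s < e"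
    using variation_sums_small[OF k e(1)] by auto
  \<comment> \<open>The hypothesis \<open>step\<close> speaks of interior points, so the starting
    point a is treated as exceptional as well.\<close>
  have "negligible (insert a N)" using N by simp
  then obtain G where G: "open G" "insert a N \<subseteq> G" "G \<in> lmeasurable" "measure lebesgue G < d"
    using open_superset_small_measure d(1) by blast
  \<comment> \<open>The variation of k inside G up to t: it never exceeds e, and it grows by at
    least |k t - k s| across an interval from s to t inside G.\<close>
  define W where "W t = Sup (variation_sums k (G \<inter> {a..t}))" for t
  have sm: "s < e" if "s \<in> variation_sums k (G \<inter> {a..t})" "t \<le> b" for s t
  proof -
    have "variation_sums k (G \<inter> {a..t}) \<subseteq> variation_sums k (G \<inter> {a..b})"
      using that by (intro variation_sums_mono) auto
    then show ?thesis using that by (intro d(2)[OF G(3,4)]) auto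
  qed
  have bdd: "bdd_above (variation_sums k (G \<inter> {a..t}))" if "t \<le> b" for t
    using sm[OF _ that] by (meson bdd_aboveI less_imp_le)
  have ne: "variation_sums k S \<noteq> {}" for S using variation_sums_zero by blast
  have W0: "0 \<le> W t" "W t \<le> e" if "t \<le> b" for t
  proof -
    show "0 \<le> W t" unfolding W_def using bdd[OF that] variation_sums_zero by (rule cSup_upper[rotated])
    show "W t \<le> e" unfolding W_def using ne sm[OF _ that] by (intro cSup_least) (auto intro: less_imp_le)
  qed
  have Wmono: "W s \<le> W t" if "s \<le> t" "t \<le> b" for s t
    unfolding W_def using that by (intro cSup_subset_mono ne bdd variation_sums_mono) auto
  have Wapp: "W s + \<bar>k t - k s\<bar> \<le> W t" if "a \<le> s" "s \<le> t" "t \<le> b" "{s..t} \<subseteq> G" for s t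
  proof -
    have "W s \<le> W t - \<bar>k t - k s\<bar>"
      unfolding W_def[of s]
    proof (rule cSup_least[OF ne])
      fix r assume "r \<in> variation_sums k (G \<inter> {a..s})"
      then have "r + \<bar>k t - k s\<bar> \<in> variation_sums k (G \<inter> {a..t})"
        using that by (rule_tac variation_sums_append) auto
      then have "r + \<bar>k t - k s\<bar> \<le> W t" unfolding W_def using bdd[OF that(3)] by (rule cSup_upper)
      then show "r \<le> W t - \<bar>k t - k s\<bar>" by simp
    qed
    then show ?thesis by simp
  qed
  \<comment> \<open>The points up to which the loss is under control. Their supremum belongs to R by
    continuity of k and monotonicity of W, and it can be passed as long as it is below b.\<close>
  define R where "R = {t\<in>{a..b}. k t \<ge> k a - e * (t - a) - W t}"
  have aR: "a \<in> R" unfolding R_def using W0(1)[of a] \<open>a \<le> b\<close> by simp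
  have bR: "bdd_above R" unfolding R_def by (auto intro: bdd_aboveI[of _ b])
  define s where "s = Sup R"
  have s: "a \<le> s" "s \<le> b" "\<And>t. t \<in> R \<Longrightarrow> t \<le> s"
  proof -
    show "t \<le> s" if "t \<in> R" for t unfolding s_def using that bR by (rule cSup_upper)
    from this[OF aR] show "a \<le> s" .
    show "s \<le> b" unfolding s_def using aR by (intro cSup_least) (auto simp: R_def)
  qed
  have cont: "continuous_on {a..b} k" using k by (rule absolutely_continuous_on_imp_continuous_on)
  have "k s \<ge> k a - e * (s - a) - W s"
  proof (rule field_le_epsilon)
    fix \<epsilon> :: real assume "\<epsilon> > 0"
    then obtain \<eta> where \<eta>: "\<eta> > 0" "\<And>t. t \<in> {a..b} \<Longrightarrow> dist t s < \<eta> \<Longrightarrow> dist (k t) (k s) < \<epsilon>"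
      using cont s unfolding continuous_on_iff by (metis atLeastAtMost_iff)
    obtain t where t: "t \<in> R" "s - \<eta> < t"
      using less_cSup_iff[of R "s - \<eta>"] aR bR \<eta> unfolding s_def by auto
    have tab: "t \<in> {a..b}" "k t \<ge> k a - e * (t - a) - W t" using t unfolding R_def by auto
    have "dist (k t) (k s) < \<epsilon>" using \<eta>(2)[OF tab(1)] t s(3)[OF t(1)] by (simp add: dist_real_def)
    moreover have "W t \<le> W s" using s t by (intro Wmono) auto
    moreover have "e * (t - a) \<le> e * (s - a)" using s t e by (intro mult_left_mono) auto
    ultimately show "k a - e * (s - a) - W s \<le> k s + \<epsilon>" using tab(2) unfolding dist_real_def by linarith
  qed
  then have sR: "s \<in> R" unfolding R_def using s by auto
  have "s = b"
  proof (rule ccontr)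
    assume "s \<noteq> b"
    then have "s < b" using s by simp
    \<comment> \<open>Inside G the growth of W pays for any decrease of k; outside G the point is
      interior and not exceptional, and \<open>step\<close> costs only e * h.\<close>
    have "\<exists>t\<in>R. s < t"
    proof (cases "s \<in> G")
      case True
      then obtain r where r: "r > 0" "cball s r \<subseteq> G" using G(1) open_contains_cball by blast
      let ?t = "min b (s + r)"
      have t: "s < ?t" "?t \<le> b" "{s..?t} \<subseteq> G" using r \<open>s < b\<close> by (auto simp: subset_iff dist_real_def)
      have "W s + \<bar>k ?t - k s\<bar> \<le> W ?t" using s t by (intro Wapp) auto
      moreover have "e * (s - a) \<le> e * (?t - a)" using t e by (intro mult_left_mono) auto
      ultimately have "k ?t \<ge> k a - e * (?t - a) - W ?t" using sR unfolding R_def by auto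
      then show ?thesis using t s unfolding R_def by (intro bexI[of _ ?t]) auto
    next
      case False
      then have "s \<noteq> a" "s \<notin> N" using G(2) by blast+
      then have "s \<in> {a<..<b} - N" using s(1) \<open>s < b\<close> by simp
      from step[OF this e(1)] obtain h where h: "h > 0" "s + h \<le> b" "k (s + h) \<ge> k s - e * h" by blast
      have "W s \<le> W (s + h)" using h by (intro Wmono) auto
      then have "k (s + h) \<ge> k a - e * (s + h - a) - W (s + h)"
        using h(3) sR unfolding R_def by (auto simp: algebra_simps)
      then show ?thesis using h s unfolding R_def by (intro bexI[of _ "s + h"]) auto
    qed
    then show False using s(3) by force
  qed
  then have "k b \<ge> k a - e * (b - a) - W b" using sR unfolding R_def by simp
  then show "k a \<le> k b + e0" using W0(2)[of b] e(2) by simp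
qed

text \<open>The Jordan decomposition with V the total variation. That V is again absolutely
  continuous follows by refining each interval to a nearly optimal subfamily: the pooled subfamilies
  occupy no more length than the original intervals.\<close>

lemma absolutely_continuous_on_difference_of_monotone:
  fixes f :: "real \<Rightarrow> real"
  assumes f: "absolutely_continuous_on {a..b} f"
  obtains V where "absolutely_continuous_on {a..b} V"
    "mono_on {a..b} V" "mono_on {a..b} (\<lambda>x. V x - f x)"
proof -
  define V where "V t = Sup (variation_sums f {a..t})" for t
  have ne: "variation_sums f S \<noteq> {}" for S using variation_sums_zero by blast
  have bdd: "bdd_above (variation_sums f S)" if "S \<subseteq> {a..b}" for S
    by (rule bdd_above_mono[OF variation_sums_bdd_above[OF f] variation_sums_mono[OF that]])
  have app: "V s + \<bar>f t - f s\<bar> \<le> V t" if "a \<le> s" "s \<le> t" "t \<le> b" for s t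
  proof -
    have "V s \<le> V t - \<bar>f t - f s\<bar>"
      unfolding V_def[of s]
    proof (rule cSup_least[OF ne])
      fix r assume "r \<in> variation_sums f {a..s}"
      then have "r + \<bar>f t - f s\<bar> \<in> variation_sums f {a..t}"
        using that by (rule_tac variation_sums_append) auto
      then have "r + \<bar>f t - f s\<bar> \<le> V t" unfolding V_def using bdd that by (intro cSup_upper) auto
      then show "r \<le> V t - \<bar>f t - f s\<bar>" by simp
    qed
    then show ?thesis by simp
  qed
  have mV: "mono_on {a..b} V" using app by (fastforce intro!: mono_onI)
  have mVf: "mono_on {a..b} (\<lambda>x. V x - f x)" using app by (fastforce intro!: mono_onI)
  have incr: "V v - V u \<le> Sup (variation_sums f {u..v})" if uv: "a \<le> u" "u \<le> v" "v \<le> b" for u v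
  proof -
    have "V v \<le> V u + Sup (variation_sums f {u..v})"
      unfolding V_def[of v]
    proof (rule cSup_least[OF ne])
      fix s assume "s \<in> variation_sums f {a..v}"
      from variation_sums_split[OF this uv(1,2)] obtain s1 s2 where
        12: "s1 \<in> variation_sums f {a..u}" "s2 \<in> variation_sums f {u..v}" "s \<le> s1 + s2" .
      have "s1 \<le> V u" unfolding V_def using 12 uv by (intro cSup_upper bdd) auto
      moreover have "s2 \<le> Sup (variation_sums f {u..v})" using 12 uv by (intro cSup_upper bdd) auto
      ultimately show "s \<le> V u + Sup (variation_sums f {u..v})" using 12 by simp
    qed
    then show ?thesis by simp
  qed
  have acV: "absolutely_continuous_on {a..b} V"
    unfolding absolutely_continuous_on_def
  proof (intro allI impI)
    fix e :: real assume "e > 0"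
    obtain d where d: "d > 0"
      "\<And>G s. G \<in> lmeasurable \<Longrightarrow> measure lebesgue G < d \<Longrightarrow> s \<in> variation_sums f (G \<inter> {a..b}) \<Longrightarrow> s < e/2"
      using variation_sums_small[OF f, of "e/2"] \<open>e > 0\<close> by auto
    show "\<exists>\<delta>>0. \<forall>(n::nat) u v. (\<forall>k<n. u k \<in> {a..b} \<and> v k \<in> {a..b} \<and> u k \<le> v k) \<and>
      disjoint_family_on (\<lambda>k. {u k<..<v k}) {..<n} \<and> (\<Sum>k<n. v k - u k) < \<delta> \<longrightarrow>
      (\<Sum>k<n. norm (V (v k) - V (u k))) < e"
    proof (intro exI[of _ d] conjI allI impI)
      fix n :: nat and u v
      assume H: "(\<forall>k<n. u k \<in> {a..b} \<and> v k \<in> {a..b} \<and> u k \<le> v k) \<and>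
        disjoint_family_on (\<lambda>k. {u k<..<v k}) {..<n} \<and> (\<Sum>k<n. v k - u k) < d"
      let ?G = "\<Union>k<n. {u k..v k}"
      \<comment> \<open>Each of the n suprema is missed by less than \<eta>, hence all together by
        at most e / 2; the summand 1 covers n = 0.\<close>
      define \<eta> where "\<eta> = e / (2 * (real n + 1))"
      have "\<eta> > 0" unfolding \<eta>_def using \<open>e > 0\<close> by simp
      have "\<forall>k. \<exists>s. k < n \<longrightarrow> s \<in> variation_sums f {u k..v k} \<and> Sup (variation_sums f {u k..v k}) - \<eta> < s"
      proof
        fix k show "\<exists>s. k < n \<longrightarrow> s \<in> variation_sums f {u k..v k} \<and> Sup (variation_sums f {u k..v k}) - \<eta> < s"
        proof (cases "k < n")
          case True
          then have bd: "bdd_above (variation_sums f {u k..v k})" using H by (intro bdd) auto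
          show ?thesis using less_cSup_iff[OF ne bd, of "Sup (variation_sums f {u k..v k}) - \<eta>"] \<open>\<eta> > 0\<close> by auto
        qed simp
      qed
      then obtain s where s: "\<And>k. k < n \<Longrightarrow> s k \<in> variation_sums f {u k..v k}"
        "\<And>k. k < n \<Longrightarrow> Sup (variation_sums f {u k..v k}) - \<eta> < s k" by metis
      \<comment> \<open>Packs all requirements on a subfamily of the k-th interval into one
        predicate, so that subfamilies can be chosen for all k simultaneously.\<close>
      define Q where "Q k m p q \<longleftrightarrow> (\<forall>i<m::nat. p i \<le> q i \<and> {p i..q i} \<subseteq> {u k..v k}) \<and>
         disjoint_family_on (\<lambda>i. {p i<..<q i}) {..<m} \<and> s k = (\<Sum>i<m. \<bar>f (q i) - f (p i)\<bar>)" for k m p q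
      have "\<forall>k. \<exists>m p q. k < n \<longrightarrow> Q k m p q"
        using s(1) unfolding variation_sums_def Q_def by blast
      then obtain m p q where mpq': "\<And>k. k < n \<Longrightarrow> Q k (m k) (p k) (q k)"
        by metis
      have mpq: "p k i \<le> q k i \<and> {p k i..q k i} \<subseteq> {u k..v k}" if "k < n" "i < m k" for k i
        using mpq'[OF that(1)] that(2) unfolding Q_def by blast
      have mpq2: "disjoint_family_on (\<lambda>i. {p k i<..<q k i}) {..<m k}"
        "s k = (\<Sum>i<m k. \<bar>f (q k i) - f (p k i)\<bar>)" if "k < n" for k
        using mpq'[OF that] unfolding Q_def by blast+
      \<comment> \<open>The pooled subfamilies form one family, indexed by the pairs of an interval
        and a member of its subfamily.\<close>
      have "(\<Sum>x\<in>Sigma {..<n} (\<lambda>k. {..<m k}). \<bar>f (case_prod q x) - f (case_prod p x)\<bar>) \<in> variation_sums f (?G \<inter> {a..b})"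
      proof (rule variation_sumsI)
        fix x assume "x \<in> Sigma {..<n} (\<lambda>k. {..<m k})"
        then obtain k i where x: "x = (k,i)" "k < n" "i < m k" by auto
        show "case_prod p x \<le> case_prod q x \<and> {case_prod p x..case_prod q x} \<subseteq> ?G \<inter> {a..b}"
          using mpq[OF x(2,3)] x H by fastforce
      next
        show "disjoint_family_on (\<lambda>x. {case_prod p x<..<case_prod q x}) (Sigma {..<n} (\<lambda>k. {..<m k}))"
          unfolding disjoint_family_on_def
        proof (intro ballI impI)
          fix x y assume xy: "x \<in> Sigma {..<n} (\<lambda>k. {..<m k})" "y \<in> Sigma {..<n} (\<lambda>k. {..<m k})" "x \<noteq> y"
          obtain k i where x: "x = (k,i)" "k < n" "i < m k" using xy by auto
          obtain l j where y: "y = (l,j)" "l < n" "j < m l" using xy by auto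
          show "{case_prod p x<..<case_prod q x} \<inter> {case_prod p y<..<case_prod q y} = {}"
          proof (cases "k = l")
            case True
            then show ?thesis using mpq2(1)[OF x(2)] x y xy(3) unfolding disjoint_family_on_def by auto
          next
            case False
            then have "{u k<..<v k} \<inter> {u l<..<v l} = {}" using H x y unfolding disjoint_family_on_def by blast
            moreover have "{p k i<..<q k i} \<subseteq> {u k<..<v k}" "{p l j<..<q l j} \<subseteq> {u l<..<v l}"
              using mpq[OF x(2,3)] mpq[OF y(2,3)] by auto
            ultimately have "{p k i<..<q k i} \<inter> {p l j<..<q l j} = {}" by blast
            then show ?thesis by (simp only: x(1) y(1) prod.case)
          qed
        qed
      qed simp
      moreover have "(\<Sum>x\<in>Sigma {..<n} (\<lambda>k. {..<m k}). \<bar>f (case_prod q x) - f (case_prod p x)\<bar>) = (\<Sum>k<n. s k)"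
      proof -
        have "(\<Sum>k<n. s k) = (\<Sum>k<n. \<Sum>i<m k. \<bar>f (q k i) - f (p k i)\<bar>)"
          using mpq2(2) by (intro sum.cong) auto
        also have "\<dots> = (\<Sum>(k,i)\<in>Sigma {..<n} (\<lambda>k. {..<m k}). \<bar>f (q k i) - f (p k i)\<bar>)"
          by (rule sum.Sigma) auto
        finally show ?thesis by (simp add: split_def)
      qed
      moreover have "measure lebesgue ?G < d"
      proof -
        have "measure lebesgue ?G \<le> (\<Sum>k<n. measure lebesgue {u k..v k})" by (rule measure_UNION_le) auto
        also have "\<dots> = (\<Sum>k<n. v k - u k)" using H by (intro sum.cong) auto
        finally show ?thesis using H by simp
      qed
      moreover have "?G \<in> lmeasurable" by (intro fmeasurable.finite_UN) auto
      ultimately have ss: "(\<Sum>k<n. s k) < e/2" using d(2)[of ?G] by metis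
      have "(\<Sum>k<n. norm (V (v k) - V (u k))) \<le> (\<Sum>k<n. s k + \<eta>)"
      proof (rule sum_mono)
        fix k assume "k \<in> {..<n}"
        then have k: "k < n" "a \<le> u k" "u k \<le> v k" "v k \<le> b" using H by auto
        have "norm (V (v k) - V (u k)) = V (v k) - V (u k)" using app[OF k(2-4)] by simp
        also have "\<dots> \<le> s k + \<eta>" using incr[OF k(2-4)] s(2)[OF k(1)] by simp
        finally show "norm (V (v k) - V (u k)) \<le> s k + \<eta>" .
      qed
      also have "\<dots> = (\<Sum>k<n. s k) + real n * \<eta>" by (simp add: sum.distrib)
      also have "\<dots> < e/2 + e/2"
      proof (rule add_less_le_mono[OF ss])
        show "real n * \<eta> \<le> e/2" unfolding \<eta>_def using \<open>e > 0\<close> by (simp add: field_simps)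
      qed
      finally show "(\<Sum>k<n. norm (V (v k) - V (u k))) < e" by simp
    qed (use d in auto)
  qed
  show ?thesis by (rule that[OF acV mV mVf])
qed

text \<open>Fatou's lemma bounds the integral of the lower limit \<open>g\<close> of the difference quotients. The
  difference of \<open>f\<close> and the integral of \<open>g\<close> then has lower limit zero of its difference quotients
  almost everywhere, so that it is both nondecreasing and nonincreasing.\<close>

lemma mono_absolutely_continuous_ac_deriv:
  fixes f :: "real \<Rightarrow> real"
  assumes f: "absolutely_continuous_on {a..b} f" and m: "mono_on {a..b} f" and ab: "a \<le> b"
  obtains g where "g absolutely_integrable_on {a..b}" "ac_deriv {a..b} f g"
proof -
  \<comment> \<open>Constant continuation of f beyond both ends, so that difference quotients near b
    are defined and F stays monotone.\<close>
  define F where "F x = f (max a (min b x))" for x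
  have cf: "continuous_on {a..b} f" using f by (rule absolutely_continuous_on_imp_continuous_on)
  have cF: "continuous_on S F" for S
    unfolding F_def using ab by (intro continuous_on_compose2[OF cf] continuous_intros) auto
  have mF: "F x \<le> F y" if "x \<le> y" for x y
    unfolding F_def using ab that by (intro mono_onD[OF m]) auto
  have Ff: "x \<in> {a..b} \<Longrightarrow> F x = f x" for x by (auto simp: F_def max_def min_def)
  define h where "h n = inverse (real (Suc n))" for n
  have h: "h n > 0" for n by (simp add: h_def)
  have hlim: "h \<longlonglongrightarrow> 0" unfolding h_def by (rule LIMSEQ_inverse_real_of_nat)
  define q where "q n x = (F (x + h n) - F x) / h n" for n x
  have q0: "0 \<le> q n x" for n x unfolding q_def using h[of n] mF[of x "x + h n"] by auto
  have cq: "continuous_on S (q n)" for n S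
    unfolding q_def by (intro continuous_intros continuous_on_compose2[OF cF[of UNIV]]) (use h[of n] in auto)
  define u where "u n x = ennreal (q n x) * indicator {a..b} x" for n x
  have um: "u n \<in> borel_measurable lborel" for n
    unfolding u_def using borel_measurable_continuous_onI[OF cq[of UNIV n]] by simp
  \<comment> \<open>The integral of the quotient telescopes to the mean of F on [b, b + h] minus its
    mean on [a, a + h]. The first is f b by the constant continuation, the second at least f a by
    monotonicity.\<close>
  have ub: "(\<integral>\<^sup>+x. u n x \<partial>lborel) \<le> ennreal (f b - f a)" for n
  proof -
    have i: "F integrable_on {c..d}" for c d by (intro integrable_continuous_real cF)
    have "((F \<circ> (+) (h n)) has_integral integral {a + h n..b + h n} F) {a..b}"
      unfolding has_integral_shift_Icc_real using i by (intro integrable_integral)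
    then have "(q n has_integral ((integral {a + h n..b + h n} F - integral {a..b} F) / h n)) {a..b}"
      unfolding q_def using i by (intro has_integral_divide has_integral_diff integrable_integral)
         (simp add: o_def add.commute)
    then have eq: "(\<integral>\<^sup>+x. u n x \<partial>lborel) = ennreal ((integral {a + h n..b + h n} F - integral {a..b} F) / h n)"
      unfolding u_def using q0 by (intro nn_integral_has_integral_lebesgue') auto
    have "integral {a..a + h n} F + integral {a + h n..b + h n} F = integral {a..b + h n} F"
         "integral {a..b} F + integral {b..b + h n} F = integral {a..b + h n} F"
      using ab h[of n] i by (auto intro!: Henstock_Kurzweil_Integration.integral_combine)
    then have "integral {a + h n..b + h n} F - integral {a..b} F = integral {b..b + h n} F - integral {a..a + h n} F" by simp
    moreover have "integral {b..b + h n} F \<le> integral {b..b + h n} (\<lambda>_. f b)"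
      using i ab by (intro integral_le) (auto simp: F_def max_def min_def)
    moreover have "integral {a..a + h n} F \<ge> integral {a..a + h n} (\<lambda>_. f a)"
      using i ab mF[of a] Ff[of a] by (intro integral_le) auto
    ultimately have "(integral {a + h n..b + h n} F - integral {a..b} F) / h n \<le> f b - f a"
      using h[of n] by (simp add: field_simps)
    then show ?thesis unfolding eq by (rule ennreal_leI)
  qed
  define G where "G x = liminf (\<lambda>n. u n x)" for x
  have Gm: "G \<in> borel_measurable lborel" unfolding G_def using um by measurable
  have GI: "(\<integral>\<^sup>+x. G x \<partial>lborel) \<le> ennreal (f b - f a)"
  proof -
    have "(\<integral>\<^sup>+x. G x \<partial>lborel) \<le> liminf (\<lambda>n. \<integral>\<^sup>+x. u n x \<partial>lborel)"
      unfolding G_def by (intro nn_integral_liminf um)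
    also have "\<dots> \<le> liminf (\<lambda>n::nat. ennreal (f b - f a))"
      by (intro Liminf_mono always_eventually allI ub)
    finally show ?thesis by (simp add: Liminf_const)
  qed
  have "AE x in lborel. G x \<noteq> \<infinity>"
    using Gm GI by (intro nn_integral_PInf_AE) (auto simp: top_unique)
  then obtain N1 where N1: "{x. \<not> G x \<noteq> \<infinity>} \<subseteq> N1" "N1 \<in> null_sets lborel"
    by (auto elim!: AE_E simp: null_sets_def)
  then have N1n: "negligible N1"
    using negligible_iff_null_sets null_sets_completionI by blast
  define g where "g x = enn2real (G x)" for x
  have "integrable lborel g"
  proof (rule integrableI_bounded)
    show "g \<in> borel_measurable lborel" unfolding g_def using Gm by measurable
    have "(\<integral>\<^sup>+ x. ennreal (norm (g x)) \<partial>lborel) \<le> (\<integral>\<^sup>+ x. G x \<partial>lborel)"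
      unfolding g_def by (intro nn_integral_mono) (auto simp: enn2real_nonneg ennreal_enn2real_if)
    also have "\<dots> < \<infinity>" using GI by (simp add: le_less_trans)
    finally show "(\<integral>\<^sup>+ x. ennreal (norm (g x)) \<partial>lborel) < \<infinity>" .
  qed
  then have "integrable lebesgue g" by (simp add: integrable_completion borel_measurable_integrable)
  then have gi: "g absolutely_integrable_on {a..b}"
    unfolding set_integrable_def by (intro integrable_mult_indicator) auto
  define K where "K x = integral {a..x} g" for x
  have K: "ac_deriv {a..b} K g" unfolding K_def by (rule ac_deriv_indefinite_integral[OF gi])
  then obtain N2 where N2: "negligible N2" "\<And>x. x \<in> {a..b} - N2 \<Longrightarrow> (K has_vector_derivative g x) (at x)"
    unfolding ac_deriv_def by blast
  have acK: "absolutely_continuous_on {a..b} K" using K unfolding ac_deriv_def by blast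
  have acN: "absolutely_continuous_on {a..b} (\<lambda>x. - K x)" "absolutely_continuous_on {a..b} (\<lambda>x. - f x)"
    by (rule absolutely_continuous_on_bounded_linear[OF _ acK] absolutely_continuous_on_bounded_linear[OF _ f],
        simp add: bounded_linear_minus)+
  have Kq: "eventually (\<lambda>n. \<bar>K (x + h n) - K x - g x * h n\<bar> \<le> e * h n) sequentially"
    if x: "x \<in> {a<..<b} - (N1 \<union> N2)" and "e > 0" for x e
  proof -
    have "(K has_derivative (\<lambda>h. h *\<^sub>R g x)) (at x)"
      using N2(2) x by (simp add: has_vector_derivative_def)
    then obtain d where d: "d > 0" "\<And>y. norm (y - x) < d \<Longrightarrow> norm (K y - K x - (y - x) *\<^sub>R g x) \<le> e * norm (y - x)"
      using \<open>e > 0\<close> unfolding has_derivative_at_alt by blast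
    have "eventually (\<lambda>n. h n < d) sequentially" using hlim d(1) by (rule order_tendstoD)
    then show ?thesis
    proof eventually_elim
      case (elim n)
      then show ?case using d(2)[of "x + h n"] h[of n] by (simp add: mult.commute)
    qed
  qed
  have xb: "eventually (\<lambda>n. x + h n \<le> b) sequentially" if "x < b" for x
  proof -
    have "eventually (\<lambda>n. h n < b - x) sequentially" using hlim that by (intro order_tendstoD) auto
    then show ?thesis by eventually_elim simp
  qed
  have low: "eventually (\<lambda>n. q n x > g x - e) sequentially"
    if x: "x \<in> {a<..<b} - (N1 \<union> N2)" and "e > 0" for x e
  proof (cases "g x - e < 0")
    case True
    then have "g x - e < q n x" for n using q0[of n x] by linarith
    then show ?thesis by simp
  next
    case False
    have "G x \<noteq> \<infinity>" using x N1 by auto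
    then have "G x = ennreal (g x)" unfolding g_def by (simp add: less_top)
    then have "ennreal (g x - e) < liminf (\<lambda>n. u n x)"
      using False \<open>e > 0\<close> unfolding G_def by (simp add: ennreal_less_iff)
    then have "eventually (\<lambda>n. ennreal (g x - e) < u n x) sequentially"
      by (rule less_LiminfD)
    then show ?thesis using x False unfolding u_def by (auto elim!: eventually_mono simp: ennreal_less_iff)
  qed
  \<comment> \<open>A lower limit bounds the quotients from above only infinitely often. That
    suffices, since \<open>absolutely_continuous_on_nondecreasing\<close> asks for a single step h
    at each point.\<close>
  have high: "frequently (\<lambda>n. q n x < g x + e) sequentially"
    if x: "x \<in> {a<..<b} - (N1 \<union> N2)" and "e > 0" for x e
  proof (rule ccontr)
    assume "\<not> frequently (\<lambda>n. q n x < g x + e) sequentially"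
    then have "eventually (\<lambda>n. g x + e \<le> q n x) sequentially" by (simp add: not_frequently not_less)
    then have "eventually (\<lambda>n. ennreal (g x + e) \<le> u n x) sequentially"
      using x by (auto elim!: eventually_mono simp: u_def intro!: ennreal_leI)
    then have "ennreal (g x + e) \<le> G x" unfolding G_def by (rule Liminf_bounded)
    moreover have "G x \<noteq> \<infinity>" using x N1 by auto
    then have "G x = ennreal (g x)" unfolding g_def by (simp add: less_top)
    ultimately have "ennreal (g x + e) \<le> ennreal (g x)" by simp
    then show False using \<open>e > 0\<close> by (simp add: g_def ennreal_le_iff enn2real_nonneg)
  qed
  have N12: "negligible (N1 \<union> N2)" using N1n N2 by simp
  have const: "f x - K x = f a" if x: "x \<in> {a..b}" for x
  proof (rule antisym)
    have sub: "{a..x} \<subseteq> {a..b}" using x by auto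
    have K0: "K a = 0" unfolding K_def by simp
    have "f a + - K a \<le> f x + - K x"
    proof (rule absolutely_continuous_on_nondecreasing[OF absolutely_continuous_on_subset[OF absolutely_continuous_on_add[OF f acN(1)] sub] _ N12])
      fix y e assume y: "y \<in> {a<..<x} - (N1 \<union> N2)" and e: "(0::real) < e"
      then have yb: "y \<in> {a<..<b} - (N1 \<union> N2)" using x by auto
      have "y < x" using y by simp
      have e2: "e/2 > 0" using e by simp
      have "eventually (\<lambda>n. h n < x - y) sequentially" using hlim \<open>y < x\<close> by (intro order_tendstoD) auto
      with low[OF yb e2] Kq[OF yb e2]
      have "eventually (\<lambda>n. y + h n \<le> x \<and> f (y + h n) + - K (y + h n) \<ge> f y + - K y - e * h n) sequentially"
      proof eventually_elim
        case (elim n)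
        have "y + h n \<in> {a..b}" "y \<in> {a..b}" using elim h[of n] x yb by auto
        then have "f (y + h n) - f y = q n y * h n" unfolding q_def using h[of n] Ff by simp
        moreover have "(g y - e/2) * h n \<le> q n y * h n" using elim h[of n] by (intro mult_right_mono) auto
        moreover have "K (y + h n) - K y - g y * h n \<le> e/2 * h n" using elim by linarith
        ultimately show ?case using elim by (simp add: algebra_simps)
      qed
      then obtain n where "y + h n \<le> x" "f (y + h n) + - K (y + h n) \<ge> f y + - K y - e * h n"
        using eventually_happens'[OF sequentially_bot] by blast
      then show "\<exists>h>0. y + h \<le> x \<and> f y + - K y - e * h \<le> f (y + h) + - K (y + h)" using h by blast
    qed (use x in auto)
    then show "f a \<le> f x - K x" using K0 by simp
    have "- f a + K a \<le> - f x + K x"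
    proof (rule absolutely_continuous_on_nondecreasing[OF absolutely_continuous_on_subset[OF absolutely_continuous_on_add[OF acN(2) acK] sub] _ N12])
      fix y e assume y: "y \<in> {a<..<x} - (N1 \<union> N2)" and e: "(0::real) < e"
      then have yb: "y \<in> {a<..<b} - (N1 \<union> N2)" using x by auto
      have "y < x" using y by simp
      have e2: "e/2 > 0" using e by simp
      have "eventually (\<lambda>n. h n < x - y) sequentially" using hlim \<open>y < x\<close> by (intro order_tendstoD) auto
      with Kq[OF yb e2] have ev: "eventually (\<lambda>n. h n < x - y \<and> \<bar>K (y + h n) - K y - g y * h n\<bar> \<le> e/2 * h n) sequentially"
        by eventually_elim simp
      from frequently_eventually_conj[OF high[OF yb e2] ev] obtain n where
        n: "q n y < g y + e/2" "h n < x - y" "\<bar>K (y + h n) - K y - g y * h n\<bar> \<le> e/2 * h n"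
        using frequently_ex by blast
      have "y + h n \<in> {a..b}" "y \<in> {a..b}" using n h[of n] x yb by auto
      then have "f (y + h n) - f y = q n y * h n" unfolding q_def using h[of n] Ff by simp
      moreover have "q n y * h n \<le> (g y + e/2) * h n" using n h[of n] by (intro mult_right_mono) auto
      moreover have "K (y + h n) - K y - g y * h n \<ge> - (e/2 * h n)" using n(3) by linarith
      ultimately have "- f (y + h n) + K (y + h n) \<ge> - f y + K y - e * h n"
        by (simp add: algebra_simps)
      then show "\<exists>h>0. y + h \<le> x \<and> - f y + K y - e * h \<le> - f (y + h) + K (y + h)" using h n(2)
        by (intro exI[of _ "h n"]) auto
    qed (use x in auto)
    then show "f x - K x \<le> f a" using K0 by simp
  qed
  have "(f has_vector_derivative g x) (at x)" if x: "x \<in> {a..b} - (N2 \<union> {a,b})" for x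
  proof (rule has_vector_derivative_transform_within_open[of "\<lambda>x. f a + K x" _ x "{a<..<b}"])
    have "((\<lambda>x. f a + K x) has_vector_derivative 0 + g x) (at x)"
      by (intro has_vector_derivative_add has_vector_derivative_const N2(2)) (use x in auto)
    then show "((\<lambda>x. f a + K x) has_vector_derivative g x) (at x)" by simp
    show "f a + K y = f y" if "y \<in> {a<..<b}" for y using const[of y] that by simp
  qed (use x in auto)
  moreover have "negligible (N2 \<union> {a,b})" using N2(1) by simp
  ultimately have "ac_deriv {a..b} f g" unfolding ac_deriv_def using f by blast
  then show ?thesis using that gi by blast
qed

lemma absolutely_continuous_on_imp_ac_deriv:
  fixes f :: "real \<Rightarrow> real"
  assumes f: "absolutely_continuous_on {a..b} f"
  obtains g where "g absolutely_integrable_on {a..b}" "ac_deriv {a..b} f g"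
proof (cases "a \<le> b")
  case True
  obtain V where V: "absolutely_continuous_on {a..b} V"
    "mono_on {a..b} V" "mono_on {a..b} (\<lambda>x. V x - f x)"
    using absolutely_continuous_on_difference_of_monotone[OF f] .
  have "absolutely_continuous_on {a..b} (\<lambda>x. - f x)"
    by (rule absolutely_continuous_on_bounded_linear[OF _ f]) (simp add: bounded_linear_minus)
  from absolutely_continuous_on_add[OF V(1) this]
  have V2: "absolutely_continuous_on {a..b} (\<lambda>x. V x - f x)" by simp
  obtain g1 where g1: "g1 absolutely_integrable_on {a..b}" "ac_deriv {a..b} V g1"
    using mono_absolutely_continuous_ac_deriv[OF V(1,2) True] .
  obtain g2 where g2: "g2 absolutely_integrable_on {a..b}" "ac_deriv {a..b} (\<lambda>x. V x - f x) g2"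
    using mono_absolutely_continuous_ac_deriv[OF V2 V(3) True] .
  obtain N1 N2 where N: "negligible N1" "negligible N2"
    "\<And>x. x \<in> {a..b} - N1 \<Longrightarrow> (V has_vector_derivative g1 x) (at x)"
    "\<And>x. x \<in> {a..b} - N2 \<Longrightarrow> ((\<lambda>x. V x - f x) has_vector_derivative g2 x) (at x)"
    using g1(2) g2(2) unfolding ac_deriv_def by blast
  have "(f has_vector_derivative g1 x - g2 x) (at x)" if "x \<in> {a..b} - (N1 \<union> N2)" for x
    using has_vector_derivative_diff[OF N(3) N(4), of x] that by simp
  moreover have "negligible (N1 \<union> N2)" using N by simp
  ultimately have "ac_deriv {a..b} f (\<lambda>x. g1 x - g2 x)" using f unfolding ac_deriv_def by blast
  moreover have "(\<lambda>x. g1 x - g2 x) absolutely_integrable_on {a..b}"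
    using g1(1) g2(1) by (rule set_integral_diff(1))
  ultimately show ?thesis using that by blast
next
  case False
  then have "ac_deriv {a..b} f f" unfolding ac_deriv_def using f negligible_empty by auto
  moreover have "f absolutely_integrable_on {a..b}" using False by (simp add: set_integrable_def)
  ultimately show ?thesis using that by blast
qed

section \<open>The system behind the harmonic exponential\<close>

lemma ac_deriv_cong_ae:
  assumes "ac_deriv S f f'" "negligible N" "\<And>x. x \<in> S - N \<Longrightarrow> f' x = f'' x"
  shows "ac_deriv S f f''"
proof -
  obtain M where M: "negligible M" "\<And>x. x\<in>S - M \<Longrightarrow> (f has_vector_derivative f' x) (at x)"
    using assms(1) unfolding ac_deriv_def by blast
  have "(f has_vector_derivative f'' x) (at x)" if "x \<in> S - (M \<union> N)" for x
    using M(2)[of x] assms(3)[of x] that by simp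
  moreover have "negligible (M \<union> N)" using M assms by simp
  ultimately show ?thesis using assms(1) unfolding ac_deriv_def by blast
qed

lemma ac_deriv_cong:
  assumes "ac_deriv S f f'" "\<And>x. f x = g x" "\<And>x. f' x = g' x"
  shows "ac_deriv S g g'"
proof -
  have "f = g" "f' = g'" using assms(2,3) by auto
  then show ?thesis using assms(1) by simp
qed

lemma ac_deriv_subset: "ac_deriv S f f' \<Longrightarrow> T \<subseteq> S \<Longrightarrow> ac_deriv T f f'"
  unfolding ac_deriv_def using absolutely_continuous_on_subset by blast

lemma ac_deriv_imp_ac: "ac_deriv S f f' \<Longrightarrow> absolutely_continuous_on S f"
  by (simp add: ac_deriv_def)

lemma ac_deriv_imp_continuous_on: "ac_deriv S f f' \<Longrightarrow> continuous_on S f"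
  by (simp add: ac_deriv_def absolutely_continuous_on_imp_continuous_on)

lemma ac_deriv_const: "ac_deriv S (\<lambda>x. c) (\<lambda>x. 0)"
  unfolding ac_deriv_def using negligible_empty by (auto simp: absolutely_continuous_on_const)

lemma ac_deriv_add:
  assumes "ac_deriv S f f'" "ac_deriv S g g'"
  shows "ac_deriv S (\<lambda>x. f x + g x) (\<lambda>x. f' x + g' x)"
proof -
  obtain M N where "negligible M" "\<forall>x\<in>S - M. (f has_vector_derivative f' x) (at x)"
    "negligible N" "\<forall>x\<in>S - N. (g has_vector_derivative g' x) (at x)"
    using assms unfolding ac_deriv_def by blast
  then show ?thesis using assms unfolding ac_deriv_def
    by (intro conjI exI[of _ "M \<union> N"] absolutely_continuous_on_add) (auto intro: has_vector_derivative_add)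
qed

lemma ac_deriv_bounded_linear:
  assumes "bounded_linear h" "ac_deriv S f f'"
  shows "ac_deriv S (\<lambda>x. h (f x)) (\<lambda>x. h (f' x))"
  using assms unfolding ac_deriv_def
  by (metis absolutely_continuous_on_bounded_linear bounded_linear.has_vector_derivative)

lemmas ac_deriv_minus = ac_deriv_bounded_linear[OF bounded_linear_minus[OF bounded_linear_ident]]
lemmas ac_deriv_cnj = ac_deriv_bounded_linear[OF bounded_linear_cnj]
lemmas ac_deriv_of_real = ac_deriv_bounded_linear[OF bounded_linear_of_real]

lemma ac_deriv_diff:
  assumes "ac_deriv S f f'" "ac_deriv S g g'"
  shows "ac_deriv S (\<lambda>x. f x - g x) (\<lambda>x. f' x - g' x)"
  using ac_deriv_add[OF assms(1) ac_deriv_minus[OF assms(2)]] by simp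

lemma ac_deriv_mult:
  fixes f g :: "real \<Rightarrow> 'a::{real_normed_algebra,euclidean_space}"
  assumes "ac_deriv S f f'" "ac_deriv S g g'" "bounded S"
  shows "ac_deriv S (\<lambda>x. f x * g x) (\<lambda>x. f x * g' x + f' x * g x)"
proof -
  obtain M N where "negligible M" "\<forall>x\<in>S - M. (f has_vector_derivative f' x) (at x)"
    "negligible N" "\<forall>x\<in>S - N. (g has_vector_derivative g' x) (at x)"
    using assms unfolding ac_deriv_def by blast
  then show ?thesis using assms unfolding ac_deriv_def
    by (intro conjI exI[of _ "M \<union> N"] absolutely_continuous_on_mult) (auto intro: has_vector_derivative_mult)
qed

lemma ac_deriv_cmult:
  fixes f :: "real \<Rightarrow> 'a::{real_normed_algebra,euclidean_space}"
  assumes "ac_deriv S f f'"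
  shows "ac_deriv S (\<lambda>x. c * f x) (\<lambda>x. c * f' x)"
  by (rule ac_deriv_bounded_linear[OF bounded_linear_mult_right assms])

lemma ac_deriv_power:
  fixes f :: "real \<Rightarrow> real"
  assumes "ac_deriv S f f'" "bounded S"
  shows "ac_deriv S (\<lambda>x. f x ^ Suc n) (\<lambda>x. real (Suc n) * f' x * f x ^ n)"
proof (induction n)
  case 0 then show ?case using assms(1) by simp
next
  case (Suc n)
  from ac_deriv_mult[OF assms(1) Suc assms(2)] show ?case
    by (rule ac_deriv_cong) (simp_all add: algebra_simps)
qed

text \<open>Absolute continuity is not stable under composition in general; the bound on g' over a
  convex set containing all values makes g Lipschitz there.\<close>

lemma ac_deriv_compose_field:
  fixes f :: "real \<Rightarrow> 'a::{real_normed_field,euclidean_space}"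
  assumes f: "ac_deriv S f f'" and C: "convex C" "\<And>x. x \<in> S \<Longrightarrow> f x \<in> C"
    and g: "\<And>z. z \<in> C \<Longrightarrow> (g has_field_derivative g' z) (at z)"
    and K: "\<And>z. z \<in> C \<Longrightarrow> norm (g' z) \<le> K"
  shows "ac_deriv S (\<lambda>x. g (f x)) (\<lambda>x. f' x * g' (f x))"
proof -
  obtain M where M: "negligible M" "\<forall>x\<in>S - M. (f has_vector_derivative f' x) (at x)"
    using f unfolding ac_deriv_def by blast
  have "absolutely_continuous_on S (\<lambda>x. g (f x))"
  proof (rule absolutely_continuous_on_lipschitz_compose[OF ac_deriv_imp_ac[OF f]])
    fix x y assume xy: "x \<in> S" "y \<in> S"
    show "norm (g (f y) - g (f x)) \<le> K * norm (f y - f x)"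
      by (rule field_differentiable_bound[OF C(1), of g g' K])
         (use C xy K in \<open>auto intro: has_field_derivative_at_within g\<close>)
  qed
  moreover have "((\<lambda>x. g (f x)) has_vector_derivative f' x * g' (f x)) (at x)" if "x \<in> S - M" for x
    using field_vector_diff_chain_at[of f "f' x" x g "g' (f x)"] M(2) g[of "f x"] C(2) that by (simp add: o_def)
  ultimately show ?thesis unfolding ac_deriv_def using M(1) by blast
qed

lemma ac_deriv_exp:
  fixes f :: "real \<Rightarrow> 'a::{real_normed_field,banach,euclidean_space}"
  assumes f: "ac_deriv S f f'" and S: "bounded S"
  shows "ac_deriv S (\<lambda>x. exp (f x)) (\<lambda>x. f' x * exp (f x))"
proof -
  obtain B where B: "\<And>x. x \<in> S \<Longrightarrow> norm (f x) \<le> B"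
    using absolutely_continuous_on_imp_bounded[OF ac_deriv_imp_ac[OF f] S] by (auto simp: bounded_iff)
  show ?thesis
    by (rule ac_deriv_compose_field[OF f, of "cball 0 B" exp exp "exp B"])
       (auto intro: B DERIV_exp order_trans[OF norm_exp])
qed

lemma ac_deriv_id: "ac_deriv S (\<lambda>x::real. x) (\<lambda>x. 1)"
  unfolding ac_deriv_def using negligible_empty absolutely_continuous_on_ident
  by (auto intro!: exI[of _ "{}"] has_vector_derivative_id)

lemma ac_deriv_expi:
  assumes S: "bounded S"
  shows "ac_deriv S (\<lambda>x. exp (\<i> * complex_of_real (\<omega> * (x - a)))) (\<lambda>x. \<i> * of_real \<omega> * exp (\<i> * complex_of_real (\<omega> * (x - a))))"
proof -
  have "ac_deriv S (\<lambda>x. \<omega> * (x - a)) (\<lambda>x. \<omega> * (1 - 0))"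
    by (intro ac_deriv_cmult ac_deriv_diff ac_deriv_id ac_deriv_const)
  from ac_deriv_exp[OF ac_deriv_cmult[OF ac_deriv_of_real[OF this], of "\<i>"] S]
  show ?thesis by simp
qed

text \<open>All conservation laws below end here. Absolute continuity is essential: the Cantor
  function has derivative zero almost everywhere.\<close>

lemma ac_deriv_zero_imp_const:
  fixes f :: "real \<Rightarrow> 'a::banach"
  assumes f: "ac_deriv S f (\<lambda>x. 0)" and S: "is_interval S" and x: "x \<in> S" "y \<in> S"
  shows "f x = f y"
proof -
  have *: "f u = f v" if "u \<in> S" "v \<in> S" "u \<le> v" for u v
  proof -
    have "{u..v} \<subseteq> S" using S that by (meson atLeastAtMost_iff mem_is_interval_1_I subsetI)
    from ac_deriv_has_integral[OF ac_deriv_subset[OF f this] that(3)]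
    have "((\<lambda>x. 0) has_integral f v - f u) {u..v}" .
    then have "f v - f u = 0" using has_integral_0 has_integral_unique by blast
    then show ?thesis by simp
  qed
  then show ?thesis using x by (metis linear)
qed

section \<open>Iterated integrals of a general coefficient and their sum\<close>

lemma absolutely_integrable_mult_continuous:
  fixes c g :: "real \<Rightarrow> 'a::{real_normed_algebra,euclidean_space}"
  assumes "c absolutely_integrable_on {a..b}" "continuous_on {a..b} g"
  shows "(\<lambda>s. c s * g s) absolutely_integrable_on {a..b}"
proof -
  have "(\<lambda>s. (\<lambda>x y. y * x) (g s) (c s)) absolutely_integrable_on {a..b}"
  proof (rule absolutely_integrable_bounded_measurable_product[where h="\<lambda>x y. y * x" and f=g and g=c])
    show "bilinear (\<lambda>x y::'a. y * x)"
      by (auto simp: bilinear_def intro!: bounded_linear.linear bounded_linear_mult_left bounded_linear_mult_right)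
    show "g \<in> borel_measurable (lebesgue_on {a..b})"
      using assms(2) by (rule continuous_imp_measurable_on_sets_lebesgue) auto
    show "bounded (g ` {a..b})"
      using assms(2) by (intro compact_imp_bounded compact_continuous_image) auto
  qed (use assms in auto)
  then show ?thesis by simp
qed

text \<open>Source of the factor 1 / j! in all bounds: with B the indefinite integral of \<beta>,
  the integrand is the derivative of B^(j+1) / (j+1)! almost everywhere.\<close>

lemma has_integral_iterated_power:
  fixes \<beta> :: "real \<Rightarrow> real"
  assumes \<beta>: "\<beta> absolutely_integrable_on {a..b}" and x: "x \<in> {a..b}"
  shows "((\<lambda>s. \<beta> s * (integral {a..s} \<beta> ^ j / fact j)) has_integral (integral {a..x} \<beta> ^ Suc j / fact (Suc j))) {a..x}"
proof -
  define B where "B s = integral {a..s} \<beta>" for s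
  have "ac_deriv {a..b} B \<beta>" unfolding B_def by (rule ac_deriv_indefinite_integral[OF \<beta>])
  from ac_deriv_power[OF ac_deriv_subset[OF this, of "{a..x}"], of j]
  have "ac_deriv {a..x} (\<lambda>s. B s ^ Suc j) (\<lambda>s. real (Suc j) * \<beta> s * B s ^ j)" using x by auto
  from ac_deriv_cmult[OF this, of "1 / fact (Suc j)"]
  have "ac_deriv {a..x} (\<lambda>s. B s ^ Suc j / fact (Suc j)) (\<lambda>s. \<beta> s * (B s ^ j / fact j))"
    by (rule ac_deriv_cong) (simp_all add: fact_Suc divide_simps del: of_nat_Suc)
  from ac_deriv_has_integral[OF this] x show ?thesis by (simp add: B_def)
qed

text \<open>The terms of the Picard series for E' = c cnj E with initial value 1. The conjugation
  produces the alternating signs in the phase of the harmonic exponential.\<close>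

primrec hexp_iter :: "real \<Rightarrow> (real \<Rightarrow> complex) \<Rightarrow> nat \<Rightarrow> real \<Rightarrow> complex" where
  "hexp_iter a c 0 x = 1"
| "hexp_iter a c (Suc j) x = integral {a..x} (\<lambda>s. c s * cnj (hexp_iter a c j s))"

definition hexp_series :: "real \<Rightarrow> (real \<Rightarrow> complex) \<Rightarrow> real \<Rightarrow> complex" where
  "hexp_series a c x = (\<Sum>j. hexp_iter a c j x)"

lemma hexp_iter_continuous:
  assumes c: "c absolutely_integrable_on {a..b}"
  shows "continuous_on {a..b} (hexp_iter a c j)"
proof (induction j)
  case 0 show ?case by simp
next
  case (Suc j)
  have "(\<lambda>s. c s * cnj (hexp_iter a c j s)) absolutely_integrable_on {a..b}"
    by (intro absolutely_integrable_mult_continuous c continuous_on_cnj Suc)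
  from ac_deriv_imp_continuous_on[OF ac_deriv_indefinite_integral[OF this]]
  show ?case by (simp add: fun_eq_iff cong: continuous_on_cong)
qed

lemma hexp_iter_integrable:
  assumes c: "c absolutely_integrable_on {a..b}"
  shows "(\<lambda>s. c s * cnj (hexp_iter a c j s)) absolutely_integrable_on {a..b}"
  by (intro absolutely_integrable_mult_continuous c continuous_on_cnj hexp_iter_continuous)

lemma hexp_iter_bound:
  assumes c: "c absolutely_integrable_on {a..b}" and \<beta>: "\<beta> absolutely_integrable_on {a..b}"
    and le: "\<And>s. s \<in> {a..b} \<Longrightarrow> norm (c s) \<le> \<beta> s"
  shows "x \<in> {a..b} \<Longrightarrow> norm (hexp_iter a c j x) \<le> integral {a..x} \<beta> ^ j / fact j"
proof (induction j arbitrary: x)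
  case (Suc j)
  note hi = has_integral_iterated_power[OF \<beta> Suc.prems, of j]
  have "norm (integral {a..x} (\<lambda>s. c s * cnj (hexp_iter a c j s)))
     \<le> integral {a..x} (\<lambda>s. \<beta> s * (integral {a..s} \<beta> ^ j / fact j))"
  proof (rule integral_norm_bound_integral)
    show "(\<lambda>s. c s * cnj (hexp_iter a c j s)) integrable_on {a..x}"
      using absolutely_integrable_on_subinterval[OF hexp_iter_integrable[OF c]] Suc.prems
      by (auto simp: absolutely_integrable_on_def)
    show "(\<lambda>s. \<beta> s * (integral {a..s} \<beta> ^ j / fact j)) integrable_on {a..x}"
      using hi by (rule has_integral_integrable)
    fix s assume "s \<in> {a..x}"
    then have s: "s \<in> {a..b}" using Suc.prems by auto
    show "norm (c s * cnj (hexp_iter a c j s)) \<le> \<beta> s * (integral {a..s} \<beta> ^ j / fact j)"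
      unfolding norm_mult complex_mod_cnj
      using Suc.IH[OF s] le[OF s] by (intro mult_mono) (auto intro: order_trans[OF norm_ge_zero])
  qed
  also have "\<dots> = integral {a..x} \<beta> ^ Suc j / fact (Suc j)" by (rule integral_unique[OF hi])
  finally show ?case by simp
qed simp

text \<open>The j coefficients of the j-fold integral are exchanged one at a time, and each exchange
  costs a factor \<delta>; this gives the factor j.\<close>

lemma hexp_iter_diff_bound:
  assumes c: "c absolutely_integrable_on {a..b}" and d: "d absolutely_integrable_on {a..b}"
    and \<beta>: "\<beta> absolutely_integrable_on {a..b}"
    and le: "\<And>s. s \<in> {a..b} \<Longrightarrow> norm (c s) \<le> \<beta> s" "\<And>s. s \<in> {a..b} \<Longrightarrow> norm (d s) \<le> \<beta> s"
    and diff: "\<And>s. s \<in> {a..b} \<Longrightarrow> norm (c s - d s) \<le> \<delta> * \<beta> s"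
  shows "x \<in> {a..b} \<Longrightarrow> norm (hexp_iter a c j x - hexp_iter a d j x) \<le> \<delta> * real j * (integral {a..x} \<beta> ^ j / fact j)"
proof (induction j arbitrary: x)
  case (Suc j)
  note hi = has_integral_mult_right[OF has_integral_iterated_power[OF \<beta> Suc.prems, of j], of "\<delta> * real (Suc j)"]
  have int: "(\<lambda>s. c s * cnj (hexp_iter a c j s)) integrable_on {a..x}" "(\<lambda>s. d s * cnj (hexp_iter a d j s)) integrable_on {a..x}"
    using absolutely_integrable_on_subinterval[OF hexp_iter_integrable[OF c]]
      absolutely_integrable_on_subinterval[OF hexp_iter_integrable[OF d]] Suc.prems
      by (auto simp: absolutely_integrable_on_def)
  have "norm (hexp_iter a c (Suc j) x - hexp_iter a d (Suc j) x)
     = norm (integral {a..x} (\<lambda>s. c s * cnj (hexp_iter a c j s) - d s * cnj (hexp_iter a d j s)))"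
    using int by (simp add: Henstock_Kurzweil_Integration.integral_diff)
  also have "\<dots> \<le> integral {a..x} (\<lambda>s. \<delta> * real (Suc j) * (\<beta> s * (integral {a..s} \<beta> ^ j / fact j)))"
  proof (rule integral_norm_bound_integral)
    show "(\<lambda>s. c s * cnj (hexp_iter a c j s) - d s * cnj (hexp_iter a d j s)) integrable_on {a..x}"
      using int by (rule integrable_diff)
    show "(\<lambda>s. \<delta> * real (Suc j) * (\<beta> s * (integral {a..s} \<beta> ^ j / fact j))) integrable_on {a..x}"
      using hi by (rule has_integral_integrable)
    fix s assume "s \<in> {a..x}"
    then have s: "s \<in> {a..b}" using Suc.prems by auto
    define P where "P = integral {a..s} \<beta> ^ j / fact j"
    have P: "norm (hexp_iter a c j s) \<le> P"
      unfolding P_def by (rule hexp_iter_bound[OF c \<beta> le(1) s])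
    have "c s * cnj (hexp_iter a c j s) - d s * cnj (hexp_iter a d j s) =
       (c s - d s) * cnj (hexp_iter a c j s) + d s * cnj (hexp_iter a c j s - hexp_iter a d j s)"
      by (simp add: algebra_simps)
    also have "norm \<dots> \<le> norm (c s - d s) * norm (hexp_iter a c j s) + norm (d s) * norm (hexp_iter a c j s - hexp_iter a d j s)"
      by (rule norm_triangle_le) (simp add: norm_mult del: complex_cnj_diff)
    also have "\<dots> \<le> (\<delta> * \<beta> s) * P + \<beta> s * (\<delta> * real j * P)"
      using diff[OF s] P le(2)[OF s] Suc.IH[OF s] unfolding P_def[symmetric]
      by (intro add_mono mult_mono) (auto intro: order_trans[OF norm_ge_zero])
    also have "\<dots> = \<delta> * real (Suc j) * (\<beta> s * P)" by (simp add: algebra_simps)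
    finally show "norm (c s * cnj (hexp_iter a c j s) - d s * cnj (hexp_iter a d j s))
       \<le> \<delta> * real (Suc j) * (\<beta> s * (integral {a..s} \<beta> ^ j / fact j))" unfolding P_def .
  qed
  also have "\<dots> = \<delta> * real (Suc j) * (integral {a..x} \<beta> ^ Suc j / fact (Suc j))" by (rule integral_unique[OF hi])
  finally show ?case .
qed simp

text \<open>Kept general because it is instantiated with the true coefficient and with the one of
  frozen phase; \<open>minus\<close> adds their negatives. All share the majorant
  |\<alpha>|.\<close>

locale hexp_coeff =
  fixes a b :: real and c :: "real \<Rightarrow> complex" and \<beta> :: "real \<Rightarrow> real"
  assumes ab: "a \<le> b" and c: "c absolutely_integrable_on {a..b}" and \<beta>: "\<beta> absolutely_integrable_on {a..b}"
    and le: "\<And>s. s \<in> {a..b} \<Longrightarrow> norm (c s) \<le> \<beta> s"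
begin

definition B where "B x = integral {a..x} \<beta>"

lemma \<beta>_nonneg: "s \<in> {a..b} \<Longrightarrow> 0 \<le> \<beta> s"
  using le[of s] norm_ge_zero[of "c s"] by linarith

lemma \<beta>_integrable: "x \<in> {a..b} \<Longrightarrow> \<beta> integrable_on {a..x}"
  using absolutely_integrable_on_subinterval[OF \<beta>, of a x] by (auto simp: absolutely_integrable_on_def)

lemma B_nonneg: "x \<in> {a..b} \<Longrightarrow> 0 \<le> B x"
  unfolding B_def by (rule integral_nonneg[OF \<beta>_integrable]) (use \<beta>_nonneg in auto)

lemma B_le: "x \<in> {a..b} \<Longrightarrow> B x \<le> B b"
  unfolding B_def using ab \<beta>_nonneg \<beta>_integrable by (intro integral_subset_le) auto

lemma iter_bound: "x \<in> {a..b} \<Longrightarrow> norm (hexp_iter a c j x) \<le> B x ^ j / fact j"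
  unfolding B_def by (rule hexp_iter_bound[OF c \<beta> le])

lemma iter_bound_uniform: "x \<in> {a..b} \<Longrightarrow> norm (hexp_iter a c j x) \<le> B b ^ j / fact j"
  by (rule order_trans[OF iter_bound]) (auto intro!: divide_right_mono power_mono B_nonneg B_le)

lemma exp_summable: "summable (\<lambda>j. r ^ j / fact j :: real)"
  using summable_exp[of r] by (simp add: field_simps)

lemma summable_iter: "x \<in> {a..b} \<Longrightarrow> summable (\<lambda>j. norm (hexp_iter a c j x))"
  by (rule summable_comparison_test'[OF exp_summable[of "B x"], of 0]) (simp add: iter_bound)

lemma uniform_limit_series:
  "uniform_limit {a..b} (\<lambda>n x. \<Sum>j<n. hexp_iter a c j x) (hexp_series a c) sequentially"
  unfolding hexp_series_def
  by (rule Weierstrass_m_test[OF iter_bound_uniform exp_summable])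

lemma continuous_series: "continuous_on {a..b} (hexp_series a c)"
  by (rule uniform_limit_theorem[OF _ uniform_limit_series])
     (auto intro!: always_eventually continuous_on_sum hexp_iter_continuous c)

lemma series_integrable: "(\<lambda>s. c s * cnj (hexp_series a c s)) absolutely_integrable_on {a..b}"
  by (intro absolutely_integrable_mult_continuous c continuous_on_cnj continuous_series)

text \<open>Integrating c times the conjugate of a partial sum shifts the index by one: it gives the
  next partial sum without its constant term.\<close>

lemma series_integral_eq:
  assumes x: "x \<in> {a..b}"
  shows "hexp_series a c x = 1 + integral {a..x} (\<lambda>s. c s * cnj (hexp_series a c s))"
proof -
  have sub: "{a..x} \<subseteq> {a..b}" using x by auto
  have int: "(\<lambda>s. c s * cnj (hexp_iter a c j s)) integrable_on {a..x}" for j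
    using absolutely_integrable_on_subinterval[OF hexp_iter_integrable[OF c] sub] by (auto simp: absolutely_integrable_on_def)
  have lim: "(\<lambda>n. \<Sum>j<n. hexp_iter a c j s) \<longlonglongrightarrow> hexp_series a c s" if "s \<in> {a..b}" for s
    by (rule tendsto_uniform_limitI[OF uniform_limit_series that])
  have "(\<lambda>n. integral {a..x} (\<lambda>s. c s * cnj (\<Sum>j<n. hexp_iter a c j s))) \<longlonglongrightarrow> integral {a..x} (\<lambda>s. c s * cnj (hexp_series a c s))"
  \<comment> \<open>All partial sums are bounded by the exponential series at B b.\<close>
  proof (rule dominated_convergence(2)[where h="\<lambda>s. \<beta> s * exp (B b)"])
    show "(\<lambda>s. c s * cnj (\<Sum>j<n. hexp_iter a c j s)) integrable_on {a..x}" for n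
      using int by (simp add: sum_distrib_left integrable_sum)
    show "(\<lambda>s. \<beta> s * exp (B b)) integrable_on {a..x}"
      using \<beta>_integrable[OF x] by (rule integrable_on_mult_left)
    fix s assume "s \<in> {a..x}"
    then have s: "s \<in> {a..b}" using sub by blast
    show "(\<lambda>n. c s * cnj (\<Sum>j<n. hexp_iter a c j s)) \<longlonglongrightarrow> c s * cnj (hexp_series a c s)"
      by (intro tendsto_mult tendsto_const tendsto_cnj lim[OF s])
    show "norm (c s * cnj (\<Sum>j<n. hexp_iter a c j s)) \<le> \<beta> s * exp (B b)" for n
    proof -
      have "norm (\<Sum>j<n. hexp_iter a c j s) \<le> (\<Sum>j<n. B b ^ j / fact j)"
        by (rule sum_norm_le) (rule iter_bound_uniform[OF s])
      also have "\<dots> \<le> (\<Sum>j. B b ^ j / fact j)"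
        using B_nonneg[of b] ab by (intro sum_le_suminf exp_summable) auto
      also have "\<dots> = exp (B b)" by (simp add: exp_def field_simps)
      finally show ?thesis unfolding norm_mult complex_mod_cnj using le[OF s] \<beta>_nonneg[OF s] by (intro mult_mono) auto
    qed
  qed
  moreover have "integral {a..x} (\<lambda>s. c s * cnj (\<Sum>j<n. hexp_iter a c j s)) = (\<Sum>j<Suc n. hexp_iter a c j x) - 1" for n
  proof -
    have "integral {a..x} (\<lambda>s. c s * cnj (\<Sum>j<n. hexp_iter a c j s)) = (\<Sum>j<n. hexp_iter a c (Suc j) x)"
      using int by (simp add: sum_distrib_left Henstock_Kurzweil_Integration.integral_sum)
    also have "\<dots> = (\<Sum>j<Suc n. hexp_iter a c j x) - 1"
      by (subst sum.lessThan_Suc_shift) simp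
    finally show ?thesis .
  qed
  ultimately have "(\<lambda>n. (\<Sum>j<Suc n. hexp_iter a c j x) - 1) \<longlonglongrightarrow> integral {a..x} (\<lambda>s. c s * cnj (hexp_series a c s))"
    by simp
  moreover have "(\<lambda>n. (\<Sum>j<Suc n. hexp_iter a c j x) - 1) \<longlonglongrightarrow> hexp_series a c x - 1"
    by (intro tendsto_diff tendsto_const LIMSEQ_Suc[OF lim[OF x]])
  ultimately have "integral {a..x} (\<lambda>s. c s * cnj (hexp_series a c s)) = hexp_series a c x - 1"
    by (rule LIMSEQ_unique)
  then show ?thesis by simp
qed

lemma series_start: "hexp_series a c a = 1"
proof -
  have "hexp_series a c a = 1 + integral {a..a} (\<lambda>s. c s * cnj (hexp_series a c s))"
    by (rule series_integral_eq) (use ab in simp)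
  also have "\<dots> = 1" using integral_refl[of a] by simp
  finally show ?thesis .
qed

lemma ac_deriv_series: "ac_deriv {a..b} (hexp_series a c) (\<lambda>s. c s * cnj (hexp_series a c s))"
proof -
  have *: "ac_deriv {a..b} (\<lambda>x. 1 + integral {a..x} (\<lambda>s. c s * cnj (hexp_series a c s))) (\<lambda>s. 0 + c s * cnj (hexp_series a c s))"
    by (intro ac_deriv_add ac_deriv_const ac_deriv_indefinite_integral series_integrable)
  have ac: "absolutely_continuous_on {a..b} (hexp_series a c)"
  proof (rule absolutely_continuous_on_lipschitz_compose[OF ac_deriv_imp_ac[OF *], of _ 1])
    fix x y assume "x \<in> {a..b}" "y \<in> {a..b}"
    note xy = this[THEN series_integral_eq]
    show "norm (hexp_series a c y - hexp_series a c x) \<le> 1 * norm (1 + integral {a..y} (\<lambda>s. c s * cnj (hexp_series a c s)) -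
        (1 + integral {a..x} (\<lambda>s. c s * cnj (hexp_series a c s))))"
      unfolding xy[symmetric] by simp
  qed
  obtain N where N: "negligible N" "\<And>x. x \<in> {a..b} - N \<Longrightarrow>
     ((\<lambda>x. 1 + integral {a..x} (\<lambda>s. c s * cnj (hexp_series a c s))) has_vector_derivative 0 + c x * cnj (hexp_series a c x)) (at x)"
    using * unfolding ac_deriv_def by blast
  \<comment> \<open>The integral equation is known on {a..b} only, so the two-sided derivative is
    transferred inside the open interval and the end points join the null set.\<close>
  have "(hexp_series a c has_vector_derivative c x * cnj (hexp_series a c x)) (at x)" if "x \<in> {a..b} - (N \<union> {a,b})" for x
    by (rule has_vector_derivative_transform_within_open[of "\<lambda>x. 1 + integral {a..x} (\<lambda>s. c s * cnj (hexp_series a c s))" _ x "{a<..<b}"])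
       (use N(2)[of x] that in \<open>auto intro: series_integral_eq[symmetric]\<close>)
  then show ?thesis unfolding ac_deriv_def using ac N(1) by (intro conjI exI[of _ "N \<union> {a,b}"]) auto
qed

lemma minus: "hexp_coeff a b (\<lambda>s. - c s) \<beta>"
proof
  show "(\<lambda>s. - c s) absolutely_integrable_on {a..b}"
    using absolutely_integrable_scaleR_left[OF c, of "-1"] by simp
qed (use ab \<beta> le in auto)

lemma iter_minus: "hexp_iter a (\<lambda>s. - c s) j x = (- 1) ^ j * hexp_iter a c j x"
proof (induction j arbitrary: x)
  case (Suc j)
  have "hexp_iter a (\<lambda>s. - c s) (Suc j) x = integral {a..x} (\<lambda>s. (- 1) ^ Suc j * (c s * cnj (hexp_iter a c j s)))"
    by (simp add: Suc algebra_simps)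
  also have "\<dots> = (- 1) ^ Suc j * hexp_iter a c (Suc j) x" by simp
  finally show ?case .
qed simp

definition S where "S x = hexp_series a c x + hexp_series a (\<lambda>s. - c s) x"
definition D where "D x = hexp_series a c x - hexp_series a (\<lambda>s. - c s) x"

lemma S_start: "S a = 2" and D_start: "D a = 0"
  unfolding S_def D_def by (simp_all add: series_start hexp_coeff.series_start[OF minus])

lemma ac_deriv_S: "ac_deriv {a..b} S (\<lambda>s. c s * cnj (D s))"
proof -
  have "ac_deriv {a..b} S (\<lambda>s. c s * cnj (hexp_series a c s) + - c s * cnj (hexp_series a (\<lambda>s. - c s) s))"
    using ac_deriv_add[OF ac_deriv_series hexp_coeff.ac_deriv_series[OF minus]] by (simp add: S_def[abs_def])
  then show ?thesis by (rule ac_deriv_cong_ae[OF _ negligible_empty]) (simp add: D_def algebra_simps)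
qed

lemma ac_deriv_D: "ac_deriv {a..b} D (\<lambda>s. c s * cnj (S s))"
proof -
  have "ac_deriv {a..b} D (\<lambda>s. c s * cnj (hexp_series a c s) - - c s * cnj (hexp_series a (\<lambda>s. - c s) s))"
    using ac_deriv_diff[OF ac_deriv_series hexp_coeff.ac_deriv_series[OF minus]] by (simp add: D_def[abs_def])
  then show ?thesis by (rule ac_deriv_cong_ae[OF _ negligible_empty]) (simp add: S_def algebra_simps)
qed

lemma S_D_invariant:
  assumes x: "x \<in> {a..b}"
  shows "S x * cnj (S x) - D x * cnj (D x) = 4"
proof -
  have "ac_deriv {a..b} (\<lambda>x. S x * cnj (S x) - D x * cnj (D x))
    (\<lambda>s. (S s * cnj (c s * cnj (D s)) + c s * cnj (D s) * cnj (S s)) - (D s * cnj (c s * cnj (S s)) + c s * cnj (S s) * cnj (D s)))"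
    by (intro ac_deriv_diff ac_deriv_mult ac_deriv_S ac_deriv_D ac_deriv_cnj) auto
  then have "ac_deriv {a..b} (\<lambda>x. S x * cnj (S x) - D x * cnj (D x)) (\<lambda>x. 0)"
    by (rule ac_deriv_cong_ae[OF _ negligible_empty]) (simp add: algebra_simps)
  then have "S x * cnj (S x) - D x * cnj (D x) = S a * cnj (S a) - D a * cnj (D a)"
    by (rule ac_deriv_zero_imp_const) (use x ab in auto)
  then show ?thesis by (simp add: S_start D_start)
qed

lemma S_D_norm:
  assumes x: "x \<in> {a..b}"
  shows "(cmod (S x))\<^sup>2 - (cmod (D x))\<^sup>2 = 4"
proof -
  have "complex_of_real ((cmod (S x))\<^sup>2 - (cmod (D x))\<^sup>2) = of_real 4"
    using S_D_invariant[OF x] by (simp only: of_real_diff complex_norm_square) simp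
  then show ?thesis by (simp only: of_real_eq_iff)
qed

lemma S_norm_ge:
  assumes x: "x \<in> {a..b}"
  shows "2 \<le> cmod (S x)"
proof (rule power2_le_imp_le)
  have "(cmod (S x))\<^sup>2 = 4 + (cmod (D x))\<^sup>2" using S_D_norm[OF x] by linarith
  then show "2\<^sup>2 \<le> (cmod (S x))\<^sup>2" by simp
qed simp

lemma D_less_S:
  assumes x: "x \<in> {a..b}"
  shows "cmod (D x) < cmod (S x)"
proof (rule power2_less_imp_less)
  show "(cmod (D x))\<^sup>2 < (cmod (S x))\<^sup>2" using S_D_norm[OF x] by simp
qed simp

text \<open>Adding the series for c and -c cancels the odd terms, so the majorant is the series of 2
  cosh instead of 2 exp.\<close>

lemma S_norm_le:
  assumes x: "x \<in> {a..b}"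
  shows "cmod (S x) \<le> 2 * cosh (B x)"
proof -
  have s: "summable (\<lambda>j. hexp_iter a c j x)" "summable (\<lambda>j. (- 1) ^ j * hexp_iter a c j x)"
    using summable_norm_cancel[OF summable_iter[OF x]]
      summable_norm_cancel[OF hexp_coeff.summable_iter[OF minus x]] by (auto simp: iter_minus)
  have e: "summable (\<lambda>j. (1 + (- 1) ^ j) * (B x ^ j / fact j))"
    using summable_add[OF exp_summable[of "B x"] exp_summable[of "- B x"]]
    by (rule back_subst[of summable]) (auto simp add: fun_eq_iff distrib_right add_divide_distrib power_minus[of "B x"])
  have "S x = (\<Sum>j. (1 + (- 1) ^ j) * hexp_iter a c j x)"
    unfolding S_def hexp_series_def iter_minus using suminf_add[OF s] by (simp add: distrib_right)
  also have "cmod \<dots> \<le> (\<Sum>j. (1 + (- 1) ^ j) * (B x ^ j / fact j))"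
  proof (rule norm_suminf_le[OF _ e])
    fix j
    have "(1 + (- 1) ^ j :: complex) = of_real (1 + (- 1) ^ j)" by simp
    then have "cmod ((1 + (- 1) ^ j) * hexp_iter a c j x) = \<bar>1 + (- 1) ^ j\<bar> * cmod (hexp_iter a c j x)"
      by (simp only: norm_mult norm_of_real)
    also have "\<bar>1 + (- 1) ^ j :: real\<bar> = 1 + (- 1) ^ j" by (cases "even j") auto
    finally show "cmod ((1 + (- 1) ^ j) * hexp_iter a c j x) \<le> (1 + (- 1) ^ j) * (B x ^ j / fact j)"
      using mult_left_mono[OF iter_bound[OF x, of j], of "1 + (- 1) ^ j"] by (cases "even j") auto
  qed
  also have "\<dots> = (\<Sum>j. B x ^ j / fact j) + (\<Sum>j. (- B x) ^ j / fact j)"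
    by (subst suminf_add[OF exp_summable exp_summable]) (simp add: distrib_right add_divide_distrib power_minus[of "B x"])
  also have "\<dots> = exp (B x) + exp (- B x)" by (simp add: exp_def field_simps)
  finally show ?thesis by (simp add: cosh_def)
qed

text \<open>Reduces both the bound by tanh and the logarithm in the energy inequality to the size of
  S.\<close>

lemma quotient_norm: 
  assumes x: "x \<in> {a..b}"
  shows "1 - (cmod (D x / S x))\<^sup>2 = 4 / (cmod (S x))\<^sup>2"
proof -
  have "cmod (S x) \<noteq> 0" using S_norm_ge[OF x] by linarith
  then have "1 - (cmod (D x / S x))\<^sup>2 = ((cmod (S x))\<^sup>2 - (cmod (D x))\<^sup>2) / (cmod (S x))\<^sup>2"
    by (simp add: norm_divide power_divide diff_divide_distrib)
  then show ?thesis by (simp only: S_D_norm[OF x])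
qed

lemma quotient_le_tanh:
  assumes x: "x \<in> {a..b}"
  shows "cmod (D x / S x) \<le> tanh (B x)"
proof (rule power2_le_imp_le)
  have p: "0 < cmod (S x)" using S_norm_ge[OF x] by linarith
  have "(cmod (S x))\<^sup>2 \<le> (2 * cosh (B x))\<^sup>2" using S_norm_le[OF x] by (rule power_mono) simp
  then have "1 / (cosh (B x))\<^sup>2 \<le> 4 / (cmod (S x))\<^sup>2"
    using p by (simp add: field_simps power2_eq_square)
  moreover have "(tanh (B x))\<^sup>2 = 1 - 1 / (cosh (B x))\<^sup>2"
    by (simp add: tanh_def power_divide sinh_square_eq field_simps)
  ultimately show "(cmod (D x / S x))\<^sup>2 \<le> (tanh (B x))\<^sup>2" using quotient_norm[OF x] by linarith
  show "0 \<le> tanh (B x)" using B_nonneg[OF x] by simp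
qed

end

section \<open>Iterated integrals\<close>

lemma sigma_finite_lebesgue: "sigma_finite_measure (lebesgue :: real measure)"
proof
  show "\<exists>A::real set set. countable A \<and> A \<subseteq> sets lebesgue \<and> \<Union> A = space lebesgue \<and> (\<forall>a\<in>A. emeasure lebesgue a \<noteq> \<infinity>)"
  proof (intro exI[of _ "range (\<lambda>n::nat. {- real n..real n})"] conjI)
    show "\<Union> (range (\<lambda>n::nat. {- real n..real n})) = space lebesgue"
    proof -
      have "\<exists>n::nat. x \<in> {- real n..real n}" for x :: real
      proof -
        obtain n :: nat where "\<bar>x\<bar> \<le> real n" using real_arch_simple by blast
        then have "x \<in> {- real n..real n}" by auto
        then show ?thesis ..
      qed
      then show ?thesis by auto
    qed
  qed auto
qed

interpretation lebesgue_product: product_sigma_finite "\<lambda>_::nat. lebesgue :: real measure"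
  unfolding product_sigma_finite_def using sigma_finite_lebesgue by blast

text \<open>Fubini with the new coordinate outermost, the order required by the recursion: the
  largest variable is integrated last.\<close>

lemma (in product_sigma_finite) product_integral_insert_rev:
  fixes f :: "_ \<Rightarrow> _::{banach, second_countable_topology}"
  assumes I: "finite I" "i \<notin> I"
    and f: "integrable (Pi\<^sub>M (insert i I) M) f"
  shows "integral\<^sup>L (Pi\<^sub>M (insert i I) M) f = (\<integral>y. (\<integral>x. f (x(i:=y)) \<partial>Pi\<^sub>M I M) \<partial>M i)"
proof -
  interpret P: finite_product_sigma_finite M I by standard fact
  have "integral\<^sup>L (Pi\<^sub>M (insert i I) M) f = integral\<^sup>L (Pi\<^sub>M ({i} \<union> I) M) f"
    by simp
  also have "\<dots> = (\<integral>y. (\<integral>x. f (merge {i} I (y,x)) \<partial>Pi\<^sub>M I M) \<partial>Pi\<^sub>M {i} M)"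
    using f I by (intro product_integral_fold) auto
  also have "\<dots> = (\<integral>y. (\<integral>x. f (x(i := y i)) \<partial>Pi\<^sub>M I M) \<partial>Pi\<^sub>M {i} M)"
  proof (intro Bochner_Integration.integral_cong refl)
    fix x y assume "x \<in> space (Pi\<^sub>M I M)"
    then have "merge {i} I (y,x) = x(i := y i)"
      using I by (auto simp: merge_def space_PiM PiE_def extensional_def fun_eq_iff)
    then show "f (merge {i} I (y,x)) = f (x(i := y i))" by simp
  qed
  also have "\<dots> = (\<integral>y. (\<integral>x. f (x(i:=y)) \<partial>Pi\<^sub>M I M) \<partial>M i)"
  proof (rule product_integral_singleton)
    have "(\<lambda>(x, y). x(i := y)) \<in> measurable (Pi\<^sub>M I M \<Otimes>\<^sub>M M i) (Pi\<^sub>M (insert i I) M)"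
      by (rule measurable_add_dim)
    from measurable_compose[OF measurable_compose[OF measurable_pair_swap' this] borel_measurable_integrable[OF f]]
    have "(\<lambda>(y, x). f (x(i := y))) \<in> borel_measurable (M i \<Otimes>\<^sub>M Pi\<^sub>M I M)"
      by (simp add: split_def)
    then show "(\<lambda>y. \<integral>x. f (x(i:=y)) \<partial>Pi\<^sub>M I M) \<in> borel_measurable (M i)"
      by (rule P.borel_measurable_lebesgue_integral)
  qed
  finally show ?thesis .
qed

definition ordered_simplex :: "real \<Rightarrow> real \<Rightarrow> nat \<Rightarrow> (nat \<Rightarrow> real) set" where
  "ordered_simplex a x j = {s. strict_mono_on {1..j} s \<and> (\<forall>\<nu>\<in>{1..j}. a < s \<nu> \<and> s \<nu> < x)}"

text \<open>This closes the recursion: the last variable t becomes the upper end point for all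
  earlier ones.\<close>

lemma ordered_simplex_Suc:
  assumes "a < t" "t < x"
  shows "s(Suc j := t) \<in> ordered_simplex a x (Suc j) \<longleftrightarrow> s \<in> ordered_simplex a t j"
proof
  assume L: "s(Suc j := t) \<in> ordered_simplex a x (Suc j)"
  then have mono: "strict_mono_on {1..Suc j} (s(Suc j := t))" unfolding ordered_simplex_def by blast
  have "s m < s n" if "m \<in> {1..j}" "n \<in> {1..j}" "m < n" for m n
    using strict_mono_onD[OF mono, of m n] that by auto
  moreover have "s n < t" if "n \<in> {1..j}" for n
    using strict_mono_onD[OF mono, of n "Suc j"] that by auto
  moreover have "a < s n" if "n \<in> {1..j}" for n
    using L that unfolding ordered_simplex_def by (auto dest!: bspec[of _ _ n])
  ultimately show "s \<in> ordered_simplex a t j" unfolding ordered_simplex_def strict_mono_on_def by blast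
next
  assume R: "s \<in> ordered_simplex a t j"
  then have s: "a < s n" "s n < t" if "n \<in> {1..j}" for n
    using that unfolding ordered_simplex_def by auto
  have "strict_mono_on {1..Suc j} (s(Suc j := t))"
  proof (rule strict_mono_onI)
    fix m n assume mn: "m \<in> {1..Suc j}" "n \<in> {1..Suc j}" "m < n"
    then have m: "m \<in> {1..j}" by auto
    show "(s(Suc j := t)) m < (s(Suc j := t)) n"
    proof (cases "n = Suc j")
      case True
      then show ?thesis using s(2)[OF m] mn by simp
    next
      case False
      then have "n \<in> {1..j}" using mn by auto
      then show ?thesis using R m mn False unfolding ordered_simplex_def strict_mono_on_def by auto
    qed
  qed
  moreover have "a < (s(Suc j := t)) n \<and> (s(Suc j := t)) n < x" if "n \<in> {1..Suc j}" for n
  proof (cases "n = Suc j")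
    case False
    then show ?thesis using s[of n] that assms by auto
  qed (use assms in auto)
  ultimately show "s(Suc j := t) \<in> ordered_simplex a x (Suc j)" unfolding ordered_simplex_def by blast
qed

lemma ordered_simplex_last:
  "s(Suc j := t) \<in> ordered_simplex a x (Suc j) \<Longrightarrow> a < t \<and> t < x"
  unfolding ordered_simplex_def by (auto dest!: bspec[of _ _ "Suc j"])

lemma ordered_simplex_measurable:
  "{s \<in> space (PiM {1..j} (\<lambda>_. lebesgue)). s \<in> ordered_simplex a x j} \<in> sets (PiM {1..j} (\<lambda>_. lebesgue))"
proof -
  have m: "(\<lambda>s. s \<nu>) \<in> borel_measurable (PiM {1..j} (\<lambda>_. lebesgue))" if "\<nu> \<in> {1..j}" for \<nu>
  proof (rule measurable_compose[OF measurable_component_singleton[OF that]])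
    show "(\<lambda>x. x) \<in> borel_measurable lebesgue" by (rule measurable_completion) simp
  qed
  have "{s \<in> space (PiM {1..j} (\<lambda>_. lebesgue)). s \<in> ordered_simplex a x j} =
    {s \<in> space (PiM {1..j} (\<lambda>_. lebesgue)). (\<forall>\<mu>\<in>{1..j}. \<forall>\<nu>\<in>{1..j}. \<mu> < \<nu> \<longrightarrow> s \<mu> < s \<nu>) \<and> (\<forall>\<nu>\<in>{1..j}. a < s \<nu> \<and> s \<nu> < x)}"
    by (auto simp: ordered_simplex_def strict_mono_on_def)
  also have "\<dots> \<in> sets (PiM {1..j} (\<lambda>_. lebesgue))"
    by (intro sets.sets_Collect_conj sets.sets_Collect_finite_All sets.sets_Collect_imp sets.sets_Collect_const
       borel_measurable_less borel_measurable_const m) auto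
  finally show ?thesis .
qed

definition hexp_integrand :: "(real \<Rightarrow> real) \<Rightarrow> real \<Rightarrow> real \<Rightarrow> real \<Rightarrow> nat \<Rightarrow> (nat \<Rightarrow> real) \<Rightarrow> complex" where
  "hexp_integrand \<alpha> a \<omega> x j s = indicator (ordered_simplex a x j) s *\<^sub>R
     (exp (2 * \<i> * complex_of_real (\<omega> * (\<Sum>\<nu>=1..j. (- 1) ^ (j - \<nu>) * (s \<nu> - a)))) * complex_of_real (\<Prod>\<nu>=1..j. \<alpha> (s \<nu>)))"

lemma harmonic_exp_term_eq:
  "harmonic_exp_term \<alpha> a x \<omega> j = (\<integral>s. hexp_integrand \<alpha> a \<omega> x j s \<partial>PiM {1..j} (\<lambda>_. lebesgue))"
  unfolding harmonic_exp_term_def set_lebesgue_integral_def hexp_integrand_def ordered_simplex_def ..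

text \<open>Removing the last variable changes the parity of every remaining exponent. The remaining
  phase is thus negated, which amounts to a conjugation because \<alpha> is real.\<close>

lemma hexp_integrand_Suc:
  assumes t: "a < t" "t < x"
  shows "hexp_integrand \<alpha> a \<omega> x (Suc j) (s(Suc j := t)) =
     (of_real (\<alpha> t) * exp (2 * \<i> * of_real (\<omega> * (t - a)))) * cnj (hexp_integrand \<alpha> a \<omega> t j s)"
proof -
  have "(\<Sum>\<nu>=1..Suc j. (- 1) ^ (Suc j - \<nu>) * ((s(Suc j := t)) \<nu> - a)) = (t - a) + (\<Sum>\<nu>=1..j. (- 1) ^ (Suc j - \<nu>) * (s \<nu> - a))"
    by simp
  also have "(\<Sum>\<nu>=1..j. (- 1) ^ (Suc j - \<nu>) * (s \<nu> - a)) = (\<Sum>\<nu>=1..j. - ((- 1) ^ (j - \<nu>) * (s \<nu> - a)))"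
    by (intro sum.cong) (auto simp: Suc_diff_le)
  also have "\<dots> = - (\<Sum>\<nu>=1..j. (- 1) ^ (j - \<nu>) * (s \<nu> - a))" by (rule sum_negf)
  finally have sum: "(\<Sum>\<nu>=1..Suc j. (- 1) ^ (Suc j - \<nu>) * ((s(Suc j := t)) \<nu> - a)) = (t - a) - (\<Sum>\<nu>=1..j. (- 1) ^ (j - \<nu>) * (s \<nu> - a))"
    by simp
  have prod: "(\<Prod>\<nu>=1..Suc j. \<alpha> ((s(Suc j := t)) \<nu>)) = \<alpha> t * (\<Prod>\<nu>=1..j. \<alpha> (s \<nu>))"
    by (simp add: mult.commute)
  define P where "P = (\<Sum>\<nu>=1..j. (- 1) ^ (j - \<nu>) * (s \<nu> - a))"
  have "exp (2 * \<i> * complex_of_real (\<omega> * ((t - a) - P))) = exp (2 * \<i> * of_real (\<omega> * (t - a))) * cnj (exp (2 * \<i> * of_real (\<omega> * P)))"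
    unfolding exp_cnj exp_add[symmetric] by (simp add: algebra_simps)
  then show ?thesis
    unfolding hexp_integrand_def sum prod P_def[symmetric]
    by (simp add: ordered_simplex_Suc[OF t] indicator_def)
qed

lemma hexp_integrand_Suc_zero:
  assumes "\<not> (a < t \<and> t < x)"
  shows "hexp_integrand \<alpha> a \<omega> x (Suc j) (s(Suc j := t)) = 0"
  using ordered_simplex_last[of s j t a x] assms unfolding hexp_integrand_def by (auto simp: indicator_def)

lemma hexp_integrand_integrable:
  fixes \<alpha> :: "real \<Rightarrow> real"
  assumes \<alpha>: "\<alpha> absolutely_integrable_on {a<..<b}" and x: "x \<le> b"
  shows "integrable (PiM {1..j} (\<lambda>_. lebesgue)) (hexp_integrand \<alpha> a \<omega> x j)"
proof -
  let ?M = "PiM {1..j} (\<lambda>_. lebesgue :: real measure)"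
  \<comment> \<open>Only the restriction of \<alpha> to the interval is known to be measurable. Its
    extension by zero is integrable on the line and agrees with \<alpha> at the coordinates of a
    point of the simplex, because x \<le> b; the product of its values dominates the integrand,
    whose phase factor has modulus one.\<close>
  define \<alpha>0 where "\<alpha>0 t = indicator {a<..<b} t *\<^sub>R \<alpha> t" for t
  have i0: "integrable lebesgue \<alpha>0" using \<alpha> unfolding set_integrable_def \<alpha>0_def .
  have I: "integrable ?M (\<lambda>s. \<Prod>\<nu>\<in>{1..j}. \<alpha>0 (s \<nu>))"
    by (rule lebesgue_product.product_integrable_prod) (use i0 in auto)
  define \<Phi> where "\<Phi> s = indicator {s \<in> space ?M. s \<in> ordered_simplex a x j} s *\<^sub>R
     (exp (2 * \<i> * complex_of_real (\<omega> * (\<Sum>\<nu>=1..j. (- 1) ^ (j - \<nu>) * (s \<nu> - a)))) * complex_of_real (\<Prod>\<nu>=1..j. \<alpha>0 (s \<nu>)))" for s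
  have m: "(\<lambda>s. s \<nu>) \<in> borel_measurable ?M" if "\<nu> \<in> {1..j}" for \<nu>
  proof (rule measurable_compose[OF measurable_component_singleton[OF that]])
    show "(\<lambda>x. x) \<in> borel_measurable lebesgue" by (rule measurable_completion) simp
  qed
  have e: "(\<lambda>s. exp (2 * \<i> * complex_of_real (\<omega> * (\<Sum>\<nu>=1..j. (- 1) ^ (j - \<nu>) * (s \<nu> - a))))) \<in> borel_measurable ?M"
  proof (rule measurable_compose[of "\<lambda>s. \<Sum>\<nu>=1..j. (- 1) ^ (j - \<nu>) * (s \<nu> - a)" ?M borel "\<lambda>r. exp (2 * \<i> * complex_of_real (\<omega> * r))"])
    show "(\<lambda>s. \<Sum>\<nu>=1..j. (- 1) ^ (j - \<nu>) * (s \<nu> - a)) \<in> borel_measurable ?M"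
      by (intro borel_measurable_sum borel_measurable_times borel_measurable_diff borel_measurable_const m) auto
    show "(\<lambda>r. exp (2 * \<i> * complex_of_real (\<omega> * r))) \<in> borel_measurable borel"
      by (intro borel_measurable_continuous_onI continuous_intros)
  qed
  have \<Phi>m: "\<Phi> \<in> borel_measurable ?M"
    unfolding \<Phi>_def
    by (intro borel_measurable_scaleR borel_measurable_indicator ordered_simplex_measurable borel_measurable_times e
      measurable_compose[OF borel_measurable_integrable[OF I]] borel_measurable_of_real)
  have "integrable ?M \<Phi>"
  proof (rule Bochner_Integration.integrable_bound[OF I \<Phi>m])
    show "AE s in ?M. norm (\<Phi> s) \<le> norm (\<Prod>\<nu>\<in>{1..j}. \<alpha>0 (s \<nu>))"
    proof (rule AE_I2)
      fix s
      have n: "cmod (exp (2 * \<i> * complex_of_real r) * complex_of_real p) = \<bar>p\<bar>" for r p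
        by (simp add: norm_mult norm_exp_eq_Re)
      show "norm (\<Phi> s) \<le> norm (\<Prod>\<nu>\<in>{1..j}. \<alpha>0 (s \<nu>))"
        unfolding \<Phi>_def norm_scaleR n real_norm_def by (rule mult_left_le_one_le) (auto simp: indicator_def)
    qed
  qed
  moreover have "\<Phi> s = hexp_integrand \<alpha> a \<omega> x j s" if s: "s \<in> space ?M" for s
  proof (cases "s \<in> ordered_simplex a x j")
    case True
    have "(\<Prod>\<nu>=1..j. \<alpha>0 (s \<nu>)) = (\<Prod>\<nu>=1..j. \<alpha> (s \<nu>))"
    proof (rule prod.cong)
      fix \<nu> assume "\<nu> \<in> {1..j}"
      then have "a < s \<nu>" "s \<nu> < x" using True unfolding ordered_simplex_def by auto
      then show "\<alpha>0 (s \<nu>) = \<alpha> (s \<nu>)" unfolding \<alpha>0_def using x by simp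
    qed simp
    then show ?thesis unfolding \<Phi>_def hexp_integrand_def using s by (simp add: indicator_def)
  qed (simp add: \<Phi>_def hexp_integrand_def)
  ultimately show ?thesis by (simp cong: Bochner_Integration.integrable_cong)
qed

text \<open>Over the empty index set the product measure is a unit point mass; the summand 1 of the
  harmonic exponential thus becomes the term of order zero.\<close>

lemma harmonic_exp_term_0: "harmonic_exp_term \<alpha> a x \<omega> 0 = 1"
  by (simp add: harmonic_exp_term_eq hexp_integrand_def ordered_simplex_def PiM_empty
    lebesgue_integral_count_space_finite strict_mono_on_def)

lemma harmonic_exp_term_Suc:
  fixes \<alpha> :: "real \<Rightarrow> real"
  assumes \<alpha>: "\<alpha> absolutely_integrable_on {a<..<b}" and x: "x \<le> b"
  shows "harmonic_exp_term \<alpha> a x \<omega> (Suc j) =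
    (LINT t:{a<..<x}|lebesgue. of_real (\<alpha> t) * exp (2 * \<i> * of_real (\<omega> * (t - a))) * cnj (harmonic_exp_term \<alpha> a t \<omega> j))"
proof -
  have ins: "{1..Suc j} = insert (Suc j) {1..j}" by auto
  have "harmonic_exp_term \<alpha> a x \<omega> (Suc j) = (\<integral>t. (\<integral>s. hexp_integrand \<alpha> a \<omega> x (Suc j) (s(Suc j := t)) \<partial>PiM {1..j} (\<lambda>_. lebesgue)) \<partial>lebesgue)"
    unfolding harmonic_exp_term_eq ins
    using hexp_integrand_integrable[OF \<alpha> x, of "Suc j" \<omega>, unfolded ins]
    by (intro lebesgue_product.product_integral_insert_rev) auto
  also have "\<dots> = (LINT t:{a<..<x}|lebesgue. of_real (\<alpha> t) * exp (2 * \<i> * of_real (\<omega> * (t - a))) * cnj (harmonic_exp_term \<alpha> a t \<omega> j))"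
    unfolding set_lebesgue_integral_def
  proof (intro Bochner_Integration.integral_cong refl)
    fix t :: real
    show "(\<integral>s. hexp_integrand \<alpha> a \<omega> x (Suc j) (s(Suc j := t)) \<partial>PiM {1..j} (\<lambda>_. lebesgue)) =
      indicator {a<..<x} t *\<^sub>R (of_real (\<alpha> t) * exp (2 * \<i> * of_real (\<omega> * (t - a))) * cnj (harmonic_exp_term \<alpha> a t \<omega> j))"
    proof (cases "a < t \<and> t < x")
      case True
      then show ?thesis
        unfolding harmonic_exp_term_eq by (simp add: hexp_integrand_Suc)
    next
      case False
      then show ?thesis by (simp add: hexp_integrand_Suc_zero)
    qed
  qed
  finally show ?thesis .
qed

section \<open>Identification of the series with the harmonic exponential\<close>

abbreviation modulated :: "(real \<Rightarrow> real) \<Rightarrow> real \<Rightarrow> real \<Rightarrow> real \<Rightarrow> complex" where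
  "modulated \<alpha> a \<omega> \<equiv> \<lambda>s. of_real (\<alpha> s) * exp (2 * \<i> * of_real (\<omega> * (s - a)))"

lemma absolutely_integrable_modulated:
  fixes \<alpha> :: "real \<Rightarrow> real"
  assumes "\<alpha> absolutely_integrable_on {a..b}"
  shows "modulated \<alpha> a \<omega> absolutely_integrable_on {a..b}"
proof (rule absolutely_integrable_mult_continuous)
  show "(\<lambda>s. complex_of_real (\<alpha> s)) absolutely_integrable_on {a..b}"
    using absolutely_integrable_linear[OF assms bounded_linear_of_real] by (simp add: o_def)
qed (intro continuous_intros)

lemma absolutely_integrable_on_Ioo_iff:
  fixes f :: "real \<Rightarrow> 'a::euclidean_space"
  shows "f absolutely_integrable_on {a<..<b} \<longleftrightarrow> f absolutely_integrable_on {a..b}"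
proof (rule absolutely_integrable_spike_set_eq)
  show "negligible {x \<in> {a<..<b} - {a..b}. f x \<noteq> 0}" by (rule negligible_subset[of "{}"]) auto
  show "negligible {x \<in> {a..b} - {a<..<b}. f x \<noteq> 0}"
    by (rule negligible_subset[of "{a,b}"]) auto
qed

lemma harmonic_exp_term_eq_iter:
  fixes \<alpha> :: "real \<Rightarrow> real"
  assumes \<alpha>: "\<alpha> absolutely_integrable_on {a..b}"
  shows "x \<in> {a..b} \<Longrightarrow> harmonic_exp_term \<alpha> a x \<omega> j = hexp_iter a (modulated \<alpha> a \<omega>) j x"
proof (induction j arbitrary: x)
  case 0 show ?case by (simp add: harmonic_exp_term_0)
next
  case (Suc j)
  have \<alpha>': "\<alpha> absolutely_integrable_on {a<..<b}" using \<alpha> by (simp add: absolutely_integrable_on_Ioo_iff)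
  let ?g = "\<lambda>t. modulated \<alpha> a \<omega> t * cnj (hexp_iter a (modulated \<alpha> a \<omega>) j t)"
  have gi: "?g absolutely_integrable_on {a<..<x}"
    using absolutely_integrable_on_subinterval[OF hexp_iter_integrable[OF absolutely_integrable_modulated[OF \<alpha>]], of a x] Suc.prems
    by (auto simp: absolutely_integrable_on_Ioo_iff)
  have "harmonic_exp_term \<alpha> a x \<omega> (Suc j) = (LINT t:{a<..<x}|lebesgue. modulated \<alpha> a \<omega> t * cnj (harmonic_exp_term \<alpha> a t \<omega> j))"
    using Suc.prems by (intro harmonic_exp_term_Suc[OF \<alpha>']) auto
  also have "\<dots> = (LINT t:{a<..<x}|lebesgue. ?g t)"
    using Suc.prems by (intro set_lebesgue_integral_cong) (auto simp: Suc.IH)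
  also have "\<dots> = integral {a<..<x} ?g" by (rule set_lebesgue_integral_eq_integral(2)[OF gi])
  also have "\<dots> = integral {a..x} ?g" using integral_open_interval_real[of a x ?g] by simp
  finally show ?case by simp
qed

lemma hexp_coeff_modulated:
  fixes \<alpha> :: "real \<Rightarrow> real"
  assumes "\<alpha> absolutely_integrable_on {a..b}" "a \<le> b"
  shows "hexp_coeff a b (modulated \<alpha> a \<omega>) (\<lambda>s. \<bar>\<alpha> s\<bar>)"
proof
  show "(\<lambda>s. \<bar>\<alpha> s\<bar>) absolutely_integrable_on {a..b}" using set_integrable_abs[OF assms(1)] .
qed (use assms absolutely_integrable_modulated in \<open>auto simp: norm_mult\<close>)

lemma harmonic_exp_eq_series:
  fixes \<alpha> :: "real \<Rightarrow> real"
  assumes \<alpha>: "\<alpha> absolutely_integrable_on {a..b}" and x: "x \<in> {a..b}"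
  shows "harmonic_exp \<alpha> a x \<omega> = hexp_series a (modulated \<alpha> a \<omega>) x"
proof -
  interpret hexp_coeff a b "modulated \<alpha> a \<omega>" "\<lambda>s. \<bar>\<alpha> s\<bar>"
    using \<alpha> x by (intro hexp_coeff_modulated) auto
  have "summable (\<lambda>j. hexp_iter a (modulated \<alpha> a \<omega>) j x)"
    by (rule summable_norm_cancel[OF summable_iter[OF x]])
  from suminf_split_head[OF this] show ?thesis
    unfolding harmonic_exp_def hexp_series_def harmonic_exp_term_eq_iter[OF \<alpha> x] by simp
qed

lemma harmonic_exp_minus_eq_series:
  fixes \<alpha> :: "real \<Rightarrow> real"
  assumes \<alpha>: "\<alpha> absolutely_integrable_on {a..b}" and x: "x \<in> {a..b}"
  shows "harmonic_exp (\<lambda>s. - \<alpha> s) a x \<omega> = hexp_series a (\<lambda>s. - modulated \<alpha> a \<omega> s) x"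
proof -
  have "(\<lambda>s. - \<alpha> s) absolutely_integrable_on {a..b}"
    using absolutely_integrable_scaleR_left[OF \<alpha>, of "-1"] by simp
  from harmonic_exp_eq_series[OF this x] show ?thesis by simp
qed

section \<open>The boundary value problem\<close>

lemma AE_lebesgue_on_iff_negligible:
  assumes "S \<in> sets lebesgue"
  shows "(AE x in lebesgue_on S. P x) \<longleftrightarrow> (\<exists>N. negligible N \<and> (\<forall>x\<in>S - N. P x))"
proof
  assume "AE x in lebesgue_on S. P x"
  then have "AE x in lebesgue. x \<in> S \<longrightarrow> P x" using assms by (simp add: AE_restrict_space_iff)
  then obtain N where N: "N \<in> null_sets lebesgue" "{x \<in> space lebesgue. \<not> (x \<in> S \<longrightarrow> P x)} \<subseteq> N"
    unfolding eventually_ae_filter by blast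
  then show "\<exists>N. negligible N \<and> (\<forall>x\<in>S - N. P x)"
    by (intro exI[of _ N]) (auto simp: negligible_iff_null_sets)
next
  assume "\<exists>N. negligible N \<and> (\<forall>x\<in>S - N. P x)"
  then obtain N where N: "N \<in> null_sets lebesgue" "\<forall>x\<in>S - N. P x" by (auto simp: negligible_iff_null_sets)
  then have "AE x in lebesgue. x \<in> S \<longrightarrow> P x" unfolding eventually_ae_filter by blast
  then show "AE x in lebesgue_on S. P x" using assms by (simp add: AE_restrict_space_iff)
qed

lemma ac_deriv_iff_AE:
  assumes "S \<in> sets lebesgue"
  shows "ac_deriv S f f' \<longleftrightarrow> absolutely_continuous_on S f \<and> (AE x in lebesgue_on S. (f has_vector_derivative f' x) (at x))"
  unfolding ac_deriv_def AE_lebesgue_on_iff_negligible[OF assms] ..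

lemma ac_deriv_inverse:
  fixes f :: "real \<Rightarrow> real"
  assumes f: "ac_deriv S f f'" and e: "e > 0" "\<And>x. x \<in> S \<Longrightarrow> f x > e"
  shows "ac_deriv S (\<lambda>x. 1 / f x) (\<lambda>x. - f' x / (f x)\<^sup>2)"
proof -
  obtain N where N: "negligible N" "\<And>x. x \<in> S - N \<Longrightarrow> (f has_vector_derivative f' x) (at x)"
    using f unfolding ac_deriv_def by blast
  have "((\<lambda>x. 1 / f x) has_vector_derivative - f' x / (f x)\<^sup>2) (at x)" if x: "x \<in> S - N" for x
  proof -
    have "f x \<noteq> 0" using e x by force
    have "(f has_real_derivative f' x) (at x)" using N(2)[OF x] by (simp add: has_real_derivative_iff_has_vector_derivative)
    from DERIV_inverse_fun[OF this \<open>f x \<noteq> 0\<close>]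
    have "((\<lambda>x. 1 / f x) has_real_derivative - f' x / (f x)\<^sup>2) (at x)"
      using \<open>f x \<noteq> 0\<close> by (simp add: field_simps power2_eq_square)
    then show ?thesis by (simp add: has_real_derivative_iff_has_vector_derivative)
  qed
  then show ?thesis
    unfolding ac_deriv_def using N(1) absolutely_continuous_on_inverse[OF ac_deriv_imp_ac[OF f] e] by blast
qed

text \<open>The relation \<alpha> = -\<zeta>' / (2 \<zeta>) enters without division. \<zeta> is
  given on the open interval, whereas what is built from \<alpha> lives on the closed one and has
  values at the end points.\<close>

locale wave_problem =
  fixes a b \<omega> \<epsilon> :: real and \<alpha> \<zeta> :: "real \<Rightarrow> real"
  assumes a_less_b: "a < b" and omega: "\<omega> \<noteq> 0" and \<alpha>: "\<alpha> absolutely_integrable_on {a..b}"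
    and \<zeta>: "ac_deriv {a<..<b} \<zeta> (\<lambda>x. - 2 * \<alpha> x * \<zeta> x)"
    and eps: "\<epsilon> > 0" "\<And>x. x \<in> {a<..<b} \<Longrightarrow> \<zeta> x > \<epsilon>"
begin

definition coeff :: "real \<Rightarrow> complex" where "coeff = modulated \<alpha> a \<omega>"

sublocale hexp_coeff a b coeff "\<lambda>s. \<bar>\<alpha> s\<bar>"
  unfolding coeff_def using a_less_b by (intro hexp_coeff_modulated \<alpha>) auto

definition e :: "real \<Rightarrow> complex" where "e x = exp (\<i> * of_real (\<omega> * (x - a)))"

lemma e_square: "exp (2 * \<i> * of_real (\<omega> * (x - a))) = e x * e x"
  unfolding e_def exp_add[symmetric] by (simp add: algebra_simps)

lemma coeff_eq: "coeff x = of_real (\<alpha> x) * (e x * e x)"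
  unfolding coeff_def e_square ..

lemma e_cnj: "e x * cnj (e x) = 1"
  unfolding e_def exp_cnj exp_add[symmetric] by simp

lemma e_start: "e a = 1" by (simp add: e_def)

lemma ac_deriv_e: "ac_deriv {a..b} e (\<lambda>x. \<i> * of_real \<omega> * e x)"
  using ac_deriv_expi[of "{a..b}" \<omega> a] by (simp add: e_def[abs_def])

lemma ac_deriv_cnj_e: "ac_deriv {a..b} (\<lambda>x. cnj (e x)) (\<lambda>x. - \<i> * of_real \<omega> * cnj (e x))"
  using ac_deriv_cnj[OF ac_deriv_e] by simp

text \<open>Integrating factor: \<zeta> to the power -1/2, normalised to 1 at a. It removes the
  diagonal terms with \<alpha> from the system for the right and left parts.\<close>

definition K :: "real \<Rightarrow> complex" where "K x = of_real (exp (integral {a..x} \<alpha>))"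

lemma K_start: "K a = 1" by (simp add: K_def)
lemma K_nonzero: "K x \<noteq> 0" by (simp add: K_def)

lemma ac_deriv_K: "ac_deriv {a..b} K (\<lambda>x. of_real (\<alpha> x) * K x)"
  using ac_deriv_of_real[OF ac_deriv_exp[OF ac_deriv_indefinite_integral[OF \<alpha>]], where ?'a = complex] by (simp add: K_def[abs_def])

lemma ac_deriv_inverse_K: "ac_deriv {a..b} (\<lambda>x. 1 / K x) (\<lambda>x. - of_real (\<alpha> x) * (1 / K x))"
proof (rule ac_deriv_cong)
  show "ac_deriv {a..b} (\<lambda>x. complex_of_real (exp (- integral {a..x} \<alpha>))) (\<lambda>x. of_real (- \<alpha> x * exp (- integral {a..x} \<alpha>)))"
    by (rule ac_deriv_of_real[OF ac_deriv_exp[OF ac_deriv_minus[OF ac_deriv_indefinite_integral[OF \<alpha>]]]]) simp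
qed (auto simp: K_def exp_minus field_simps)

definition Q :: complex where "Q = exp (2 * \<i> * of_real ((b - a) * \<omega>))"

lemma Q_e: "Q = e b * e b"
  using e_square[of b] by (simp add: Q_def mult.commute)

text \<open>|Q| = 1 and |D b| < |S b|, so the second summand has smaller modulus than the
  first.\<close>

lemma denominator_nonzero:
  assumes "cmod \<xi> < 1"
  shows "S b + \<xi> * Q * cnj (D b) \<noteq> 0"
proof
  assume "S b + \<xi> * Q * cnj (D b) = 0"
  then have "cmod (S b) = cmod (\<xi> * Q * cnj (D b))" by (metis add_eq_0_iff norm_minus_cancel)
  also have "\<dots> = cmod \<xi> * cmod (D b)" by (simp add: norm_mult Q_def norm_exp_eq_Re)
  also have "\<dots> \<le> cmod (D b)" using assms by (intro mult_left_le_one_le) auto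
  finally show False using D_less_S[of b] a_less_b by simp
qed

text \<open>In \<open>bvp_solution_left_limit\<close> the conserved quantities turn out to be F = 2
  and G = 2 z; dividing their values at b, where l = \<xi> r, gives this expression for z.\<close>

definition reflected :: "complex \<Rightarrow> complex" where
  "reflected \<xi> = (D b + \<xi> * Q * cnj (S b)) / (S b + \<xi> * Q * cnj (D b))"

lemma tendsto_at_right_start: "continuous_on {a..b} f \<Longrightarrow> (f \<longlongrightarrow> f a) (at_right a)"
  using a_less_b by (simp add: continuous_on_def at_within_Icc_at_right[symmetric])

lemma tendsto_at_left_end: "continuous_on {a..b} f \<Longrightarrow> (f \<longlongrightarrow> f b) (at_left b)"
  using a_less_b by (simp add: continuous_on_def at_within_Icc_at_left[symmetric])

text \<open>Writing \<open>r = K e p\<close> and \<open>l = K cnj e q\<close> for the right and left parts of \<open>u\<close> turns the equation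
  into the system \<open>p' = - cnj c q\<close>, \<open>q' = - c p\<close>, which is solved by \<open>(cnj S, - D)\<close> and \<open>(- cnj D, S)\<close>.\<close>

lemma bvp_solution_exists:
  assumes \<xi>: "cmod \<xi> < 1"
  obtains u u' where "bvp_solution \<zeta> a b \<omega> \<xi> u u'" "(left_part \<omega> u u' \<longlongrightarrow> reflected \<xi>) (at_right a)"
proof -
  define z where "z = reflected \<xi>"
  \<comment> \<open>The combination of the two basic solutions with p a = 1 and q a = z; the
    condition at b then forces z = \<open>reflected \<xi>\<close>.\<close>
  define p where "p x = (cnj (S x) - z * cnj (D x)) / 2" for x
  define q where "q x = (z * S x - D x) / 2" for x
  have "ac_deriv {a..b} (\<lambda>x. 1/2 * (cnj (S x) - z * cnj (D x))) (\<lambda>x. 1/2 * (cnj (coeff x * cnj (D x)) - z * cnj (coeff x * cnj (S x))))"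
    by (intro ac_deriv_cmult ac_deriv_diff ac_deriv_cnj ac_deriv_S ac_deriv_D)
  then have p: "ac_deriv {a..b} p (\<lambda>x. - cnj (coeff x) * q x)"
    by (rule ac_deriv_cong) (simp_all add: p_def q_def algebra_simps)
  have "ac_deriv {a..b} (\<lambda>x. 1/2 * (z * S x - D x)) (\<lambda>x. 1/2 * (z * (coeff x * cnj (D x)) - coeff x * cnj (S x)))"
    by (intro ac_deriv_cmult ac_deriv_diff ac_deriv_S ac_deriv_D)
  then have q: "ac_deriv {a..b} q (\<lambda>x. - coeff x * p x)"
    by (rule ac_deriv_cong) (simp_all add: p_def q_def algebra_simps)
  define r where "r x = K x * (e x * p x)" for x
  define l where "l x = K x * (cnj (e x) * q x)" for x
  have r: "ac_deriv {a..b} r (\<lambda>x. \<i> * of_real \<omega> * r x + of_real (\<alpha> x) * (r x - l x))"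
  proof (rule ac_deriv_cong)
    show "ac_deriv {a..b} (\<lambda>x. K x * (e x * p x))
      (\<lambda>x. K x * (e x * (- cnj (coeff x) * q x) + \<i> * of_real \<omega> * e x * p x) + of_real (\<alpha> x) * K x * (e x * p x))"
      by (intro ac_deriv_mult ac_deriv_K ac_deriv_e p) auto
    fix x
    have "e x * cnj (coeff x) = of_real (\<alpha> x) * cnj (e x) * (e x * cnj (e x))" by (simp add: coeff_eq algebra_simps)
    then have ec: "e x * cnj (coeff x) = of_real (\<alpha> x) * cnj (e x)" by (simp add: e_cnj)
    have "K x * (e x * (- cnj (coeff x) * q x) + \<i> * of_real \<omega> * e x * p x) + of_real (\<alpha> x) * K x * (e x * p x)
       = K x * (- (e x * cnj (coeff x)) * q x + \<i> * of_real \<omega> * e x * p x) + of_real (\<alpha> x) * K x * (e x * p x)"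
      by (simp add: algebra_simps)
    also have "\<dots> = \<i> * of_real \<omega> * r x + of_real (\<alpha> x) * (r x - l x)"
      unfolding ec r_def l_def by (simp add: algebra_simps)
    finally show "K x * (e x * (- cnj (coeff x) * q x) + \<i> * of_real \<omega> * e x * p x) + of_real (\<alpha> x) * K x * (e x * p x)
      = \<i> * of_real \<omega> * r x + of_real (\<alpha> x) * (r x - l x)" .
  qed (simp add: r_def)
  have l: "ac_deriv {a..b} l (\<lambda>x. - \<i> * of_real \<omega> * l x - of_real (\<alpha> x) * (r x - l x))"
  proof (rule ac_deriv_cong)
    show "ac_deriv {a..b} (\<lambda>x. K x * (cnj (e x) * q x))
      (\<lambda>x. K x * (cnj (e x) * (- coeff x * p x) + - \<i> * of_real \<omega> * cnj (e x) * q x) + of_real (\<alpha> x) * K x * (cnj (e x) * q x))"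
      by (intro ac_deriv_mult ac_deriv_K ac_deriv_cnj_e q) auto
    fix x
    have "cnj (e x) * coeff x = of_real (\<alpha> x) * e x * (e x * cnj (e x))" by (simp add: coeff_eq algebra_simps)
    then have ec: "cnj (e x) * coeff x = of_real (\<alpha> x) * e x" by (simp add: e_cnj)
    have "K x * (cnj (e x) * (- coeff x * p x) + - \<i> * of_real \<omega> * cnj (e x) * q x) + of_real (\<alpha> x) * K x * (cnj (e x) * q x)
       = K x * (- (cnj (e x) * coeff x) * p x + - \<i> * of_real \<omega> * cnj (e x) * q x) + of_real (\<alpha> x) * K x * (cnj (e x) * q x)"
      by (simp add: algebra_simps)
    also have "\<dots> = - \<i> * of_real \<omega> * l x - of_real (\<alpha> x) * (r x - l x)"
      unfolding ec r_def l_def by (simp add: algebra_simps)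
    finally show "K x * (cnj (e x) * (- coeff x * p x) + - \<i> * of_real \<omega> * cnj (e x) * q x) + of_real (\<alpha> x) * K x * (cnj (e x) * q x)
      = - \<i> * of_real \<omega> * l x - of_real (\<alpha> x) * (r x - l x)" .
  qed (simp add: l_def)
  define u where "u x = r x + l x" for x
  define u' where "u' x = \<i> * of_real \<omega> * (r x - l x)" for x
  have sub: "{a<..<b} \<subseteq> {a..b}" by auto
  have u: "ac_deriv {a<..<b} u u'"
    by (rule ac_deriv_cong[OF ac_deriv_add[OF ac_deriv_subset[OF r sub] ac_deriv_subset[OF l sub]]])
       (simp_all add: u_def u'_def algebra_simps)
  have zu': "ac_deriv {a<..<b} (\<lambda>x. of_real (\<zeta> x) * u' x) (\<lambda>x. - of_real (\<omega>\<^sup>2 * \<zeta> x) * u x)"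
  proof (rule ac_deriv_cong)
    show "ac_deriv {a<..<b} (\<lambda>x. of_real (\<zeta> x) * (\<i> * of_real \<omega> * (r x - l x)))
      (\<lambda>x. of_real (\<zeta> x) * (\<i> * of_real \<omega> * ((\<i> * of_real \<omega> * r x + of_real (\<alpha> x) * (r x - l x)) - (- \<i> * of_real \<omega> * l x - of_real (\<alpha> x) * (r x - l x))))
         + of_real (- 2 * \<alpha> x * \<zeta> x) * (\<i> * of_real \<omega> * (r x - l x)))"
      by (intro ac_deriv_mult ac_deriv_of_real ac_deriv_cmult ac_deriv_diff \<zeta> ac_deriv_subset[OF r sub] ac_deriv_subset[OF l sub]) auto
    fix x
    \<comment> \<open>The term 2 \<alpha> (r - l) in r' - l' cancels against the derivative -2
      \<alpha> \<zeta> of \<zeta>, leaving (\<i> \<omega>)^2 \<zeta> (r + l).\<close>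
    show "of_real (\<zeta> x) * (\<i> * of_real \<omega> * ((\<i> * of_real \<omega> * r x + of_real (\<alpha> x) * (r x - l x)) - (- \<i> * of_real \<omega> * l x - of_real (\<alpha> x) * (r x - l x))))
         + of_real (- 2 * \<alpha> x * \<zeta> x) * (\<i> * of_real \<omega> * (r x - l x)) = - of_real (\<omega>\<^sup>2 * \<zeta> x) * u x"
      unfolding u_def of_real_mult of_real_minus of_real_numeral of_real_power
      using i_squared by algebra
  qed (simp add: u'_def)
  have rp: "right_part \<omega> u u' = r" and lp: "left_part \<omega> u u' = l"
    using omega by (auto simp: right_part_def left_part_def u_def u'_def fun_eq_iff)
  have lim: "(r \<longlongrightarrow> r a) (at_right a)" "(l \<longlongrightarrow> l a) (at_right a)" "(r \<longlongrightarrow> r b) (at_left b)" "(l \<longlongrightarrow> l b) (at_left b)"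
    by (intro tendsto_at_right_start tendsto_at_left_end ac_deriv_imp_continuous_on[OF r] ac_deriv_imp_continuous_on[OF l])+
  have ra: "r a = 1" and la: "l a = z"
    by (simp_all add: r_def l_def K_start e_start p_def q_def S_start D_start)
  \<comment> \<open>Clearing the denominator of z gives q b = \<xi> Q p b, which is l b = \<xi> r b
    because Q is the square of e b.\<close>
  have "z * (S b + \<xi> * Q * cnj (D b)) = D b + \<xi> * Q * cnj (S b)"
    unfolding z_def reflected_def using denominator_nonzero[OF \<xi>] by simp
  then have "z * S b - D b = \<xi> * Q * (cnj (S b) - z * cnj (D b))" by (simp add: algebra_simps)
  moreover have "z * S b - D b = 2 * q b" "cnj (S b) - z * cnj (D b) = 2 * p b" by (simp_all add: q_def p_def)
  ultimately have "2 * q b = 2 * (\<xi> * Q * p b)" by simp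
  then have "q b = \<xi> * Q * p b" by (rule mult_left_cancel[THEN iffD1, rotated]) simp
  then have "l b = \<xi> * (K b * (e b * cnj (e b)) * (e b * p b))"
    unfolding l_def Q_e by (simp add: algebra_simps)
  then have lb: "l b = \<xi> * r b" by (simp add: e_cnj r_def)
  have "bvp_solution \<zeta> a b \<omega> \<xi> u u'"
    unfolding bvp_solution_def rp lp
  proof (intro conjI)
    show "\<exists>l' r'. (l \<longlongrightarrow> l') (at_left b) \<and> (r \<longlongrightarrow> r') (at_left b) \<and> l' = \<xi> * r'"
      using lim lb by blast
    show "AE x in lebesgue_on {a<..<b}. \<exists>d. ((\<lambda>x. complex_of_real (\<zeta> x) * u' x) has_vector_derivative d) (at x) \<and> d + complex_of_real (\<omega>\<^sup>2 * \<zeta> x) * u x = 0"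
    proof (rule AE_mp)
      show "AE x in lebesgue_on {a<..<b}. ((\<lambda>x. of_real (\<zeta> x) * u' x) has_vector_derivative - of_real (\<omega>\<^sup>2 * \<zeta> x) * u x) (at x)"
        using zu' by (simp add: ac_deriv_iff_AE)
    qed (intro AE_I2 impI exI conjI, assumption, simp)
  qed (use u zu' lim(1) ra in \<open>simp_all add: ac_deriv_iff_AE\<close>)
  moreover have "(left_part \<omega> u u' \<longlongrightarrow> reflected \<xi>) (at_right a)" using lim(2) la lp z_def by simp
  ultimately show ?thesis using that by blast
qed

text \<open>An arbitrary solution is written in terms of p and q, and its pairings F and G with the
  two basic solutions are constant. Comparing their limits at both ends determines z.\<close>

lemma bvp_solution_left_limit:
  assumes \<xi>: "cmod \<xi> < 1" and sol: "bvp_solution \<zeta> a b \<omega> \<xi> u u'"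
    and z: "(left_part \<omega> u u' \<longlongrightarrow> z) (at_right a)"
  shows "z = reflected \<xi>"
proof -
  define r where "r = right_part \<omega> u u'"
  define l where "l = left_part \<omega> u u'"
  let ?I = "{a<..<b}"
  have u: "ac_deriv ?I u u'" using sol by (simp add: bvp_solution_def ac_deriv_iff_AE)
  have "AE x in lebesgue_on ?I. ((\<lambda>x. of_real (\<zeta> x) * u' x) has_vector_derivative - of_real (\<omega>\<^sup>2 * \<zeta> x) * u x) (at x)"
  proof (rule AE_mp)
    show "AE x in lebesgue_on ?I. \<exists>d. ((\<lambda>x. complex_of_real (\<zeta> x) * u' x) has_vector_derivative d) (at x) \<and> d + complex_of_real (\<omega>\<^sup>2 * \<zeta> x) * u x = 0"
      using sol by (simp add: bvp_solution_def)
  qed (intro AE_I2 impI, clarify, simp add: add_eq_0_iff2)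
  then have v: "ac_deriv ?I (\<lambda>x. of_real (\<zeta> x) * u' x) (\<lambda>x. - of_real (\<omega>\<^sup>2 * \<zeta> x) * u x)"
    using sol by (simp add: bvp_solution_def ac_deriv_iff_AE)
  have z0: "\<zeta> x \<noteq> 0" if "x \<in> ?I" for x using eps(1) eps(2)[OF that] by simp
  have iz: "ac_deriv ?I (\<lambda>x. complex_of_real (1 / \<zeta> x)) (\<lambda>x. of_real (- (- 2 * \<alpha> x * \<zeta> x) / (\<zeta> x)\<^sup>2))"
    by (intro ac_deriv_of_real ac_deriv_inverse[OF \<zeta> eps])
  have u'0: "ac_deriv ?I (\<lambda>x. of_real (\<zeta> x) * u' x * of_real (1 / \<zeta> x))
     (\<lambda>x. of_real (\<zeta> x) * u' x * of_real (- (- 2 * \<alpha> x * \<zeta> x) / (\<zeta> x)\<^sup>2) + - of_real (\<omega>\<^sup>2 * \<zeta> x) * u x * of_real (1 / \<zeta> x))"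
    by (intro ac_deriv_mult v iz) auto
  \<comment> \<open>Absolute continuity is given for \<zeta> u' only; it passes to u' because 1 /
    \<zeta> is absolutely continuous as well.\<close>
  have u': "ac_deriv ?I u' (\<lambda>x. 2 * of_real (\<alpha> x) * u' x - of_real (\<omega>\<^sup>2) * u x)"
  proof -
    obtain N where N: "negligible N" "\<And>x. x \<in> ?I - N \<Longrightarrow> ((\<lambda>x. of_real (\<zeta> x) * u' x * of_real (1 / \<zeta> x)) has_vector_derivative
       of_real (\<zeta> x) * u' x * of_real (- (- 2 * \<alpha> x * \<zeta> x) / (\<zeta> x)\<^sup>2) + - of_real (\<omega>\<^sup>2 * \<zeta> x) * u x * of_real (1 / \<zeta> x)) (at x)"
      using u'0 unfolding ac_deriv_def by blast
    have eq: "of_real (\<zeta> x) * u' x * of_real (1 / \<zeta> x) = u' x" if "x \<in> ?I" for x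
      using z0[OF that] by simp
    have eq': "of_real (\<zeta> x) * u' x * of_real (- (- 2 * \<alpha> x * \<zeta> x) / (\<zeta> x)\<^sup>2) + - of_real (\<omega>\<^sup>2 * \<zeta> x) * u x * of_real (1 / \<zeta> x)
       = 2 * of_real (\<alpha> x) * u' x - of_real (\<omega>\<^sup>2) * u x" if "x \<in> ?I" for x
      using z0[OF that] by (simp add: field_simps power2_eq_square)
    have "absolutely_continuous_on ?I u'"
      by (rule absolutely_continuous_on_lipschitz_compose[OF ac_deriv_imp_ac[OF u'0], of _ 1]) (simp only: eq mult_1 order_refl)
    moreover have "(u' has_vector_derivative 2 * of_real (\<alpha> x) * u' x - of_real (\<omega>\<^sup>2) * u x) (at x)" if x: "x \<in> ?I - N" for x
    proof (rule has_vector_derivative_transform_within_open)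
      show "((\<lambda>x. of_real (\<zeta> x) * u' x * of_real (1 / \<zeta> x)) has_vector_derivative 2 * of_real (\<alpha> x) * u' x - of_real (\<omega>\<^sup>2) * u x) (at x)"
        using N(2)[OF x] eq'[of x] x by simp
      show "open ?I" "x \<in> ?I" using x by auto
    qed (rule eq)
    ultimately show ?thesis unfolding ac_deriv_def using N(1) by blast
  qed
  have i\<omega>: "complex_of_real \<omega> \<noteq> 0" using omega by simp
  have r: "ac_deriv ?I r (\<lambda>x. \<i> * of_real \<omega> * r x + of_real (\<alpha> x) * (r x - l x))"
  proof (rule ac_deriv_cong)
    show "ac_deriv ?I (\<lambda>x. 1/2 * (u x + 1 / (\<i> * of_real \<omega>) * u' x))
       (\<lambda>x. 1/2 * (u' x + 1 / (\<i> * of_real \<omega>) * (2 * of_real (\<alpha> x) * u' x - of_real (\<omega>\<^sup>2) * u x)))"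
      by (intro ac_deriv_cmult ac_deriv_add u u')
  qed (use i\<omega> in \<open>auto simp: r_def l_def right_part_def left_part_def field_simps power2_eq_square\<close>)
  have l: "ac_deriv ?I l (\<lambda>x. - \<i> * of_real \<omega> * l x - of_real (\<alpha> x) * (r x - l x))"
  proof (rule ac_deriv_cong)
    show "ac_deriv ?I (\<lambda>x. 1/2 * (u x - 1 / (\<i> * of_real \<omega>) * u' x))
       (\<lambda>x. 1/2 * (u' x - 1 / (\<i> * of_real \<omega>) * (2 * of_real (\<alpha> x) * u' x - of_real (\<omega>\<^sup>2) * u x)))"
      by (intro ac_deriv_cmult ac_deriv_diff u u')
  qed (use i\<omega> in \<open>auto simp: r_def l_def right_part_def left_part_def field_simps power2_eq_square\<close>)
  have sub: "?I \<subseteq> {a..b}" by auto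
  define p where "p x = 1 / K x * (cnj (e x) * r x)" for x
  define q where "q x = 1 / K x * (e x * l x)" for x
  have p: "ac_deriv ?I p (\<lambda>x. - cnj (coeff x) * q x)"
  proof (rule ac_deriv_cong)
    show "ac_deriv ?I (\<lambda>x. 1 / K x * (cnj (e x) * r x))
      (\<lambda>x. 1 / K x * (cnj (e x) * (\<i> * of_real \<omega> * r x + of_real (\<alpha> x) * (r x - l x)) + - \<i> * of_real \<omega> * cnj (e x) * r x)
        + - of_real (\<alpha> x) * (1 / K x) * (cnj (e x) * r x))"
      by (intro ac_deriv_mult ac_deriv_subset[OF ac_deriv_inverse_K sub] ac_deriv_subset[OF ac_deriv_cnj_e sub] r) auto
    fix x
    have "cnj (coeff x) * e x = of_real (\<alpha> x) * cnj (e x) * (e x * cnj (e x))" by (simp add: coeff_eq algebra_simps)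
    then have ec: "cnj (coeff x) * e x = of_real (\<alpha> x) * cnj (e x)" by (simp add: e_cnj)
    have "- cnj (coeff x) * q x = - (1 / K x * ((cnj (coeff x) * e x) * l x))" by (simp add: q_def)
    also have "\<dots> = 1 / K x * (cnj (e x) * (\<i> * of_real \<omega> * r x + of_real (\<alpha> x) * (r x - l x)) + - \<i> * of_real \<omega> * cnj (e x) * r x)
        + - of_real (\<alpha> x) * (1 / K x) * (cnj (e x) * r x)" unfolding ec by (simp add: algebra_simps)
    finally show "1 / K x * (cnj (e x) * (\<i> * of_real \<omega> * r x + of_real (\<alpha> x) * (r x - l x)) + - \<i> * of_real \<omega> * cnj (e x) * r x)
        + - of_real (\<alpha> x) * (1 / K x) * (cnj (e x) * r x) = - cnj (coeff x) * q x" ..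
  qed (simp add: p_def)
  have q: "ac_deriv ?I q (\<lambda>x. - coeff x * p x)"
  proof (rule ac_deriv_cong)
    show "ac_deriv ?I (\<lambda>x. 1 / K x * (e x * l x))
      (\<lambda>x. 1 / K x * (e x * (- \<i> * of_real \<omega> * l x - of_real (\<alpha> x) * (r x - l x)) + \<i> * of_real \<omega> * e x * l x)
        + - of_real (\<alpha> x) * (1 / K x) * (e x * l x))"
      by (intro ac_deriv_mult ac_deriv_subset[OF ac_deriv_inverse_K sub] ac_deriv_subset[OF ac_deriv_e sub] l) auto
    fix x
    have "coeff x * cnj (e x) = of_real (\<alpha> x) * e x * (e x * cnj (e x))" by (simp add: coeff_eq algebra_simps)
    then have ec: "coeff x * cnj (e x) = of_real (\<alpha> x) * e x" by (simp add: e_cnj)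
    have "- coeff x * p x = - (1 / K x * ((coeff x * cnj (e x)) * r x))" by (simp add: p_def)
    also have "\<dots> = 1 / K x * (e x * (- \<i> * of_real \<omega> * l x - of_real (\<alpha> x) * (r x - l x)) + \<i> * of_real \<omega> * e x * l x)
        + - of_real (\<alpha> x) * (1 / K x) * (e x * l x)" unfolding ec by (simp add: algebra_simps)
    finally show "1 / K x * (e x * (- \<i> * of_real \<omega> * l x - of_real (\<alpha> x) * (r x - l x)) + \<i> * of_real \<omega> * e x * l x)
        + - of_real (\<alpha> x) * (1 / K x) * (e x * l x) = - coeff x * p x" ..
  qed (simp add: q_def)
  define F where "F x = S x * p x + cnj (D x) * q x" for x
  define G where "G x = D x * p x + cnj (S x) * q x" for x
  have F: "ac_deriv ?I F (\<lambda>x. 0)"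
  proof (rule ac_deriv_cong)
    show "ac_deriv ?I (\<lambda>x. S x * p x + cnj (D x) * q x)
       (\<lambda>x. (S x * (- cnj (coeff x) * q x) + coeff x * cnj (D x) * p x) + (cnj (D x) * (- coeff x * p x) + cnj (coeff x * cnj (S x)) * q x))"
      by (intro ac_deriv_add ac_deriv_mult ac_deriv_cnj p q ac_deriv_subset[OF ac_deriv_S sub] ac_deriv_subset[OF ac_deriv_D sub]) auto
  qed (auto simp: F_def algebra_simps)
  have G: "ac_deriv ?I G (\<lambda>x. 0)"
  proof (rule ac_deriv_cong)
    show "ac_deriv ?I (\<lambda>x. D x * p x + cnj (S x) * q x)
       (\<lambda>x. (D x * (- cnj (coeff x) * q x) + coeff x * cnj (S x) * p x) + (cnj (S x) * (- coeff x * p x) + cnj (coeff x * cnj (D x)) * q x))"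
      by (intro ac_deriv_add ac_deriv_mult ac_deriv_cnj p q ac_deriv_subset[OF ac_deriv_S sub] ac_deriv_subset[OF ac_deriv_D sub]) auto
  qed (auto simp: G_def algebra_simps)
  obtain lb rb where lim: "(r \<longlongrightarrow> 1) (at_right a)" "(l \<longlongrightarrow> z) (at_right a)" "(r \<longlongrightarrow> rb) (at_left b)" "(l \<longlongrightarrow> lb) (at_left b)" "lb = \<xi> * rb"
    using sol z unfolding bvp_solution_def r_def l_def by blast
  note cont = ac_deriv_S[THEN ac_deriv_imp_continuous_on] ac_deriv_D[THEN ac_deriv_imp_continuous_on]
    ac_deriv_e[THEN ac_deriv_imp_continuous_on] ac_deriv_K[THEN ac_deriv_imp_continuous_on]
  note atr = cont[THEN tendsto_at_right_start] and atl = cont[THEN tendsto_at_left_end]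
  have Fa: "(F \<longlongrightarrow> S a * (1 / K a * (cnj (e a) * 1)) + cnj (D a) * (1 / K a * (e a * z))) (at_right a)"
    unfolding F_def p_def q_def by (intro tendsto_intros atr lim K_nonzero)
  have Ga: "(G \<longlongrightarrow> D a * (1 / K a * (cnj (e a) * 1)) + cnj (S a) * (1 / K a * (e a * z))) (at_right a)"
    unfolding G_def p_def q_def by (intro tendsto_intros atr lim K_nonzero)
  have Fb: "(F \<longlongrightarrow> S b * (1 / K b * (cnj (e b) * rb)) + cnj (D b) * (1 / K b * (e b * lb))) (at_left b)"
    unfolding F_def p_def q_def by (intro tendsto_intros atl lim K_nonzero)
  have Gb: "(G \<longlongrightarrow> D b * (1 / K b * (cnj (e b) * rb)) + cnj (S b) * (1 / K b * (e b * lb))) (at_left b)"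
    unfolding G_def p_def q_def by (intro tendsto_intros atl lim K_nonzero)
  define m where "m = (a + b) / 2"
  have m: "m \<in> ?I" using a_less_b by (auto simp: m_def)
  have evr: "eventually (\<lambda>x. x \<in> ?I) (at_right a)" and evl: "eventually (\<lambda>x. x \<in> ?I) (at_left b)"
    using a_less_b by (auto intro: eventually_at_rightI eventually_at_leftI)
  have const: "F x = F m" "G x = G m" if "x \<in> ?I" for x
    using ac_deriv_zero_imp_const[OF F _ that m] ac_deriv_zero_imp_const[OF G _ that m] by (auto simp: is_interval_1)
  have "(F \<longlongrightarrow> F m) (at_right a)" "(G \<longlongrightarrow> G m) (at_right a)"
    by (rule tendsto_eventually, rule eventually_mono[OF evr], rule const, assumption)+
  then have "F m = S a * (1 / K a * (cnj (e a) * 1)) + cnj (D a) * (1 / K a * (e a * z))"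
    "G m = D a * (1 / K a * (cnj (e a) * 1)) + cnj (S a) * (1 / K a * (e a * z))"
    using tendsto_unique[OF _ _ Fa] tendsto_unique[OF _ _ Ga] by auto
  then have 1: "F m = 2" "G m = 2 * z"
    by (simp_all add: S_start D_start K_start e_start)
  have "(F \<longlongrightarrow> F m) (at_left b)" "(G \<longlongrightarrow> G m) (at_left b)"
    by (rule tendsto_eventually, rule eventually_mono[OF evl], rule const, assumption)+
  then have 2: "F m = S b * (1 / K b * (cnj (e b) * rb)) + cnj (D b) * (1 / K b * (e b * lb))"
    "G m = D b * (1 / K b * (cnj (e b) * rb)) + cnj (S b) * (1 / K b * (e b * lb))"
    using tendsto_unique[OF _ _ Fb] tendsto_unique[OF _ _ Gb] by auto
  define P where "P = 1 / K b * (cnj (e b) * rb)"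
  have "\<xi> * Q * P = 1 / K b * (\<xi> * (e b * rb) * (e b * cnj (e b)))" unfolding P_def Q_e by (simp add: algebra_simps)
  then have QP: "1 / K b * (e b * lb) = \<xi> * Q * P" unfolding lim(5) e_cnj by (simp add: algebra_simps)
  have 3: "2 = (S b + \<xi> * Q * cnj (D b)) * P" "2 * z = (D b + \<xi> * Q * cnj (S b)) * P"
    using 1 2 unfolding QP P_def[symmetric] by (simp_all add: algebra_simps)
  \<comment> \<open>The unknown boundary value enters through P alone, and P is eliminated between
    the two equations.\<close>
  have "2 * (z * (S b + \<xi> * Q * cnj (D b))) = 2 * (D b + \<xi> * Q * cnj (S b))"
    using 3 by algebra
  then have "z * (S b + \<xi> * Q * cnj (D b)) = D b + \<xi> * Q * cnj (S b)"
    by (rule mult_left_cancel[THEN iffD1, rotated]) simp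
  then show ?thesis unfolding reflected_def using denominator_nonzero[OF \<xi>] by (simp add: eq_divide_eq)
qed

lemma reflection_coeff_eq:
  assumes \<xi>: "cmod \<xi> < 1"
  shows "reflection_coeff \<zeta> a b \<omega> \<xi> = reflected \<xi>"
  unfolding reflection_coeff_def
proof (rule the_equality)
  show "\<exists>u u'. bvp_solution \<zeta> a b \<omega> \<xi> u u' \<and> (left_part \<omega> u u' \<longlongrightarrow> reflected \<xi>) (at_right a)"
    using bvp_solution_exists[OF \<xi>] by blast
qed (use bvp_solution_left_limit[OF \<xi>] in blast)

end

section \<open>Smoothness in the frequency\<close>

text \<open>The real derivatives are restrictions of the complex ones. U is any open set around the
  real line, since the quotient to come may have poles off it.\<close>

lemma smooth_of_holomorphic:
  assumes H: "H holomorphic_on U" "open U" "\<And>x. complex_of_real x \<in> U"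
  shows "smooth (\<lambda>x. H (of_real x))"
  unfolding smooth_def
proof (intro exI[of _ "\<lambda>n x. (deriv ^^ n) H (of_real x)"] conjI allI)
  fix n x
  have "((deriv ^^ n) H has_field_derivative (deriv ^^ Suc n) H (of_real x)) (at (of_real x))"
    using holomorphic_derivI[OF holomorphic_higher_deriv[OF H(1,2)] H(2,3)] by simp
  moreover have "((\<lambda>x. complex_of_real x) has_vector_derivative 1) (at x)"
    using has_vector_derivative_of_real[OF DERIV_ident] by simp
  ultimately show "((\<lambda>x. (deriv ^^ n) H (of_real x)) has_vector_derivative (deriv ^^ Suc n) H (of_real x)) (at x)"
    using field_vector_diff_chain_at[of "\<lambda>x. complex_of_real x" 1 x "(deriv ^^ n) H"] by (simp add: o_def)
qed simp

text \<open>Cauchy's estimate dominates the difference quotients of the integrand.\<close>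

lemma holomorphic_parametric_integral:
  fixes f :: "real \<Rightarrow> complex \<Rightarrow> complex"
  assumes hol: "\<And>s. s \<in> I \<Longrightarrow> f s holomorphic_on UNIV"
    and int: "\<And>z. (\<lambda>s. f s z) integrable_on I"
    and bound: "\<And>R. \<exists>G. G integrable_on I \<and> (\<forall>s\<in>I. \<forall>z. norm z \<le> R \<longrightarrow> norm (f s z) \<le> G s)"
  shows "(\<lambda>z. integral I (\<lambda>s. f s z)) holomorphic_on UNIV"
proof -
  have "((\<lambda>z. integral I (\<lambda>s. f s z)) has_field_derivative integral I (\<lambda>s. deriv (f s) z0)) (at z0)" for z0
    unfolding has_field_derivative_iff tendsto_at_iff_sequentially
  proof (intro allI impI)
    fix X :: "nat \<Rightarrow> complex" assume X: "\<forall>i. X i \<in> UNIV - {z0}" "X \<longlonglongrightarrow> z0"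
    then obtain R0 where R0: "\<And>i. norm (X i) \<le> R0"
      using convergent_imp_Bseq[of X] unfolding convergent_def Bseq_def by blast
    define R where "R = max R0 (norm z0)"
    have R: "norm (X i) \<le> R" "norm z0 \<le> R" for i unfolding R_def using R0[of i] by auto
    \<comment> \<open>Cauchy's estimate uses unit circles around points of the disc of radius R,
      hence the domination on radius R + 1.\<close>
    obtain G where G: "G integrable_on I" "\<And>s z. s \<in> I \<Longrightarrow> norm z \<le> R + 1 \<Longrightarrow> norm (f s z) \<le> G s"
      using bound[of "R + 1"] by blast
    have deriv_le: "norm (deriv (f s) w) \<le> G s" if "s \<in> I" "norm w \<le> R" for s w
    proof -
      have "norm ((deriv ^^ 1) (f s) w) \<le> fact 1 * G s / 1 ^ 1"
      proof (rule Cauchy_inequality)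
        show "f s holomorphic_on ball w 1" using hol[OF that(1)] by (rule holomorphic_on_subset) simp
        show "continuous_on (cball w 1) (f s)"
          using holomorphic_on_imp_continuous_on[OF hol[OF that(1)]] by (rule continuous_on_subset) simp
        fix x assume "cmod (w - x) = 1"
        then have "norm x \<le> R + 1" using that(2) norm_triangle_ineq2[of x w] by (simp add: norm_minus_commute)
        then show "norm (f s x) \<le> G s" by (rule G(2)[OF that(1)])
      qed simp
      then show ?thesis by simp
    qed
    have fd: "(f s has_field_derivative deriv (f s) w) (at w)" if "s \<in> I" for s w
      by (rule holomorphic_derivI[OF hol[OF that]]) auto
    have lip: "norm ((f s (X i) - f s z0) / (X i - z0)) \<le> G s" if "s \<in> I" for s i
    proof -
      have "norm (f s (X i) - f s z0) \<le> G s * norm (X i - z0)"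
        by (rule field_differentiable_bound[of "cball 0 R" "f s" "deriv (f s)"])
           (use that R deriv_le fd in \<open>auto intro: has_field_derivative_at_within\<close>)
      moreover have "norm (X i - z0) > 0" using X(1) by simp
      ultimately show ?thesis by (simp add: norm_divide divide_le_eq)
    qed
    have lim: "(\<lambda>i. integral I (\<lambda>s. (f s (X i) - f s z0) / (X i - z0))) \<longlonglongrightarrow> integral I (\<lambda>s. deriv (f s) z0)"
    proof (rule dominated_convergence(2)[OF _ G(1)])
      show "(\<lambda>s. (f s (X i) - f s z0) / (X i - z0)) integrable_on I" for i
        by (intro integrable_on_divide integrable_diff int)
      show "(\<lambda>i. (f s (X i) - f s z0) / (X i - z0)) \<longlonglongrightarrow> deriv (f s) z0" if "s \<in> I" for s
        using fd[OF that, of z0] X unfolding has_field_derivative_iff tendsto_at_iff_sequentially o_def by blast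
    qed (rule lip)
    have eq: "integral I (\<lambda>s. (f s (X i) - f s z0) / (X i - z0)) = (integral I (\<lambda>s. f s (X i)) - integral I (\<lambda>s. f s z0)) / (X i - z0)" for i
      by (simp add: Henstock_Kurzweil_Integration.integral_diff int)
    show "((\<lambda>z. (integral I (\<lambda>s. f s z) - integral I (\<lambda>s. f s z0)) / (z - z0)) \<circ> X) \<longlonglongrightarrow> integral I (\<lambda>s. deriv (f s) z0)"
      unfolding o_def by (rule lim[unfolded eq])
  qed
  then show ?thesis by (auto simp: holomorphic_on_open)
qed

text \<open>The iterates with a complex frequency: the conjugation in the real iterates becomes
  the reflection \<open>z \<mapsto> - z\<close>.\<close>

primrec hol_iter :: "real \<Rightarrow> (real \<Rightarrow> real) \<Rightarrow> nat \<Rightarrow> real \<Rightarrow> complex \<Rightarrow> complex" where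
  "hol_iter a \<alpha> 0 x z = 1"
| "hol_iter a \<alpha> (Suc j) x z = integral {a..x} (\<lambda>s. of_real (\<alpha> s) * exp (2 * \<i> * z * of_real (s - a)) * hol_iter a \<alpha> j s (- z))"

text \<open>\<alpha> is real, so conjugation merely reverses the phase. This trades cnj, which is
  not holomorphic, for a change of sign of the frequency.\<close>

lemma cnj_hexp_iter: "cnj (hexp_iter a (modulated \<alpha> a \<omega>) j x) = hexp_iter a (modulated \<alpha> a (- \<omega>)) j x"
proof (induction j arbitrary: x)
  case (Suc j)
  have "cnj (hexp_iter a (modulated \<alpha> a \<omega>) (Suc j) x) =
     integral {a..x} (\<lambda>s. cnj (modulated \<alpha> a \<omega> s * cnj (hexp_iter a (modulated \<alpha> a \<omega>) j s)))"
    by (simp only: hexp_iter.simps integral_cnj)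
  also have "\<dots> = integral {a..x} (\<lambda>s. modulated \<alpha> a (- \<omega>) s * cnj (hexp_iter a (modulated \<alpha> a (- \<omega>)) j s))"
    unfolding complex_cnj_mult Suc by (simp add: exp_cnj flip: Suc)
  finally show ?case by simp
qed simp

lemma hol_iter_of_real: "hol_iter a \<alpha> j x (of_real \<omega>) = hexp_iter a (modulated \<alpha> a \<omega>) j x"
proof (induction j arbitrary: x \<omega>)
  case (Suc j)
  have "hol_iter a \<alpha> j s (- of_real \<omega>) = cnj (hexp_iter a (modulated \<alpha> a \<omega>) j s)" for s
    using Suc[of s "- \<omega>"] unfolding cnj_hexp_iter by simp
  then show ?case by (simp add: mult.assoc)
qed simp

text \<open>One induction for all three facts: holomorphy of the next iterate uses continuity in x
  for integrability and the bound for domination. The constant exp (2 R (b - a)) bounds the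
  exponential factor for |z| \<le> R.\<close>

lemma hol_iter_properties:
  fixes \<alpha> :: "real \<Rightarrow> real"
  assumes \<alpha>: "\<alpha> absolutely_integrable_on {a..b}"
  shows hol_iter_continuous: "continuous_on {a..b} (\<lambda>x. hol_iter a \<alpha> j x z)"
    and hol_iter_bound: "x \<in> {a..b} \<Longrightarrow> norm z \<le> R \<Longrightarrow>
      norm (hol_iter a \<alpha> j x z) \<le> (integral {a..x} (\<lambda>s. exp (2 * R * (b - a)) * \<bar>\<alpha> s\<bar>)) ^ j / fact j"
    and hol_iter_holomorphic: "x \<in> {a..b} \<Longrightarrow> hol_iter a \<alpha> j x holomorphic_on UNIV"
proof (induction j arbitrary: x z R)
  case 0
  { case 1 show ?case by simp }
  { case 2 show ?case by simp }
  { case 3 show ?case by (simp add: fun_eq_iff cong: holomorphic_cong) }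
next
  case (Suc j)
  have ca: "(\<lambda>s. complex_of_real (\<alpha> s)) absolutely_integrable_on {a..b}"
    using absolutely_integrable_linear[OF \<alpha> bounded_linear_of_real] by (simp add: o_def)
  let ?f = "\<lambda>s z. of_real (\<alpha> s) * exp (2 * \<i> * z * of_real (s - a)) * hol_iter a \<alpha> j s (- z)"
  have ai: "(\<lambda>s. ?f s z) absolutely_integrable_on {a..b}" for z
  proof -
    have "continuous_on {a..b} (\<lambda>s. exp (2 * \<i> * z * of_real (s - a)) * hol_iter a \<alpha> j s (- z))"
      by (intro continuous_intros Suc(1))
    from absolutely_integrable_mult_continuous[OF ca this] show ?thesis by (simp add: mult.assoc)
  qed
  have int: "(\<lambda>s. ?f s z) integrable_on {a..x}" if "x \<in> {a..b}" for x z
    using absolutely_integrable_on_subinterval[OF ai, of a x z] that by (auto simp: absolutely_integrable_on_def)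
  have \<beta>: "(\<lambda>s. exp (2 * R * (b - a)) * \<bar>\<alpha> s\<bar>) absolutely_integrable_on {a..b}" for R
    by (intro set_integrable_mult_right set_integrable_abs \<alpha>)
  have le: "norm (?f s z) \<le> exp (2 * R * (b - a)) * \<bar>\<alpha> s\<bar> * (integral {a..s} (\<lambda>s. exp (2 * R * (b - a)) * \<bar>\<alpha> s\<bar>) ^ j / fact j)"
    if "s \<in> {a..b}" "norm z \<le> R" for s z R
  proof -
    have "\<bar>Im z\<bar> \<le> R" using abs_Im_le_cmod[of z] that by linarith
    then have "- 2 * Im z * (s - a) \<le> 2 * R * (s - a)"
      using that by (intro mult_right_mono) auto
    also have "\<dots> \<le> 2 * R * (b - a)"
      using that \<open>\<bar>Im z\<bar> \<le> R\<close> by (intro mult_left_mono) auto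
    finally have "- 2 * Im z * (s - a) \<le> 2 * R * (b - a)" .
    then have e: "norm (exp (2 * \<i> * z * of_real (s - a))) \<le> exp (2 * R * (b - a))"
      by (simp add: norm_exp_eq_Re)
    have h: "norm (hol_iter a \<alpha> j s (- z)) \<le> integral {a..s} (\<lambda>s. exp (2 * R * (b - a)) * \<bar>\<alpha> s\<bar>) ^ j / fact j"
      using that by (intro Suc(2)) auto
    have "norm (?f s z) = norm (exp (2 * \<i> * z * of_real (s - a))) * \<bar>\<alpha> s\<bar> * norm (hol_iter a \<alpha> j s (- z))"
      by (simp add: norm_mult)
    also have "\<dots> \<le> exp (2 * R * (b - a)) * \<bar>\<alpha> s\<bar> * (integral {a..s} (\<lambda>s. exp (2 * R * (b - a)) * \<bar>\<alpha> s\<bar>) ^ j / fact j)"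
      using e h by (intro mult_mono) auto
    finally show ?thesis .
  qed
  note pow = has_integral_iterated_power[OF \<beta>]
  { case 1
    have "continuous_on {a..b} (\<lambda>x. integral {a..x} (\<lambda>s. ?f s z))"
      by (rule ac_deriv_imp_continuous_on[OF ac_deriv_indefinite_integral[OF ai]])
    then show ?case by simp }
  { case 2
    have "norm (integral {a..x} (\<lambda>s. ?f s z)) \<le> integral {a..x} (\<lambda>s. exp (2 * R * (b - a)) * \<bar>\<alpha> s\<bar> * (integral {a..s} (\<lambda>s. exp (2 * R * (b - a)) * \<bar>\<alpha> s\<bar>) ^ j / fact j))"
      using 2 by (intro integral_norm_bound_integral int has_integral_integrable[OF pow[OF 2(1)]] le) auto
    also have "\<dots> = integral {a..x} (\<lambda>s. exp (2 * R * (b - a)) * \<bar>\<alpha> s\<bar>) ^ Suc j / fact (Suc j)"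
      by (rule integral_unique[OF pow[OF 2(1)]])
    finally show ?case by simp }
  { case 3
    have "(\<lambda>z. integral {a..x} (\<lambda>s. ?f s z)) holomorphic_on UNIV"
    proof (rule holomorphic_parametric_integral)
      fix s assume "s \<in> {a..x}"
      then have "hol_iter a \<alpha> j s holomorphic_on UNIV" using 3 by (intro Suc(3)) auto
      then have "(hol_iter a \<alpha> j s \<circ> uminus) holomorphic_on UNIV"
        by (intro holomorphic_on_compose holomorphic_intros) (auto elim: holomorphic_on_subset)
      then have "(\<lambda>z. hol_iter a \<alpha> j s (- z)) holomorphic_on UNIV" by (simp add: o_def)
      then show "?f s holomorphic_on UNIV" by (intro holomorphic_intros)
    next
      fix R
      show "\<exists>G. G integrable_on {a..x} \<and> (\<forall>s\<in>{a..x}. \<forall>z. norm z \<le> R \<longrightarrow> norm (?f s z) \<le> G s)"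
        using has_integral_integrable[OF pow[OF 3, of R j]] le 3
        by (intro exI[of _ "\<lambda>s. exp (2 * R * (b - a)) * \<bar>\<alpha> s\<bar> * (integral {a..s} (\<lambda>s. exp (2 * R * (b - a)) * \<bar>\<alpha> s\<bar>) ^ j / fact j)"]) auto
    qed (rule int[OF 3])
    then show ?case by (simp cong: holomorphic_cong) }
qed

lemma hexp_series_entire_extension:
  fixes \<alpha> :: "real \<Rightarrow> real"
  assumes \<alpha>: "\<alpha> absolutely_integrable_on {a..b}" and x: "x \<in> {a..b}"
  obtains E where "E holomorphic_on UNIV" "\<And>\<omega>. E (of_real \<omega>) = hexp_series a (modulated \<alpha> a \<omega>) x"
proof -
  define E where "E z = (\<Sum>j. hol_iter a \<alpha> j x z)" for z
  have "E holomorphic_on UNIV"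
  proof (rule holomorphic_uniform_sequence)
    show "(\<lambda>z. \<Sum>j<n. hol_iter a \<alpha> j x z) holomorphic_on UNIV" for n
      by (intro holomorphic_intros hol_iter_holomorphic[OF \<alpha> x])
    fix z0 :: complex
    let ?B = "integral {a..x} (\<lambda>s. exp (2 * (norm z0 + 1) * (b - a)) * \<bar>\<alpha> s\<bar>)"
    have "uniform_limit (cball z0 1) (\<lambda>n z. \<Sum>j<n. hol_iter a \<alpha> j x z) E sequentially"
      unfolding E_def
    proof (rule Weierstrass_m_test)
      show "summable (\<lambda>j. ?B ^ j / fact j)"
        using summable_exp[of ?B] by (simp add: field_simps)
      fix j z assume "z \<in> cball z0 1"
      then have "norm z \<le> norm z0 + 1"
        using norm_triangle_ineq2[of z z0] by (simp add: dist_norm norm_minus_commute)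
      then show "norm (hol_iter a \<alpha> j x z) \<le> ?B ^ j / fact j" by (rule hol_iter_bound[OF \<alpha> x])
    qed
    then show "\<exists>d>0. cball z0 d \<subseteq> UNIV \<and> uniform_limit (cball z0 d) (\<lambda>n z. \<Sum>j<n. hol_iter a \<alpha> j x z) E sequentially"
      by (intro exI[of _ 1]) auto
  qed simp
  moreover have "E (of_real \<omega>) = hexp_series a (modulated \<alpha> a \<omega>) x" for \<omega>
    unfolding E_def hexp_series_def hol_iter_of_real ..
  ultimately show ?thesis using that by blast
qed

lemma cnj_hexp_series:
  fixes \<alpha> :: "real \<Rightarrow> real"
  assumes \<alpha>: "\<alpha> absolutely_integrable_on {a..b}" and x: "x \<in> {a..b}"
  shows "cnj (hexp_series a (modulated \<alpha> a \<omega>) x) = hexp_series a (modulated \<alpha> a (- \<omega>)) x"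
proof -
  interpret hexp_coeff a b "modulated \<alpha> a \<omega>" "\<lambda>s. \<bar>\<alpha> s\<bar>"
    using \<alpha> x by (intro hexp_coeff_modulated) auto
  have "(\<lambda>j. hexp_iter a (modulated \<alpha> a \<omega>) j x) sums hexp_series a (modulated \<alpha> a \<omega>) x"
    unfolding hexp_series_def by (rule summable_sums[OF summable_norm_cancel[OF summable_iter[OF x]]])
  then have "(\<lambda>j. cnj (hexp_iter a (modulated \<alpha> a \<omega>) j x)) sums cnj (hexp_series a (modulated \<alpha> a \<omega>) x)"
    by (rule bounded_linear.sums[OF bounded_linear_cnj])
  then show ?thesis unfolding cnj_hexp_iter hexp_series_def[of _ "modulated \<alpha> a (- \<omega>)"] by (rule sums_unique)
qed

text \<open>The conjugates of S and D are values of entire functions at -\<omega>, so numerator and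
  denominator are restrictions of entire functions. The denominator has no real zeros because |D| <
  |S|; the quotient is holomorphic on the open set where it does not vanish.\<close>

lemma smooth_reflected:
  fixes \<alpha> :: "real \<Rightarrow> real"
  assumes \<alpha>: "\<alpha> absolutely_integrable_on {a..b}" and ab: "a \<le> b" and \<xi>: "cmod \<xi> < 1"
  defines "S \<equiv> \<lambda>\<omega>. hexp_series a (modulated \<alpha> a \<omega>) b + hexp_series a (\<lambda>s. - modulated \<alpha> a \<omega> s) b"
    and "D \<equiv> \<lambda>\<omega>. hexp_series a (modulated \<alpha> a \<omega>) b - hexp_series a (\<lambda>s. - modulated \<alpha> a \<omega> s) b"
    and "Q \<equiv> \<lambda>\<omega>. exp (2 * \<i> * complex_of_real ((b - a) * \<omega>))"
  shows "smooth (\<lambda>\<omega>. (D \<omega> + \<xi> * Q \<omega> * cnj (S \<omega>)) / (S \<omega> + \<xi> * Q \<omega> * cnj (D \<omega>)))"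
proof -
  have b: "b \<in> {a..b}" using ab by simp
  have \<alpha>m: "(\<lambda>s. - \<alpha> s) absolutely_integrable_on {a..b}"
    using absolutely_integrable_scaleR_left[OF \<alpha>, of "-1"] by simp
  obtain E where E: "E holomorphic_on UNIV" "\<And>\<omega>. E (of_real \<omega>) = hexp_series a (modulated \<alpha> a \<omega>) b"
    using hexp_series_entire_extension[OF \<alpha> b] by blast
  obtain F where F: "F holomorphic_on UNIV" "\<And>\<omega>. F (of_real \<omega>) = hexp_series a (modulated (\<lambda>s. - \<alpha> s) a \<omega>) b"
    using hexp_series_entire_extension[OF \<alpha>m b] by blast
  have mm: "modulated (\<lambda>s. - \<alpha> s) a \<omega> = (\<lambda>s. - modulated \<alpha> a \<omega> s)" for \<omega> by simp
  have S: "S \<omega> = E (of_real \<omega>) + F (of_real \<omega>)" and D: "D \<omega> = E (of_real \<omega>) - F (of_real \<omega>)" for \<omega>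
    unfolding S_def D_def E F mm by auto
  have cS: "cnj (S \<omega>) = E (- of_real \<omega>) + F (- of_real \<omega>)" and cD: "cnj (D \<omega>) = E (- of_real \<omega>) - F (- of_real \<omega>)" for \<omega>
    unfolding S_def D_def mm[symmetric] complex_cnj_add complex_cnj_diff cnj_hexp_series[OF \<alpha> b] cnj_hexp_series[OF \<alpha>m b]
    using E(2)[of "- \<omega>"] F(2)[of "- \<omega>"] by auto
  define q where "q z = exp (2 * \<i> * (of_real (b - a) * z))" for z
  define num where "num z = (E z - F z) + \<xi> * q z * (E (- z) + F (- z))" for z
  define den where "den z = (E z + F z) + \<xi> * q z * (E (- z) - F (- z))" for z
  have refl: "(\<lambda>z. f (- z)) holomorphic_on UNIV" if "f holomorphic_on UNIV" for f :: "complex \<Rightarrow> complex"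
  proof -
    have "(f \<circ> uminus) holomorphic_on UNIV"
      using that by (intro holomorphic_on_compose holomorphic_intros) (auto elim: holomorphic_on_subset)
    then show ?thesis by (simp add: o_def)
  qed
  have hn: "num holomorphic_on UNIV" unfolding num_def[abs_def] q_def by (intro holomorphic_intros E F refl)
  have hd: "den holomorphic_on UNIV" unfolding den_def[abs_def] q_def by (intro holomorphic_intros E F refl)
  have val: "num (of_real \<omega>) = D \<omega> + \<xi> * Q \<omega> * cnj (S \<omega>)" "den (of_real \<omega>) = S \<omega> + \<xi> * Q \<omega> * cnj (D \<omega>)" for \<omega>
    unfolding num_def den_def cS cD unfolding S D q_def Q_def by simp_all
  note outer = D_def S_def
  have nz: "den (of_real \<omega>) \<noteq> 0" for \<omega>
  proof -
    interpret hexp_coeff a b "modulated \<alpha> a \<omega>" "\<lambda>s. \<bar>\<alpha> s\<bar>"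
      using \<alpha> ab by (intro hexp_coeff_modulated) auto
    have less: "cmod (D \<omega>) < cmod (S \<omega>)" using D_less_S[OF b] unfolding D_def S_def outer .
    show ?thesis
    proof
      assume "den (of_real \<omega>) = 0"
      then have "S \<omega> + \<xi> * Q \<omega> * cnj (D \<omega>) = 0" unfolding val .
      then have "cmod (S \<omega>) = cmod (\<xi> * Q \<omega> * cnj (D \<omega>))" by (metis add_eq_0_iff norm_minus_cancel)
      also have "\<dots> = cmod \<xi> * cmod (D \<omega>)" by (simp add: norm_mult Q_def norm_exp_eq_Re)
      also have "\<dots> \<le> cmod (D \<omega>)" using \<xi> by (intro mult_left_le_one_le) auto
      finally show False using less by simp
    qed
  qed
  have op: "open {z. den z \<noteq> 0}"
    using holomorphic_on_imp_continuous_on[OF hd] by (intro open_Collect_neq) auto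
  have "(\<lambda>z. num z / den z) holomorphic_on {z. den z \<noteq> 0}"
    by (intro holomorphic_on_divide holomorphic_on_subset[OF hn] holomorphic_on_subset[OF hd]) auto
  from smooth_of_holomorphic[OF this op] nz show ?thesis by (simp add: val)
qed

section \<open>The energy inequality\<close>

text \<open>For x \<ge> 0 compare derivatives, using tanh s \<le> s; this in turn holds because s
  cosh s - sinh s has derivative s sinh s. Evenness covers negative x.\<close>

lemma ln_cosh_le: "ln (cosh x) \<le> x\<^sup>2 / (2::real)"
proof -
  have *: "ln (cosh x) \<le> x\<^sup>2 / 2" if "x \<ge> 0" for x :: real
  proof -
    have g: "0 \<le> t * cosh t - sinh t" if "t \<ge> 0" for t :: real
    proof -
      have "0 * cosh 0 - sinh 0 \<le> t * cosh t - sinh t"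
      proof (rule DERIV_nonneg_imp_nondecreasing[OF that])
        fix s :: real assume s: "0 \<le> s" "s \<le> t"
        have "((\<lambda>t. t * cosh t - sinh t) has_real_derivative s * sinh s) (at s)"
          by (auto intro!: derivative_eq_intros)
        moreover have "s * sinh s \<ge> 0" using s by simp
        ultimately show "\<exists>y. ((\<lambda>t. t * cosh t - sinh t) has_real_derivative y) (at s) \<and> 0 \<le> y" by blast
      qed
      then show ?thesis by simp
    qed
    have "0\<^sup>2 / 2 - ln (cosh 0) \<le> x\<^sup>2 / 2 - ln (cosh x)"
    proof (rule DERIV_nonneg_imp_nondecreasing[OF that])
      fix s :: real assume s: "0 \<le> s" "s \<le> x"
      have "((\<lambda>t. t\<^sup>2 / 2 - ln (cosh t)) has_real_derivative s - sinh s / cosh s) (at s)"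
        by (auto intro!: derivative_eq_intros simp: cosh_real_pos)
      moreover have "s - sinh s / cosh s = (s * cosh s - sinh s) / cosh s" by (simp add: field_simps)
      then have "s - sinh s / cosh s \<ge> 0" using g[OF s(1)] cosh_real_pos[of s] by simp
      ultimately show "\<exists>y. ((\<lambda>t. t\<^sup>2 / 2 - ln (cosh t)) has_real_derivative y) (at s) \<and> 0 \<le> y" by blast
    qed
    then show ?thesis by simp
  qed
  show ?thesis using *[of "\<bar>x\<bar>"] by (cases "x \<ge> 0") auto
qed

text \<open>Cauchy-Schwarz against the constant function 1, obtained by integrating (f - m)^2 with m
  the mean of f.\<close>

lemma square_integral_le:
  fixes f :: "real \<Rightarrow> real"
  assumes f: "f integrable_on {u..v}" and f2: "(\<lambda>x. (f x)\<^sup>2) integrable_on {u..v}" and uv: "u < v"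
  shows "(integral {u..v} f)\<^sup>2 \<le> (v - u) * integral {u..v} (\<lambda>x. (f x)\<^sup>2)"
proof -
  define m where "m = integral {u..v} f / (v - u)"
  have "((\<lambda>x. (f x)\<^sup>2 - 2 * m * f x + m\<^sup>2) has_integral
      (integral {u..v} (\<lambda>x. (f x)\<^sup>2) - 2 * m * integral {u..v} f + (v - u) * m\<^sup>2)) {u..v}"
    using has_integral_const_real[of "m\<^sup>2" u v] uv
    by (intro has_integral_add has_integral_diff has_integral_mult_right integrable_integral f f2) simp
  then have "0 \<le> integral {u..v} (\<lambda>x. (f x)\<^sup>2) - 2 * m * integral {u..v} f + (v - u) * m\<^sup>2"
  proof (rule has_integral_nonneg)
    fix x
    have "(f x)\<^sup>2 - 2 * m * f x + m\<^sup>2 = (f x - m)\<^sup>2" by (simp add: power2_eq_square algebra_simps)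
    then show "0 \<le> (f x)\<^sup>2 - 2 * m * f x + m\<^sup>2" by simp
  qed
  moreover have I: "integral {u..v} f = m * (v - u)" using uv by (simp add: m_def)
  ultimately have "m\<^sup>2 * (v - u) \<le> integral {u..v} (\<lambda>x. (f x)\<^sup>2)"
    by (simp add: power2_eq_square algebra_simps)
  then have "(v - u) * (m\<^sup>2 * (v - u)) \<le> (v - u) * integral {u..v} (\<lambda>x. (f x)\<^sup>2)"
    using uv by (intro mult_left_mono) auto
  then show ?thesis unfolding I by (simp add: power2_eq_square algebra_simps)
qed

text \<open>Transfer polynomials of a layered coefficient: with \<open>w = exp (2 \<i> \<omega> h)\<close> the first component is
  \<open>S / 2\<close> and the second one \<open>w ^ k * cnj D / 2\<close> at the end of the \<open>k\<close>-th layer.\<close>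

primrec layer_poly :: "(nat \<Rightarrow> real) \<Rightarrow> nat \<Rightarrow> complex \<Rightarrow> complex \<times> complex" where
  "layer_poly \<beta> 0 w = (1, 0)"
| "layer_poly \<beta> (Suc k) w =
    (of_real (cosh (\<beta> k)) * fst (layer_poly \<beta> k w) + of_real (sinh (\<beta> k)) * w * snd (layer_poly \<beta> k w),
     of_real (sinh (\<beta> k)) * fst (layer_poly \<beta> k w) + of_real (cosh (\<beta> k)) * w * snd (layer_poly \<beta> k w))"

section \<open>Zero-freeness of the transfer polynomials and the mean value property\<close>

lemma layer_poly_holomorphic:
  "(\<lambda>w. fst (layer_poly \<beta> k w)) holomorphic_on A \<and> (\<lambda>w. snd (layer_poly \<beta> k w)) holomorphic_on A"
  by (induction k) (auto intro!: holomorphic_intros)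

text \<open>At w = 0 the coupling to the second component disappears. The logarithm of this product
  is the sum over layers produced by the mean value property.\<close>

lemma layer_poly_0: "fst (layer_poly \<beta> k 0) = of_real (\<Prod>i<k. cosh (\<beta> i))"
  by (induction k) (auto simp: mult.commute)

lemma hyperbolic_rotation_norm:
  fixes s w :: complex
  shows "(cmod (of_real (cosh x) * s + of_real (sinh x) * w))\<^sup>2 - (cmod (of_real (sinh x) * s + of_real (cosh x) * w))\<^sup>2
    = (cmod s)\<^sup>2 - (cmod w)\<^sup>2"
proof -
  have c: "(cosh x)\<^sup>2 = (sinh x)\<^sup>2 + 1" by (simp add: cosh_square_eq)
  have "(cmod (of_real (cosh x) * s + of_real (sinh x) * w))\<^sup>2 - (cmod (of_real (sinh x) * s + of_real (cosh x) * w))\<^sup>2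
    = ((cosh x)\<^sup>2 - (sinh x)\<^sup>2) * ((cmod s)\<^sup>2 - (cmod w)\<^sup>2)"
    unfolding cmod_power2 by (simp add: power2_eq_square algebra_simps)
  then show ?thesis by (simp add: c)
qed

text \<open>Multiplying the second component by w can only shrink it, and the hyperbolic rotation
  preserves the indefinite form, so the form never drops below its initial value 1.\<close>

lemma layer_poly_norm:
  assumes "cmod w \<le> 1"
  shows "(cmod (fst (layer_poly \<beta> k w)))\<^sup>2 - (cmod (snd (layer_poly \<beta> k w)))\<^sup>2 \<ge> 1"
proof (induction k)
  case (Suc k)
  have "(cmod (w * snd (layer_poly \<beta> k w)))\<^sup>2 \<le> (cmod (snd (layer_poly \<beta> k w)))\<^sup>2"
    using assms by (intro power_mono) (auto simp: norm_mult intro: mult_left_le_one_le)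
  then show ?case
    unfolding layer_poly.simps fst_conv snd_conv mult.assoc
    using Suc hyperbolic_rotation_norm[of "\<beta> k" "fst (layer_poly \<beta> k w)" "w * snd (layer_poly \<beta> k w)"]
    by linarith
qed simp

lemma layer_poly_nonzero:
  assumes "cmod w \<le> 1"
  shows "cmod (fst (layer_poly \<beta> k w)) \<ge> 1"
proof (rule power2_le_imp_le)
  show "1\<^sup>2 \<le> (cmod (fst (layer_poly \<beta> k w)))\<^sup>2"
    unfolding one_power2
    using layer_poly_norm[OF assms, of \<beta> k] zero_le_power2[of "cmod (snd (layer_poly \<beta> k w))"] by linarith
qed simp

text \<open>On a slightly larger disc f has a holomorphic logarithm g, and ln |f| = Re g inherits
  the mean value property from Cauchy's formula. The minus sign starts the circle at -1, so that
  rescaling gives a period symmetric about \<omega> = 0.\<close>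

lemma has_integral_ln_norm_circle:
  assumes f: "f holomorphic_on UNIV" and nz: "\<And>z. cmod z \<le> 1 \<Longrightarrow> f z \<noteq> 0"
  shows "((\<lambda>t. ln (cmod (f (- exp (2 * of_real pi * \<i> * of_real t))))) has_integral ln (cmod (f 0))) {0..1}"
proof -
  have op: "open {z. f z \<noteq> 0}"
    using holomorphic_on_imp_continuous_on[OF f] by (intro open_Collect_neq) auto
  have "cball 0 1 \<subseteq> {z. f z \<noteq> 0}" using nz by auto
  \<comment> \<open>Compactness gives the zero-free set a margin \<epsilon> around the closed
    disc.\<close>
  then obtain \<epsilon> where \<epsilon>: "\<epsilon> > 0" "(\<Union>x\<in>cball 0 1. ball x \<epsilon>) \<subseteq> {z. f z \<noteq> 0}"
    by (rule compact_subset_open_imp_ball_epsilon_subset[OF compact_cball op])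
  have sub: "ball 0 (1 + \<epsilon>) \<subseteq> {z. f z \<noteq> 0}"
  proof
    fix z :: complex assume z: "z \<in> ball 0 (1 + \<epsilon>)"
    show "z \<in> {z. f z \<noteq> 0}"
    proof (cases "cmod z \<le> 1")
      case False
      \<comment> \<open>The radial projection of z to the unit circle, at distance |z| - 1 <
        \<epsilon> from z.\<close>
      define x where "x = z / of_real (cmod z)"
      have x1: "cmod x = 1" unfolding x_def using False by (auto simp: norm_divide)
      have "z - x = of_real (1 - 1 / cmod z) * z" unfolding x_def by (simp add: algebra_simps)
      then have "cmod (z - x) = \<bar>1 - 1 / cmod z\<bar> * cmod z" by (simp only: norm_mult norm_of_real)
      moreover have "1 - 1 / cmod z \<ge> 0" using False by (simp add: divide_le_eq_1)
      ultimately have "cmod (z - x) = (1 - 1 / cmod z) * cmod z" by simp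
      also have "\<dots> = cmod z - 1" using False by (auto simp: left_diff_distrib)
      finally have zx: "cmod (z - x) = cmod z - 1" .
      then have "z \<in> ball x \<epsilon>" using z by (simp add: dist_norm norm_minus_commute)
      moreover have "x \<in> cball 0 1" using x1 by simp
      ultimately show ?thesis using \<epsilon>(2) by blast
    qed (use nz in auto)
  qed
  have "contractible (ball (0::complex) (1 + \<epsilon>))" by (simp add: convex_imp_contractible)
  then obtain g where g: "g holomorphic_on ball 0 (1 + \<epsilon>)" "\<And>z. z \<in> ball 0 (1 + \<epsilon>) \<Longrightarrow> f z = exp (g z)"
    using contractible_imp_holomorphic_log[OF holomorphic_on_subset[OF f subset_UNIV], of "ball 0 (1 + \<epsilon>)"] sub by blast
  have lg: "ln (cmod (f z)) = Re (g z)" if "cmod z \<le> 1" for z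
    using g(2)[of z] that \<epsilon>(1) by (simp add: norm_exp_eq_Re)
  have "(g \<circ> uminus) holomorphic_on cball 0 1"
    using \<epsilon>(1) by (intro holomorphic_on_compose holomorphic_intros holomorphic_on_subset[OF g(1)]) auto
  from Cauchy_integral_circlepath_simple[OF this, of 0]
  have "((\<lambda>u. g (- u) / u) has_contour_integral 2 * of_real pi * \<i> * g 0) (circlepath 0 1)" by (simp add: o_def)
  then have "((\<lambda>t. g (- circlepath 0 1 t) / circlepath 0 1 t * vector_derivative (circlepath 0 1) (at t within {0..1}))
     has_integral 2 * of_real pi * \<i> * g 0) {0..1}"
    unfolding has_contour_integral_def .
  then have "((\<lambda>t. 2 * of_real pi * \<i> * g (- exp (2 * of_real pi * \<i> * of_real t))) has_integral 2 * of_real pi * \<i> * g 0) {0..1}"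
  proof (rule has_integral_eq[rotated])
    fix t :: real assume t: "t \<in> {0..1}"
    have cp: "circlepath 0 1 t = exp (2 * of_real pi * \<i> * of_real t)" by (simp add: circlepath)
    have vd: "vector_derivative (circlepath 0 1) (at t within {0..1}) = 2 * of_real pi * \<i> * exp (2 * of_real pi * \<i> * of_real t)"
      using t vector_derivative_circlepath01[of t 0 1] by simp
    show "g (- circlepath 0 1 t) / circlepath 0 1 t * vector_derivative (circlepath 0 1) (at t within {0..1})
      = 2 * of_real pi * \<i> * g (- exp (2 * of_real pi * \<i> * of_real t))"
      unfolding vd cp by simp
  qed
  from has_integral_mult_right[OF this, of "1 / (2 * of_real pi * \<i>)"]
  have "((\<lambda>t. g (- exp (2 * of_real pi * \<i> * of_real t))) has_integral g 0) {0..1}" by simp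
  from has_integral_linear[OF this bounded_linear_Re]
  have "((\<lambda>t. Re (g (- exp (2 * of_real pi * \<i> * of_real t)))) has_integral Re (g 0)) {0..1}" by (simp add: o_def)
  then have "((\<lambda>t. Re (g (- exp (2 * of_real pi * \<i> * of_real t)))) has_integral ln (cmod (f 0))) {0..1}"
    by (simp add: lg)
  then show ?thesis
    by (rule has_integral_eq[rotated]) (simp add: lg norm_exp_eq_Re)
qed

lemma has_integral_ln_norm_period:
  assumes f: "f holomorphic_on UNIV" and nz: "\<And>z. cmod z \<le> 1 \<Longrightarrow> f z \<noteq> 0" and h: "h > 0"
  shows "((\<lambda>\<omega>. ln (cmod (f (exp (2 * \<i> * of_real (\<omega> * h)))))) has_integral pi / h * ln (cmod (f 0))) {- (pi / (2 * h))..pi / (2 * h)}"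
proof -
  have m: "h / pi > 0" using h by simp
  have eq: "- exp (2 * of_real pi * \<i> * of_real (h / pi * \<omega> + 1/2)) = exp (2 * \<i> * of_real (\<omega> * h))" for \<omega>
  proof -
    have "2 * of_real pi * \<i> * of_real (h / pi * \<omega> + 1/2) = 2 * \<i> * of_real (\<omega> * h) + \<i> * of_real pi"
      by (simp add: field_simps)
    then show ?thesis by (simp only: exp_add) (simp add: mult.commute)
  qed
  have "((\<lambda>t. ln (cmod (f (- exp (2 * of_real pi * \<i> * of_real t))))) has_integral ln (cmod (f 0))) (cbox 0 1)"
    using has_integral_ln_norm_circle[OF f nz] by simp
  from has_integral_affinity_iff[OF m, THEN iffD2, OF this, of "1/2"]
  have *: "((\<lambda>\<omega>. ln (cmod (f (- exp (2 * of_real pi * \<i> * of_real (h / pi * \<omega> + 1/2)))))) has_integral ln (cmod (f 0)) /\<^sub>R (h / pi))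
     (cbox ((0 - 1/2) /\<^sub>R (h / pi)) ((1 - 1/2) /\<^sub>R (h / pi)))"
    by (simp only: real_scaleR_def DIM_real power_one_right)
  have "(0 - 1/2) /\<^sub>R (h / pi) = - (pi / (2 * h))" "(1 - 1/2) /\<^sub>R (h / pi) = pi / (2 * h)"
    "ln (cmod (f 0)) /\<^sub>R (h / pi) = pi / h * ln (cmod (f 0))"
    by (simp_all add: field_simps)
  then show ?thesis using * unfolding eq by (simp only: cbox_interval)
qed

text \<open>On a layer the phase is constant, so that the system is solved by hyperbolic rotations.\<close>

lemma frozen_phase_step:
  fixes X Y :: "real \<Rightarrow> complex" and \<alpha> :: "real \<Rightarrow> real"
  assumes X: "ac_deriv {u..v} X (\<lambda>s. c s * cnj (Y s))" and Y: "ac_deriv {u..v} Y (\<lambda>s. c s * cnj (X s))"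
    and \<alpha>: "\<alpha> absolutely_integrable_on {u..v}" and c: "\<And>s. s \<in> {u<..v} \<Longrightarrow> c s = of_real (\<alpha> s) * w" and w: "cmod w = 1" and uv: "u \<le> v"
  defines "M \<equiv> integral {u..v} \<alpha>"
  shows "X v = of_real (cosh M) * X u + of_real (sinh M) * w * cnj (Y u)"
proof -
  define A where "A x = integral {u..x} \<alpha>" for x
  have A: "ac_deriv {u..v} A \<alpha>" unfolding A_def[abs_def] by (rule ac_deriv_indefinite_integral[OF \<alpha>])
  have A0: "A u = 0" by (simp add: A_def)
  have ep: "ac_deriv {u..v} (\<lambda>x. exp (A x)) (\<lambda>x. \<alpha> x * exp (A x))" by (rule ac_deriv_exp[OF A]) simp
  have em: "ac_deriv {u..v} (\<lambda>x. exp (- A x)) (\<lambda>x. - \<alpha> x * exp (- A x))" by (rule ac_deriv_exp[OF ac_deriv_minus[OF A]]) simp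
  have ch: "ac_deriv {u..v} (\<lambda>x. cosh (A x)) (\<lambda>x. \<alpha> x * sinh (A x))"
    by (rule ac_deriv_cong[OF ac_deriv_cmult[OF ac_deriv_add[OF ep em], of "1/2"]]) (simp_all add: cosh_def sinh_def algebra_simps)
  have sh: "ac_deriv {u..v} (\<lambda>x. sinh (A x)) (\<lambda>x. \<alpha> x * cosh (A x))"
    by (rule ac_deriv_cong[OF ac_deriv_cmult[OF ac_deriv_diff[OF ep em], of "1/2"]]) (simp_all add: cosh_def sinh_def algebra_simps)
  have ww: "w * cnj w = 1" using complex_norm_square[of w] w by simp
  \<comment> \<open>The inverse hyperbolic rotation of the pair is conserved. Applied to (X, Y) and
    (Y, X) this gives two linear equations at v, which are solved by cosh^2 - sinh^2 = 1.\<close>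
  have gen: "of_real (cosh M) * P v - of_real (sinh M) * w * cnj (R v) = P u"
    if P: "ac_deriv {u..v} P (\<lambda>s. c s * cnj (R s))" and R: "ac_deriv {u..v} R (\<lambda>s. c s * cnj (P s))" for P R
  proof -
    let ?G = "\<lambda>x. of_real (cosh (A x)) * P x - w * (of_real (sinh (A x)) * cnj (R x))"
    have "ac_deriv {u..v} ?G (\<lambda>x. (of_real (cosh (A x)) * (c x * cnj (R x)) + of_real (\<alpha> x * sinh (A x)) * P x)
       - w * (of_real (sinh (A x)) * cnj (c x * cnj (P x)) + of_real (\<alpha> x * cosh (A x)) * cnj (R x)))"
      by (intro ac_deriv_diff ac_deriv_mult ac_deriv_cmult ac_deriv_of_real ac_deriv_cnj ch sh P R) auto
    then have "ac_deriv {u..v} ?G (\<lambda>x. 0)"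
    proof (rule ac_deriv_cong_ae)
      \<comment> \<open>The phase is known on {u<..v} only: the ceiling in \<open>frozen\<close>
        assigns u to the preceding layer.\<close>
      show "negligible {u}" by simp
      fix x assume "x \<in> {u..v} - {u}"
      then have cx: "c x = of_real (\<alpha> x) * w" using c by auto
      have "w * (of_real (sinh (A x)) * cnj (c x * cnj (P x))) = (w * cnj w) * (of_real (sinh (A x)) * of_real (\<alpha> x) * P x)"
        unfolding cx by (simp add: algebra_simps)
      also have "\<dots> = of_real (\<alpha> x * sinh (A x)) * P x" unfolding ww by simp
      finally show "(of_real (cosh (A x)) * (c x * cnj (R x)) + of_real (\<alpha> x * sinh (A x)) * P x)
       - w * (of_real (sinh (A x)) * cnj (c x * cnj (P x)) + of_real (\<alpha> x * cosh (A x)) * cnj (R x)) = 0"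
        unfolding cx by (simp add: algebra_simps)
    qed
    from ac_deriv_zero_imp_const[OF this, of v u] uv
    show ?thesis by (simp add: A0 M_def A_def is_interval_cc algebra_simps)
  qed
  note 1 = gen[OF X Y] and 2 = gen[OF Y X]
  have ch2: "of_real (cosh M) * of_real (cosh M) - of_real (sinh M) * of_real (sinh M) = (1::complex)"
    unfolding of_real_mult[symmetric] of_real_diff[symmetric]
    using hyperbolic_pythagoras[of M] by (simp add: power2_eq_square)
  have "cnj (Y u) = of_real (cosh M) * cnj (Y v) - of_real (sinh M) * cnj w * X v"
    unfolding 2[symmetric] by simp
  then have "of_real (cosh M) * X u + of_real (sinh M) * w * cnj (Y u) =
     of_real (cosh M) * (of_real (cosh M) * X v - of_real (sinh M) * w * cnj (Y v))
      + of_real (sinh M) * w * (of_real (cosh M) * cnj (Y v) - of_real (sinh M) * cnj w * X v)"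
    by (simp only: 1)
  also have "\<dots> = (of_real (cosh M) * of_real (cosh M) - of_real (sinh M) * of_real (sinh M) * (w * cnj w)) * X v"
    by (simp add: algebra_simps)
  also have "\<dots> = X v" unfolding ww by (simp add: ch2)
  finally show ?thesis ..
qed

text \<open>The ceiling moves s to the right end of its layer, so the phase on layer k is the power
  \<open>Suc k\<close> of exp (2 \<i> \<omega> h). The factor \<alpha> stays untouched, which keeps
  |\<alpha>| as majorant.\<close>

definition frozen :: "(real \<Rightarrow> real) \<Rightarrow> real \<Rightarrow> real \<Rightarrow> real \<Rightarrow> real \<Rightarrow> complex" where
  "frozen \<alpha> a h \<omega> s = of_real (\<alpha> s) * exp (2 * \<i> * of_real (\<omega> * (h * of_int \<lceil>(s - a) / h\<rceil>)))"

lemma norm_frozen: "cmod (frozen \<alpha> a h \<omega> s) = \<bar>\<alpha> s\<bar>"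
  by (simp add: frozen_def norm_mult norm_exp_eq_Re)

lemma absolutely_integrable_frozen:
  fixes \<alpha> :: "real \<Rightarrow> real"
  assumes \<alpha>: "\<alpha> absolutely_integrable_on {a..b}"
  shows "frozen \<alpha> a h \<omega> absolutely_integrable_on {a..b}"
proof -
  let ?p = "\<lambda>s. exp (2 * \<i> * complex_of_real (\<omega> * (h * of_int \<lceil>(s - a) / h\<rceil>)))"
  have "(\<lambda>s. (\<lambda>x y. y * x) (?p s) (complex_of_real (\<alpha> s))) absolutely_integrable_on {a..b}"
  proof (rule absolutely_integrable_bounded_measurable_product[where h="\<lambda>x y. y * x" and f="?p" and g="\<lambda>s. complex_of_real (\<alpha> s)"])
    show "bilinear (\<lambda>x y::complex. y * x)"
      by (auto simp: bilinear_def intro!: bounded_linear.linear bounded_linear_mult_left bounded_linear_mult_right)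
    have "(\<lambda>s. real_of_int \<lceil>(s - a) / h\<rceil>) \<in> borel_measurable borel" by measurable
    from measurable_compose[OF this, of "\<lambda>r. exp (2 * \<i> * complex_of_real (\<omega> * (h * r)))" borel]
    have "?p \<in> borel_measurable borel"
      by (simp add: borel_measurable_continuous_onI continuous_intros)
    then have "?p \<in> borel_measurable lebesgue" by (simp add: measurable_completion)
    then show "?p \<in> borel_measurable (lebesgue_on {a..b})" by (rule measurable_restrict_space1)
    show "bounded (?p ` {a..b})"
      by (rule boundedI[of _ 1]) (auto simp: norm_exp_eq_Re)
    show "(\<lambda>s. complex_of_real (\<alpha> s)) absolutely_integrable_on {a..b}"
      using absolutely_integrable_linear[OF \<alpha> bounded_linear_of_real] by (simp add: o_def)
  qed simp
  then show ?thesis by (simp add: frozen_def[abs_def])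
qed

lemma norm_exp_i_diff_le: "cmod (exp (\<i> * of_real x) - exp (\<i> * of_real y)) \<le> \<bar>x - y\<bar>"
proof -
  have "exp (\<i> * of_real x) - exp (\<i> * of_real y) = exp (\<i> * of_real y) * (exp (\<i> * of_real (x - y)) - 1)"
    unfolding right_diff_distrib exp_add[symmetric] by (simp add: algebra_simps)
  then have "cmod (exp (\<i> * of_real x) - exp (\<i> * of_real y)) = 2 * \<bar>sin ((x - y) / 2)\<bar>"
    by (simp only: norm_mult dist_exp_i_1 norm_exp_i_times mult_1)
  also have "\<dots> \<le> 2 * \<bar>(x - y) / 2\<bar>" by (intro mult_left_mono abs_sin_x_le_abs_x) simp
  finally show ?thesis by simp
qed

text \<open>Freezing displaces s by at most h, hence the argument of the unit exponential by at most
  2 |\<omega>| h.\<close>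

lemma modulated_frozen_diff:
  assumes h: "h > 0"
  shows "cmod (modulated \<alpha> a \<omega> s - frozen \<alpha> a h \<omega> s) \<le> (2 * \<bar>\<omega>\<bar> * h) * \<bar>\<alpha> s\<bar>"
proof -
  define n where "n = real_of_int \<lceil>(s - a) / h\<rceil>"
  have n: "(s - a) / h \<le> n" "n < (s - a) / h + 1" unfolding n_def by linarith+
  have "\<bar>(s - a) - h * n\<bar> \<le> h"
    using n h by (simp add: field_simps abs_le_iff)
  then have le: "2 * \<bar>\<omega>\<bar> * \<bar>(s - a) - h * n\<bar> \<le> 2 * \<bar>\<omega>\<bar> * h" by (intro mult_left_mono) auto
  have "cmod (exp (\<i> * of_real (2 * (\<omega> * (s - a)))) - exp (\<i> * of_real (2 * (\<omega> * (h * n))))) \<le> \<bar>2 * (\<omega> * (s - a)) - 2 * (\<omega> * (h * n))\<bar>"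
    by (rule norm_exp_i_diff_le)
  also have "2 * (\<omega> * (s - a)) - 2 * (\<omega> * (h * n)) = 2 * \<omega> * ((s - a) - h * n)" by (simp add: algebra_simps)
  also have "\<bar>2 * \<omega> * ((s - a) - h * n)\<bar> = 2 * \<bar>\<omega>\<bar> * \<bar>(s - a) - h * n\<bar>" by (simp only: abs_mult abs_numeral)
  also note le
  finally have *: "cmod (exp (\<i> * of_real (2 * (\<omega> * (s - a)))) - exp (\<i> * of_real (2 * (\<omega> * (h * n))))) \<le> 2 * \<bar>\<omega>\<bar> * h" .
  have "modulated \<alpha> a \<omega> s - frozen \<alpha> a h \<omega> s = of_real (\<alpha> s) * (exp (\<i> * of_real (2 * (\<omega> * (s - a)))) - exp (\<i> * of_real (2 * (\<omega> * (h * n)))))"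
    unfolding frozen_def n_def[symmetric] by (simp add: algebra_simps)
  also have "cmod \<dots> \<le> \<bar>\<alpha> s\<bar> * (2 * \<bar>\<omega>\<bar> * h)"
    unfolding norm_mult norm_of_real using * by (rule mult_left_mono) simp
  finally show ?thesis by (simp add: mult.commute)
qed

lemma hexp_series_diff_bound:
  assumes c: "hexp_coeff a b c \<beta>" and d: "hexp_coeff a b d \<beta>"
    and diff: "\<And>s. s \<in> {a..b} \<Longrightarrow> norm (c s - d s) \<le> \<delta> * \<beta> s" and x: "x \<in> {a..b}" and \<delta>: "\<delta> \<ge> 0"
  shows "norm (hexp_series a c x - hexp_series a d x) \<le> \<delta> * exp (2 * integral {a..x} \<beta>)"
proof -
  interpret c: hexp_coeff a b c \<beta> by fact
  interpret d: hexp_coeff a b d \<beta> by fact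
  let ?B = "integral {a..x} \<beta>"
  have B: "0 \<le> ?B" using c.B_nonneg[OF x] unfolding c.B_def .
  have s: "summable (\<lambda>j. hexp_iter a c j x)" "summable (\<lambda>j. hexp_iter a d j x)"
    using summable_norm_cancel[OF c.summable_iter[OF x]] summable_norm_cancel[OF d.summable_iter[OF x]] .
  have "hexp_series a c x - hexp_series a d x = (\<Sum>j. hexp_iter a c j x - hexp_iter a d j x)"
    unfolding hexp_series_def by (rule suminf_diff[OF s])
  also have "norm \<dots> \<le> (\<Sum>j. \<delta> * ((2 * ?B) ^ j / fact j))"
  proof (rule norm_suminf_le)
    fix j
    have "norm (hexp_iter a c j x - hexp_iter a d j x) \<le> \<delta> * real j * (?B ^ j / fact j)"
      by (rule hexp_iter_diff_bound[OF c.c d.c c.\<beta> c.le d.le diff x])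
    \<comment> \<open>The factor j is absorbed by 2^j, which doubles the argument of the exponential
      series.\<close>
    also have "\<dots> \<le> \<delta> * 2 ^ j * (?B ^ j / fact j)"
      using B \<delta> of_nat_less_two_power[of j, where ?'a = real] by (intro mult_right_mono mult_left_mono) (auto simp: less_imp_le)
    also have "\<dots> = \<delta> * ((2 * ?B) ^ j / fact j)" by (simp add: power_mult_distrib)
    finally show "norm (hexp_iter a c j x - hexp_iter a d j x) \<le> \<delta> * ((2 * ?B) ^ j / fact j)" .
  qed (intro summable_mult c.exp_summable)
  also have "\<dots> = \<delta> * exp (2 * ?B)"
    by (subst suminf_mult[OF c.exp_summable]) (simp add: exp_def field_simps)
  finally show ?thesis .
qed

section \<open>The energy of a coefficient with frozen phase\<close>

locale layered =
  fixes a b :: real and \<alpha> :: "real \<Rightarrow> real" and N :: nat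
  assumes a_less_b: "a < b" and \<alpha>: "\<alpha> absolutely_integrable_on {a..b}" and N: "N > 0"
begin

definition h where "h = (b - a) / real N"
definition t where "t k = a + real k * h"
definition \<beta> where "\<beta> k = integral {t k..t (Suc k)} \<alpha>"

lemma h_pos: "h > 0" unfolding h_def using a_less_b N by simp

lemma t_0: "t 0 = a" by (simp add: t_def)

lemma t_N: "t N = b" using N by (simp add: t_def h_def)

lemma t_Suc: "t (Suc k) = t k + h" by (simp add: t_def algebra_simps)

lemma t_mono: "i \<le> j \<Longrightarrow> t i \<le> t j" using h_pos by (simp add: t_def)

lemma t_in: "k \<le> N \<Longrightarrow> t k \<in> {a..b}" using t_mono[of 0 k] t_mono[of k N] by (simp add: t_0 t_N)

lemma hexp_coeff_frozen: "hexp_coeff a b (frozen \<alpha> a h \<omega>) (\<lambda>s. \<bar>\<alpha> s\<bar>)"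
proof
  show "(\<lambda>s. \<bar>\<alpha> s\<bar>) absolutely_integrable_on {a..b}" by (rule set_integrable_abs[OF \<alpha>])
qed (use a_less_b absolutely_integrable_frozen[OF \<alpha>] in \<open>auto simp: norm_frozen\<close>)

lemma frozen_on_layer:
  assumes "s \<in> {t k<..t (Suc k)}"
  shows "frozen \<alpha> a h \<omega> s = of_real (\<alpha> s) * exp (2 * \<i> * of_real (\<omega> * h)) ^ Suc k"
proof -
  have "real k * h < s - a" "s - a \<le> (real k + 1) * h" using assms by (auto simp: t_def algebra_simps)
  then have "real k < (s - a) / h" "(s - a) / h \<le> real k + 1" using h_pos by (auto simp: field_simps)
  then have "\<lceil>(s - a) / h\<rceil> = int k + 1" by linarith
  moreover have "exp (2 * \<i> * of_real (\<omega> * h)) ^ Suc k = exp (of_nat (Suc k) * (2 * \<i> * of_real (\<omega> * h)))"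
    by (rule exp_of_nat_mult[symmetric])
  ultimately show ?thesis unfolding frozen_def by (simp add: algebra_simps)
qed

text \<open>The phase on layer k is w^(k+1). Carrying the factor w^k along with cnj D leaves a
  single factor w per layer, so that the recursion becomes polynomial in w.\<close>

lemma layer_transfer:
  fixes \<omega> :: real
  defines "c \<equiv> frozen \<alpha> a h \<omega>" and "w \<equiv> exp (2 * \<i> * of_real (\<omega> * h))"
  assumes "k \<le> N"
  shows "hexp_coeff.S a c (t k) = 2 * fst (layer_poly \<beta> k w) \<and>
    w ^ k * cnj (hexp_coeff.D a c (t k)) = 2 * snd (layer_poly \<beta> k w)"
  using \<open>k \<le> N\<close>
proof (induction k)
  case 0
  interpret hexp_coeff a b c "\<lambda>s. \<bar>\<alpha> s\<bar>" unfolding c_def by (rule hexp_coeff_frozen)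
  show ?case by (simp add: t_0 S_start D_start)
next
  case (Suc k)
  interpret hexp_coeff a b c "\<lambda>s. \<bar>\<alpha> s\<bar>" unfolding c_def by (rule hexp_coeff_frozen)
  have sub: "{t k..t (Suc k)} \<subseteq> {a..b}" using t_in[of k] t_in[of "Suc k"] Suc.prems by auto
  have w: "cmod w = 1" by (simp add: w_def norm_exp_eq_Re)
  have ww: "w ^ Suc k * cnj (w ^ Suc k) = 1"
    using complex_norm_square[of "w ^ Suc k"] w by (simp add: norm_power del: power_Suc)
  have cs: "c s = of_real (\<alpha> s) * w ^ Suc k" if "s \<in> {t k<..t (Suc k)}" for s
    unfolding c_def w_def by (rule frozen_on_layer[OF that])
  have wk: "cmod (w ^ Suc k) = 1" using w by (simp add: norm_power del: power_Suc)
  have \<alpha>k: "\<alpha> absolutely_integrable_on {t k..t (Suc k)}" by (rule absolutely_integrable_on_subinterval[OF \<alpha> sub])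
  have tt: "t k \<le> t (Suc k)" by (rule t_mono) simp
  note S' = ac_deriv_subset[OF ac_deriv_S sub] and D' = ac_deriv_subset[OF ac_deriv_D sub]
  have 1: "S (t (Suc k)) = of_real (cosh (\<beta> k)) * S (t k) + of_real (sinh (\<beta> k)) * w ^ Suc k * cnj (D (t k))"
    unfolding \<beta>_def by (rule frozen_phase_step[OF S' D' \<alpha>k cs wk tt])
  have 2: "D (t (Suc k)) = of_real (cosh (\<beta> k)) * D (t k) + of_real (sinh (\<beta> k)) * w ^ Suc k * cnj (S (t k))"
    unfolding \<beta>_def by (rule frozen_phase_step[OF D' S' \<alpha>k cs wk tt])
  have IH: "S (t k) = 2 * fst (layer_poly \<beta> k w)" "w ^ k * cnj (D (t k)) = 2 * snd (layer_poly \<beta> k w)"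
    using Suc by auto
  have "S (t (Suc k)) = of_real (cosh (\<beta> k)) * S (t k) + of_real (sinh (\<beta> k)) * w * (w ^ k * cnj (D (t k)))"
    unfolding 1 by simp
  then have "S (t (Suc k)) = 2 * fst (layer_poly \<beta> (Suc k) w)" unfolding IH by (simp add: algebra_simps)
  moreover have "w ^ Suc k * cnj (D (t (Suc k))) = of_real (cosh (\<beta> k)) * w * (w ^ k * cnj (D (t k)))
      + of_real (sinh (\<beta> k)) * (w ^ Suc k * cnj (w ^ Suc k)) * S (t k)"
    unfolding 2 by (simp add: algebra_simps)
  then have "w ^ Suc k * cnj (D (t (Suc k))) = 2 * snd (layer_poly \<beta> (Suc k) w)"
    unfolding ww IH by (simp add: algebra_simps)
  ultimately show ?case by blast
qed

lemma layer_S_end: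
  "hexp_coeff.S a (frozen \<alpha> a h \<omega>) b = 2 * fst (layer_poly \<beta> N (exp (2 * \<i> * of_real (\<omega> * h))))"
  using layer_transfer[of N \<omega>] by (simp add: t_N)

lemma sum_layer_integrals:
  assumes f: "f integrable_on {a..b}"
  shows "k \<le> N \<Longrightarrow> (\<Sum>i<k. integral {t i..t (Suc i)} f) = integral {a..t k} (f :: real \<Rightarrow> real)"
proof (induction k)
  case (Suc k)
  have "f integrable_on {a..t (Suc k)}"
    using f t_in[OF Suc.prems] by (intro integrable_subinterval_real[OF f]) auto
  then have "integral {a..t k} f + integral {t k..t (Suc k)} f = integral {a..t (Suc k)} f"
    using t_mono[of 0 k] t_mono[of k "Suc k"] by (intro Henstock_Kurzweil_Integration.integral_combine) (auto simp: t_0)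
  then show ?case using Suc by simp
qed (simp add: t_0)

text \<open>On each layer 2 ln cosh \<beta> is at most \<beta>^2, which Cauchy-Schwarz bounds by h
  times the integral of \<alpha>^2; this h cancels the denominator of the period.\<close>

lemma layer_energy:
  assumes f2: "(\<lambda>s. (\<alpha> s)\<^sup>2) integrable_on {a..b}"
  shows "pi / h * (2 * (\<Sum>k<N. ln (cosh (\<beta> k)))) \<le> pi * integral {a..b} (\<lambda>s. (\<alpha> s)\<^sup>2)"
proof -
  have f1: "\<alpha> integrable_on {a..b}" using \<alpha> by (simp add: absolutely_integrable_on_def)
  have "2 * (\<Sum>k<N. ln (cosh (\<beta> k))) = (\<Sum>k<N. 2 * ln (cosh (\<beta> k)))" by (rule sum_distrib_left)
  also have "\<dots> \<le> (\<Sum>k<N. h * integral {t k..t (Suc k)} (\<lambda>s. (\<alpha> s)\<^sup>2))"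
  proof (rule sum_mono)
    fix k assume "k \<in> {..<N}"
    then have sub: "{t k..t (Suc k)} \<subseteq> {a..b}" using t_in[of k] t_in[of "Suc k"] by auto
    have "2 * ln (cosh (\<beta> k)) \<le> (\<beta> k)\<^sup>2" using ln_cosh_le[of "\<beta> k"] by simp
    also have "\<dots> \<le> (t (Suc k) - t k) * integral {t k..t (Suc k)} (\<lambda>s. (\<alpha> s)\<^sup>2)"
      unfolding \<beta>_def by (rule square_integral_le) (use sub h_pos in \<open>auto simp: t_Suc intro: integrable_subinterval_real[OF f1] integrable_subinterval_real[OF f2]\<close>)
    finally show "2 * ln (cosh (\<beta> k)) \<le> h * integral {t k..t (Suc k)} (\<lambda>s. (\<alpha> s)\<^sup>2)" by (simp add: t_Suc)
  qed
  also have "\<dots> = h * integral {a..b} (\<lambda>s. (\<alpha> s)\<^sup>2)"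
    using sum_layer_integrals[OF f2, of N] by (simp add: t_N flip: sum_distrib_left)
  finally have "pi / h * (2 * (\<Sum>k<N. ln (cosh (\<beta> k)))) \<le> pi / h * (h * integral {a..b} (\<lambda>s. (\<alpha> s)\<^sup>2))"
    using h_pos by (intro mult_left_mono) auto
  then show ?thesis using h_pos by simp
qed

definition energy where "energy \<omega> = 2 * ln (cmod (hexp_coeff.S a (frozen \<alpha> a h \<omega>) b) / 2)"

lemma energy_eq: "energy \<omega> = 2 * ln (cmod (fst (layer_poly \<beta> N (exp (2 * \<i> * of_real (\<omega> * h))))))"
  unfolding energy_def layer_S_end by (simp add: norm_mult)

lemma norm_phase: "cmod (exp (2 * \<i> * of_real (\<omega> * h))) = 1" for \<omega> by (simp add: norm_exp_eq_Re)

lemma energy_nonneg: "0 \<le> energy \<omega>"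
  unfolding energy_eq using layer_poly_nonzero[of "exp (2 * \<i> * of_real (\<omega> * h))" \<beta> N] norm_phase[of \<omega>] by simp

lemma energy_measurable: "energy \<in> borel_measurable borel"
proof (rule borel_measurable_continuous_onI)
  define p where "p \<omega> = fst (layer_poly \<beta> N (exp (2 * \<i> * of_real (\<omega> * h))))" for \<omega>
  have "continuous_on UNIV (\<lambda>\<omega>. fst (layer_poly \<beta> N (exp (2 * \<i> * of_real (\<omega> * h)))))"
    by (rule continuous_on_compose2[OF holomorphic_on_imp_continuous_on[OF conjunct1[OF layer_poly_holomorphic]], of UNIV])
       (auto intro!: continuous_intros)
  then have "continuous_on UNIV p" by (simp add: p_def[abs_def])
  moreover have "cmod (p \<omega>) \<noteq> 0" for \<omega>
    unfolding p_def using layer_poly_nonzero[of "exp (2 * \<i> * of_real (\<omega> * h))" \<beta> N] norm_phase[of \<omega>] by auto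
  ultimately show "continuous_on UNIV energy"
    unfolding energy_eq[abs_def] p_def[symmetric] by (intro continuous_intros) auto
qed

lemma energy_integral:
  assumes f2: "(\<lambda>s. (\<alpha> s)\<^sup>2) integrable_on {a..b}"
  shows "(\<integral>\<^sup>+\<omega>. ennreal (energy \<omega>) * indicator {- (pi / (2 * h))..pi / (2 * h)} \<omega> \<partial>lborel) \<le> ennreal (pi * integral {a..b} (\<lambda>s. (\<alpha> s)\<^sup>2))"
proof -
  have p: "(\<Prod>i<N. cosh (\<beta> i)) > 0" by (intro prod_pos) (auto simp: cosh_real_pos)
  have nz: "fst (layer_poly \<beta> N z) \<noteq> 0" if "cmod z \<le> 1" for z using layer_poly_nonzero[OF that, of \<beta> N] by auto
  have l0: "ln (cmod (fst (layer_poly \<beta> N 0))) = (\<Sum>k<N. ln (cosh (\<beta> k)))"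
    unfolding layer_poly_0 norm_of_real using p by (simp add: ln_prod cosh_real_pos)
  have "((\<lambda>\<omega>. ln (cmod (fst (layer_poly \<beta> N (exp (2 * \<i> * of_real (\<omega> * h))))))) has_integral
     pi / h * (\<Sum>k<N. ln (cosh (\<beta> k)))) {- (pi / (2 * h))..pi / (2 * h)}"
    using has_integral_ln_norm_period[OF conjunct1[OF layer_poly_holomorphic], of \<beta> N, OF nz h_pos] unfolding l0 .
  from has_integral_mult_right[OF this, of 2]
  have "(energy has_integral pi / h * (2 * (\<Sum>k<N. ln (cosh (\<beta> k))))) {- (pi / (2 * h))..pi / (2 * h)}"
    unfolding energy_eq[abs_def] by (simp add: algebra_simps)
  from nn_integral_has_integral_lebesgue'[OF energy_nonneg this]
  show ?thesis using layer_energy[OF f2] by (simp add: ennreal_leI)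
qed

end

lemma nn_integral_ln_norm_S_le:
  fixes \<alpha> :: "real \<Rightarrow> real"
  assumes ab: "a < b" and \<alpha>: "\<alpha> absolutely_integrable_on {a..b}" and f2: "(\<lambda>s. (\<alpha> s)\<^sup>2) integrable_on {a..b}"
  shows "(\<integral>\<^sup>+\<omega>. ennreal (2 * ln (cmod (hexp_coeff.S a (modulated \<alpha> a \<omega>) b) / 2)) \<partial>lborel) \<le> ennreal (pi * integral {a..b} (\<lambda>s. (\<alpha> s)\<^sup>2))"
proof -
  have lay: "layered a b \<alpha> (Suc n)" for n by unfold_locales (use ab \<alpha> in auto)
  define h where "h n = layered.h a b (Suc n)" for n
  have h: "h n = (b - a) / real (Suc n)" for n unfolding h_def layered.h_def[OF lay] ..
  have hpos: "h n > 0" for n unfolding h using ab by simp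
  have hlim: "h \<longlonglongrightarrow> 0"
    using tendsto_mult[OF tendsto_const[of "b - a"] LIMSEQ_inverse_real_of_nat] by (simp add: h[abs_def] divide_inverse)
  define I where "I n = {- (pi / (2 * h n))..pi / (2 * h n)}" for n
  define u where "u n \<omega> = ennreal (layered.energy a b \<alpha> (Suc n) \<omega>) * indicator (I n) \<omega>" for n \<omega>
  let ?F = "\<lambda>\<omega>. 2 * ln (cmod (hexp_coeff.S a (modulated \<alpha> a \<omega>) b) / 2)"
  have um: "u n \<in> borel_measurable lborel" for n
    unfolding u_def I_def using layered.energy_measurable[OF lay, of n] by simp
  have lim: "(\<lambda>n. u n \<omega>) \<longlonglongrightarrow> ennreal (?F \<omega>)" for \<omega>
  proof -
    let ?c = "modulated \<alpha> a \<omega>" and ?d = "\<lambda>n. frozen \<alpha> a (h n) \<omega>"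
    have b: "b \<in> {a..b}" using ab by simp
    interpret c: hexp_coeff a b ?c "\<lambda>s. \<bar>\<alpha> s\<bar>" using \<alpha> ab by (intro hexp_coeff_modulated) auto
    have d: "hexp_coeff a b (?d n) (\<lambda>s. \<bar>\<alpha> s\<bar>)" for n
      unfolding h_def by (rule layered.hexp_coeff_frozen[OF lay])
    let ?C = "exp (2 * integral {a..b} (\<lambda>s. \<bar>\<alpha> s\<bar>))"
    have dist: "norm (c.S b - hexp_coeff.S a (?d n) b) \<le> 2 * ((2 * \<bar>\<omega>\<bar> * h n) * ?C)" for n
    proof -
      interpret d: hexp_coeff a b "?d n" "\<lambda>s. \<bar>\<alpha> s\<bar>" by (rule d)
      have e1: "norm (hexp_series a ?c b - hexp_series a (?d n) b) \<le> (2 * \<bar>\<omega>\<bar> * h n) * ?C"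
        by (rule hexp_series_diff_bound[OF c.hexp_coeff_axioms d.hexp_coeff_axioms modulated_frozen_diff[OF hpos] b])
           (use hpos[of n] in simp)
      have e2: "norm (hexp_series a (\<lambda>s. - ?c s) b - hexp_series a (\<lambda>s. - ?d n s) b) \<le> (2 * \<bar>\<omega>\<bar> * h n) * ?C"
      proof (rule hexp_series_diff_bound[OF c.minus d.minus _ b])
        fix s
        have "norm (- ?c s - - ?d n s) = norm (?c s - ?d n s)" by (metis minus_diff_minus norm_minus_cancel)
        then show "norm (- ?c s - - ?d n s) \<le> (2 * \<bar>\<omega>\<bar> * h n) * \<bar>\<alpha> s\<bar>"
          using modulated_frozen_diff[OF hpos[of n], where \<alpha>=\<alpha> and a=a and \<omega>=\<omega> and s=s] by (simp only:)
      qed (use hpos[of n] in simp)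
      have e3: "c.S b - d.S b = (hexp_series a ?c b - hexp_series a (?d n) b) + (hexp_series a (\<lambda>s. - ?c s) b - hexp_series a (\<lambda>s. - ?d n s) b)"
        unfolding c.S_def d.S_def by simp
      show ?thesis unfolding e3 mult_2[of "(2 * \<bar>\<omega>\<bar> * h n) * ?C"] by (rule norm_triangle_mono[OF e1 e2])
    qed
    have "(\<lambda>n. 2 * ((2 * \<bar>\<omega>\<bar> * h n) * ?C)) \<longlonglongrightarrow> 2 * ((2 * \<bar>\<omega>\<bar> * 0) * ?C)"
      by (intro tendsto_intros hlim)
    then have "(\<lambda>n. c.S b - hexp_coeff.S a (?d n) b) \<longlonglongrightarrow> 0"
      by (intro Lim_null_comparison[OF always_eventually[OF allI[OF dist]]]) simp
    from tendsto_diff[OF tendsto_const[of "c.S b"] this]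
    have "(\<lambda>n. hexp_coeff.S a (?d n) b) \<longlonglongrightarrow> c.S b" by simp
    then have "(\<lambda>n. 2 * ln (cmod (hexp_coeff.S a (?d n) b) / 2)) \<longlonglongrightarrow> ?F \<omega>"
      using c.S_norm_ge[OF b] by (intro tendsto_intros) auto
    then have lim1: "(\<lambda>n. ennreal (2 * ln (cmod (hexp_coeff.S a (?d n) b) / 2))) \<longlonglongrightarrow> ennreal (?F \<omega>)"
      by (rule tendsto_ennrealI)
    have "filterlim (\<lambda>n. pi / 2 * inverse (h n)) at_top sequentially"
      by (intro filterlim_tendsto_pos_mult_at_top[OF tendsto_const] filterlim_inverse_at_top[OF hlim]) (auto simp: hpos)
    then have "eventually (\<lambda>n. \<bar>\<omega>\<bar> \<le> pi / 2 * inverse (h n)) sequentially" by (simp add: filterlim_at_top)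
    then have "eventually (\<lambda>n. u n \<omega> = ennreal (2 * ln (cmod (hexp_coeff.S a (?d n) b) / 2))) sequentially"
    proof eventually_elim
      case (elim n)
      have "pi / 2 * inverse (h n) = pi / (2 * h n)" by (simp only: divide_inverse inverse_mult_distrib mult.assoc)
      with elim have "\<bar>\<omega>\<bar> \<le> pi / (2 * h n)" by (simp only:)
      then have "\<omega> \<in> I n" unfolding I_def atLeastAtMost_iff by linarith
      then show ?case unfolding u_def layered.energy_def[OF lay] h_def by simp
    qed
    then show ?thesis using lim1 by (simp add: tendsto_cong)
  qed
  have "(\<integral>\<^sup>+\<omega>. ennreal (?F \<omega>) \<partial>lborel) = (\<integral>\<^sup>+\<omega>. liminf (\<lambda>n. u n \<omega>) \<partial>lborel)"
    using lim_imp_Liminf[OF _ lim] by (intro nn_integral_cong) simp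
  also have "\<dots> \<le> liminf (\<lambda>n. \<integral>\<^sup>+\<omega>. u n \<omega> \<partial>lborel)"
    by (intro nn_integral_liminf um)
  also have "\<dots> \<le> liminf (\<lambda>n::nat. ennreal (pi * integral {a..b} (\<lambda>s. (\<alpha> s)\<^sup>2)))"
    using layered.energy_integral[OF lay f2] unfolding u_def I_def h_def
    by (intro Liminf_mono always_eventually allI)
  finally show ?thesis by (simp add: Liminf_const)
qed

section \<open>The theorem\<close>

text \<open>A family of intervals in the closed interval is the limit of its images under contractions
  towards the midpoint, which lie in the open interval.\<close>

lemma absolutely_continuous_on_extend_closed:
  fixes f :: "real \<Rightarrow> 'a::banach"
  assumes f: "absolutely_continuous_on {a<..<b} f" and ab: "a < b"
  obtains g where "absolutely_continuous_on {a..b} g" "\<And>x. x \<in> {a<..<b} \<Longrightarrow> g x = f x"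
proof -
  obtain g where g: "uniformly_continuous_on (closure {a<..<b}) g" "\<And>x. x \<in> {a<..<b} \<Longrightarrow> f x = g x"
    using uniformly_continuous_on_extension_on_closure[OF absolutely_continuous_on_imp_uniformly_continuous[OF f]] by metis
  have cg: "continuous_on {a..b} g"
    using uniformly_continuous_imp_continuous[OF g(1)] ab by simp
  define \<phi> where "\<phi> n x = (a + b) / 2 + (1 - inverse (real (Suc n))) * (x - (a + b) / 2)" for n x
  have \<phi>in: "\<phi> n x \<in> {a<..<b}" if x: "x \<in> {a..b}" for n x
  proof -
    define s where "s = 1 - inverse (real (Suc n))"
    have s: "0 \<le> s" "s < 1" unfolding s_def by (auto simp: field_simps)
    have "\<bar>x - (a + b) / 2\<bar> \<le> (b - a) / 2" using x by (auto simp: abs_le_iff field_simps)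
    then have "s * \<bar>x - (a + b) / 2\<bar> \<le> s * ((b - a) / 2)" using s(1) by (rule mult_left_mono)
    moreover have "\<bar>s * (x - (a + b) / 2)\<bar> = s * \<bar>x - (a + b) / 2\<bar>" using s(1) by (simp only: abs_mult abs_of_nonneg)
    ultimately have "\<bar>s * (x - (a + b) / 2)\<bar> \<le> s * ((b - a) / 2)" by simp
    also have "\<dots> < 1 * ((b - a) / 2)" using s ab by (intro mult_strict_right_mono) auto
    finally have "\<bar>s * (x - (a + b) / 2)\<bar> < (b - a) / 2" by simp
    moreover define p where "p = s * (x - (a + b) / 2)"
    ultimately have "\<bar>p\<bar> < (b - a) / 2" by simp
    then have "p < (b - a) / 2" "- p < (b - a) / 2" by (simp_all only: abs_less_iff)
    then have "a < (a + b) / 2 + p" "(a + b) / 2 + p < b" by (simp_all add: field_simps)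
    then show ?thesis unfolding \<phi>_def s_def[symmetric] p_def[symmetric] by simp
  qed
  have \<phi>lim: "(\<lambda>n. \<phi> n x) \<longlonglongrightarrow> x" for x
  proof -
    have "(\<lambda>n. \<phi> n x) \<longlonglongrightarrow> (a + b) / 2 + (1 - 0) * (x - (a + b) / 2)"
      unfolding \<phi>_def by (intro tendsto_intros LIMSEQ_inverse_real_of_nat)
    then show ?thesis by simp
  qed
  have glim: "(\<lambda>n. g (\<phi> n x)) \<longlonglongrightarrow> g x" if x: "x \<in> {a..b}" for x
    by (rule continuous_on_tendsto_compose[OF cg \<phi>lim x]) (use \<phi>in[OF x] in \<open>auto intro!: always_eventually less_imp_le\<close>)
  have "absolutely_continuous_on {a..b} g"
    unfolding absolutely_continuous_on_def
  proof (intro allI impI)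
    fix e :: real assume "e > 0"
    \<comment> \<open>Strict inequalities become weak in the limit, hence the margin.\<close>
    then have "e / 2 > 0" by simp
    then obtain \<delta> where \<delta>: "\<delta> > 0" "\<And>(n::nat) u v.
        (\<forall>k<n. u k \<in> {a<..<b} \<and> v k \<in> {a<..<b} \<and> u k \<le> v k) \<Longrightarrow>
        disjoint_family_on (\<lambda>k. {u k<..<v k}) {..<n} \<Longrightarrow>
        (\<Sum>k<n. v k - u k) < \<delta> \<Longrightarrow>
        (\<Sum>k<n. norm (f (v k) - f (u k))) < e / 2"
      using f unfolding absolutely_continuous_on_def by meson
    show "\<exists>\<delta>>0. \<forall>(n::nat) u v. (\<forall>k<n. u k \<in> {a..b} \<and> v k \<in> {a..b} \<and> u k \<le> v k) \<and>
      disjoint_family_on (\<lambda>k. {u k<..<v k}) {..<n} \<and> (\<Sum>k<n. v k - u k) < \<delta> \<longrightarrow>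
      (\<Sum>k<n. norm (g (v k) - g (u k))) < e"
    proof (intro exI[of _ \<delta>] conjI allI impI)
      fix n :: nat and u v
      assume H: "(\<forall>k<n. u k \<in> {a..b} \<and> v k \<in> {a..b} \<and> u k \<le> v k) \<and>
        disjoint_family_on (\<lambda>k. {u k<..<v k}) {..<n} \<and> (\<Sum>k<n. v k - u k) < \<delta>"
      have le: "(\<Sum>k<n. norm (g (\<phi> i (v k)) - g (\<phi> i (u k)))) \<le> e / 2" for i
      proof -
        define s where "s = 1 - inverse (real (Suc i))"
        have s: "0 \<le> s" "s \<le> 1" unfolding s_def by (auto simp: field_simps)
        have d: "\<phi> i y - \<phi> i x = s * (y - x)" for x y unfolding \<phi>_def s_def[symmetric] by (simp add: algebra_simps)
        have mono: "\<phi> i x \<le> \<phi> i y" if "x \<le> y" for x y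
          using d[of y x] mult_nonneg_nonneg[OF s(1), of "y - x"] that by simp
        have "(\<Sum>k<n. norm (f (\<phi> i (v k)) - f (\<phi> i (u k)))) < e / 2"
        proof (rule \<delta>(2))
          show "\<forall>k<n. \<phi> i (u k) \<in> {a<..<b} \<and> \<phi> i (v k) \<in> {a<..<b} \<and> \<phi> i (u k) \<le> \<phi> i (v k)"
            using H \<phi>in mono by blast
          show "disjoint_family_on (\<lambda>k. {\<phi> i (u k)<..<\<phi> i (v k)}) {..<n}"
            unfolding disjoint_family_on_def
          proof (intro ballI impI)
            fix k l assume kl: "k \<in> {..<n}" "l \<in> {..<n}" "k \<noteq> l"
            then have "{u k<..<v k} \<inter> {u l<..<v l} = {}" using H unfolding disjoint_family_on_def by blast
            then have "min (v k) (v l) \<le> max (u k) (u l)" by simp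
            then have "v k \<le> u k \<or> v k \<le> u l \<or> v l \<le> u k \<or> v l \<le> u l" by linarith
            then have "\<phi> i (v k) \<le> \<phi> i (u k) \<or> \<phi> i (v k) \<le> \<phi> i (u l) \<or> \<phi> i (v l) \<le> \<phi> i (u k) \<or> \<phi> i (v l) \<le> \<phi> i (u l)"
              using mono by blast
            then show "{\<phi> i (u k)<..<\<phi> i (v k)} \<inter> {\<phi> i (u l)<..<\<phi> i (v l)} = {}" by auto
          qed
          have "(\<Sum>k<n. \<phi> i (v k) - \<phi> i (u k)) = s * (\<Sum>k<n. v k - u k)"
            unfolding d by (simp add: sum_distrib_left)
          also have "\<dots> \<le> (\<Sum>k<n. v k - u k)"
            using s H by (intro mult_left_le_one_le sum_nonneg) auto
          finally show "(\<Sum>k<n. \<phi> i (v k) - \<phi> i (u k)) < \<delta>" using H by linarith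
        qed
        also have "(\<Sum>k<n. norm (f (\<phi> i (v k)) - f (\<phi> i (u k)))) = (\<Sum>k<n. norm (g (\<phi> i (v k)) - g (\<phi> i (u k))))"
          using H \<phi>in g(2) by (intro sum.cong) auto
        finally show ?thesis by simp
      qed
      have "(\<lambda>i. \<Sum>k<n. norm (g (\<phi> i (v k)) - g (\<phi> i (u k)))) \<longlonglongrightarrow> (\<Sum>k<n. norm (g (v k) - g (u k)))"
        using H by (intro tendsto_sum tendsto_norm tendsto_diff glim) auto
      then have "(\<Sum>k<n. norm (g (v k) - g (u k))) \<le> e / 2"
        by (rule tendsto_upperbound) (use le in auto)
      then show "(\<Sum>k<n. norm (g (v k) - g (u k))) < e" using \<open>e > 0\<close> by simp
    qed (use \<delta> in auto)
  qed
  then show ?thesis using that g(2) by metis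
qed

text \<open>The extension g of \<zeta> to the closed interval has an integrable derivative d, which
  agrees with \<open>deriv \<zeta>\<close> off a null set. Dividing by the continuous g, which stays
  at least \<epsilon>, preserves integrability.\<close>

lemma C_plus_log_derivative:
  assumes "\<zeta> \<in> C_plus {a<..<b}" and ab: "a < b"
    and \<alpha>: "AE x in lebesgue_on {a<..<b}. \<alpha> x = - deriv \<zeta> x / (2 * \<zeta> x)"
  obtains \<epsilon> where "\<epsilon> > 0" "\<And>x. x \<in> {a<..<b} \<Longrightarrow> \<zeta> x > \<epsilon>" "\<alpha> absolutely_integrable_on {a..b}"
    "ac_deriv {a<..<b} \<zeta> (\<lambda>x. - 2 * \<alpha> x * \<zeta> x)"
proof -
  obtain \<epsilon> where ac: "absolutely_continuous_on {a<..<b} \<zeta>" and \<epsilon>: "\<epsilon> > 0" "\<And>x. x \<in> {a<..<b} \<Longrightarrow> \<zeta> x > \<epsilon>"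
    using assms(1) unfolding C_plus_def by blast
  obtain g where g: "absolutely_continuous_on {a..b} g" "\<And>x. x \<in> {a<..<b} \<Longrightarrow> g x = \<zeta> x"
    using absolutely_continuous_on_extend_closed[OF ac ab] by blast
  have cg: "continuous_on {a..b} g" using g(1) by (rule absolutely_continuous_on_imp_continuous_on)
  have ge: "\<epsilon> \<le> g x" if "x \<in> {a..b}" for x
  proof (rule continuous_ge_on_closure[of "{a<..<b}" g])
    show "continuous_on (closure {a<..<b}) g" using cg ab by simp
    show "x \<in> closure {a<..<b}" using that ab by simp
    show "\<epsilon> \<le> g y" if "y \<in> {a<..<b}" for y using g(2)[OF that] \<epsilon>(2)[OF that] by simp
  qed
  obtain d where d: "d absolutely_integrable_on {a..b}" "ac_deriv {a..b} g d"
    using absolutely_continuous_on_imp_ac_deriv[OF g(1)] .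
  then obtain N where N: "negligible N" "\<And>x. x \<in> {a..b} - N \<Longrightarrow> (g has_vector_derivative d x) (at x)"
    unfolding ac_deriv_def by blast
  have dz: "(\<zeta> has_vector_derivative d x) (at x)" if "x \<in> {a<..<b} - N" for x
    by (rule has_vector_derivative_transform_within_open[OF N(2), of x "{a<..<b}"]) (use that g(2) in auto)
  have dd: "deriv \<zeta> x = d x" if "x \<in> {a<..<b} - N" for x
    using dz[OF that] by (intro DERIV_imp_deriv) (simp add: has_real_derivative_iff_has_vector_derivative)
  obtain M where M: "negligible M" "\<And>x. x \<in> {a<..<b} - M \<Longrightarrow> \<alpha> x = - deriv \<zeta> x / (2 * \<zeta> x)"
    using \<alpha> AE_lebesgue_on_iff_negligible[of "{a<..<b}"] by auto
  have \<alpha>eq: "\<alpha> x = - d x / (2 * g x)" if "x \<in> {a..b} - (M \<union> N \<union> {a,b})" for x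
    using M(2)[of x] dd[of x] g(2)[of x] that by auto
  have neg: "negligible (M \<union> N \<union> {a,b})" using M N by simp
  have "(\<lambda>x. d x * (- 1 / (2 * g x))) absolutely_integrable_on {a..b}"
    by (intro absolutely_integrable_mult_continuous d continuous_intros cg) (use ge \<epsilon>(1) in force)
  then have "\<alpha> absolutely_integrable_on {a..b}"
    by (rule absolutely_integrable_spike[OF _ neg]) (simp add: \<alpha>eq)
  moreover have "ac_deriv {a<..<b} \<zeta> (\<lambda>x. - 2 * \<alpha> x * \<zeta> x)"
  proof (rule ac_deriv_cong_ae[OF _ neg])
    show "ac_deriv {a<..<b} \<zeta> d" unfolding ac_deriv_def using ac dz N(1) by blast
    fix x assume x: "x \<in> {a<..<b} - (M \<union> N \<union> {a,b})"
    then have "\<zeta> x \<noteq> 0" using \<epsilon>(1) \<epsilon>(2)[of x] by auto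
    then show "d x = - 2 * \<alpha> x * \<zeta> x" using \<alpha>eq[of x] g(2)[of x] x by auto
  qed
  ultimately show ?thesis using that \<epsilon> by blast
qed

text \<open>Pull Q cnj S out of the numerator and S out of the denominator; the hypotheses say that
  Q is unimodular with inverse Q'.\<close>

lemma moebius_form:
  fixes S D Q Q' \<xi> :: complex
  assumes "S \<noteq> 0" "Q * Q' = 1" "cnj Q' = Q"
  shows "(D + \<xi> * Q * cnj S) / (S + \<xi> * Q * cnj D) =
    Q * (cnj S / S) * ((\<xi> + Q' * (D / cnj S)) / (1 + cnj (Q' * (D / cnj S)) * \<xi>))"
proof -
  have cS: "cnj S \<noteq> 0" using assms by simp
  have "Q * cnj S * (\<xi> + Q' * (D / cnj S)) = \<xi> * Q * cnj S + (Q * Q') * (D / cnj S * cnj S)"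
    by (simp add: algebra_simps)
  then have n: "Q * cnj S * (\<xi> + Q' * (D / cnj S)) = D + \<xi> * Q * cnj S" using cS assms(2) by simp
  have "S * (1 + cnj (Q' * (D / cnj S)) * \<xi>) = S + \<xi> * Q * (cnj D / S * S)"
    using assms(3) by (simp add: algebra_simps)
  then have d: "S * (1 + cnj (Q' * (D / cnj S)) * \<xi>) = S + \<xi> * Q * cnj D" using assms(1) by simp
  show ?thesis unfolding n[symmetric] d[symmetric] by simp
qed

text \<open>In the Moebius formula the quantifier over \<xi> stands inside \<open>AE\<close>, so one
  null set serves all \<xi>. Integrability is claimed explicitly in the energy inequality, because
  the integral of a non-integrable function is 0 by convention.\<close>

theorem theorem7:
  fixes x0 x1 y :: real and \<zeta> \<alpha> :: "real \<Rightarrow> real" and R :: "real \<Rightarrow> complex"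
  assumes "x0 < x1"
    and "\<zeta> \<in> C_plus {x0<..<x1}"
    and "AE x in lebesgue_on {x0<..<x1}. \<alpha> x = - deriv \<zeta> x / (2 * \<zeta> x)"
    and "y \<in> {x0<..x1}"
    and "\<And>\<omega>. R \<omega> = reflection_coeff \<zeta> x0 y \<omega> 0"
  shows "(AE \<omega> in lborel. R \<omega> = Th \<alpha> x0 y \<omega>) \<and>
    (\<forall>\<omega>. cmod (Th \<alpha> x0 y \<omega>) \<le> tanh (LINT x:{x0<..<y}|lebesgue. \<bar>\<alpha> x\<bar>)) \<and>
    (\<forall>\<xi>\<in>ball 0 1. \<exists>h. smooth h \<and> (AE \<omega> in lborel. reflection_coeff \<zeta> x0 y \<omega> \<xi> = h \<omega>)) \<and>
    (AE \<omega> in lborel. \<forall>\<xi>\<in>ball 0 1.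
       (let S = harmonic_exp \<alpha> x0 y \<omega> + harmonic_exp (\<lambda>x. - \<alpha> x) x0 y \<omega>;
            D = harmonic_exp \<alpha> x0 y \<omega> - harmonic_exp (\<lambda>x. - \<alpha> x) x0 y \<omega>;
            \<mu> = exp (2 * \<i> * of_real ((y - x0) * \<omega>)) * (cnj S / S);
            \<rho> = exp (- 2 * \<i> * of_real ((y - x0) * \<omega>)) * (D / cnj S)
        in reflection_coeff \<zeta> x0 y \<omega> \<xi> = \<mu> * ((\<xi> + \<rho>) / (1 + cnj \<rho> * \<xi>)))) \<and>
    (set_integrable lebesgue {x0<..<x1} (\<lambda>x. \<bar>\<alpha> x\<bar>\<^sup>2) \<longrightarrow>
       integrable lborel (\<lambda>\<omega>. - ln (1 - (cmod (Th \<alpha> x0 y \<omega>))\<^sup>2)) \<and>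
       (LINT \<omega>|lborel. - ln (1 - (cmod (Th \<alpha> x0 y \<omega>))\<^sup>2))
         \<le> pi * (LINT x:{x0<..<y}|lebesgue. \<bar>\<alpha> x\<bar>\<^sup>2))"
proof -
  have y: "x0 < y" "y \<le> x1" using assms(4) by auto
  obtain \<epsilon> where \<epsilon>: "\<epsilon> > 0" "\<And>x. x \<in> {x0<..<x1} \<Longrightarrow> \<zeta> x > \<epsilon>" and \<alpha>1: "\<alpha> absolutely_integrable_on {x0..x1}"
    and \<zeta>: "ac_deriv {x0<..<x1} \<zeta> (\<lambda>x. - 2 * \<alpha> x * \<zeta> x)"
    using C_plus_log_derivative[OF assms(2,1,3)] by blast
  have \<alpha>: "\<alpha> absolutely_integrable_on {x0..y}"
    using y by (intro absolutely_integrable_on_subinterval[OF \<alpha>1]) auto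
  have yy: "y \<in> {x0..y}" using y by simp
  define S where "S \<omega> = harmonic_exp \<alpha> x0 y \<omega> + harmonic_exp (\<lambda>x. - \<alpha> x) x0 y \<omega>" for \<omega>
  define D where "D \<omega> = harmonic_exp \<alpha> x0 y \<omega> - harmonic_exp (\<lambda>x. - \<alpha> x) x0 y \<omega>" for \<omega>
  define Q where "Q \<omega> = exp (2 * \<i> * complex_of_real ((y - x0) * \<omega>))" for \<omega>
  have Th: "Th \<alpha> x0 y \<omega> = D \<omega> / S \<omega>" for \<omega> by (simp add: Th_def S_def D_def)
  have coeff: "hexp_coeff x0 y (modulated \<alpha> x0 \<omega>) (\<lambda>s. \<bar>\<alpha> s\<bar>)" for \<omega>
    using \<alpha> y by (intro hexp_coeff_modulated) auto
  have SS: "S \<omega> = hexp_coeff.S x0 (modulated \<alpha> x0 \<omega>) y" for \<omega>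
    unfolding S_def hexp_coeff.S_def[OF coeff] harmonic_exp_eq_series[OF \<alpha> yy] harmonic_exp_minus_eq_series[OF \<alpha> yy] ..
  have DD: "D \<omega> = hexp_coeff.D x0 (modulated \<alpha> x0 \<omega>) y" for \<omega>
    unfolding D_def hexp_coeff.D_def[OF coeff] harmonic_exp_eq_series[OF \<alpha> yy] harmonic_exp_minus_eq_series[OF \<alpha> yy] ..
  have S2: "2 \<le> cmod (S \<omega>)" for \<omega> unfolding SS by (rule hexp_coeff.S_norm_ge[OF coeff yy])
  have Snz: "S \<omega> \<noteq> 0" for \<omega> using S2[of \<omega>] by auto
  have sub: "{x0<..<y} \<subseteq> {x0<..<x1}" using y by auto
  have refl: "reflection_coeff \<zeta> x0 y \<omega> \<xi> = (D \<omega> + \<xi> * Q \<omega> * cnj (S \<omega>)) / (S \<omega> + \<xi> * Q \<omega> * cnj (D \<omega>))"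
    if \<omega>: "\<omega> \<noteq> 0" and \<xi>: "cmod \<xi> < 1" for \<omega> \<xi>
  proof -
    note outer_Q = Q_def
    interpret wave_problem x0 y \<omega> \<epsilon> \<alpha> \<zeta>
      by unfold_locales (use y \<omega> \<alpha> ac_deriv_subset[OF \<zeta> sub] \<epsilon> sub in auto)
    show ?thesis
      using reflection_coeff_eq[OF \<xi>] unfolding reflected_def SS DD local.Q_def coeff_def outer_Q .
  qed
  \<comment> \<open>At \<omega> = 0 the right and left parts involve a division by zero; this single
    point is the exceptional set for all identities.\<close>
  have ae: "AE \<omega> in lborel. \<omega> \<noteq> (0::real)" by (rule AE_lborel_singleton)
  have norm_int: "(LINT x:{x0<..<y}|lebesgue. f x) = integral {x0..y} f" if "f absolutely_integrable_on {x0..y}" for f :: "real \<Rightarrow> real"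
    using set_lebesgue_integral_eq_integral(2)[of "{x0<..<y}" f] that
    by (simp add: absolutely_integrable_on_Ioo_iff integral_open_interval_real)
  show ?thesis
  proof (intro conjI allI ballI impI)
    show "AE \<omega> in lborel. R \<omega> = Th \<alpha> x0 y \<omega>"
      using ae by eventually_elim (simp add: assms(5) refl Th)
  next
    fix \<omega>
    have "cmod (Th \<alpha> x0 y \<omega>) \<le> tanh (hexp_coeff.B x0 (\<lambda>s. \<bar>\<alpha> s\<bar>) y)"
      unfolding Th SS DD by (rule hexp_coeff.quotient_le_tanh[OF coeff yy])
    also have "hexp_coeff.B x0 (\<lambda>s. \<bar>\<alpha> s\<bar>) y = (LINT x:{x0<..<y}|lebesgue. \<bar>\<alpha> x\<bar>)"
      unfolding hexp_coeff.B_def[OF coeff] by (rule norm_int[symmetric, OF set_integrable_abs[OF \<alpha>]])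
    finally show "cmod (Th \<alpha> x0 y \<omega>) \<le> tanh (LINT x:{x0<..<y}|lebesgue. \<bar>\<alpha> x\<bar>)" .
  next
    fix \<xi> :: complex assume "\<xi> \<in> ball 0 1"
    then have \<xi>: "cmod \<xi> < 1" by simp
    let ?h = "\<lambda>\<omega>. (D \<omega> + \<xi> * Q \<omega> * cnj (S \<omega>)) / (S \<omega> + \<xi> * Q \<omega> * cnj (D \<omega>))"
    have "smooth ?h"
      using smooth_reflected[OF \<alpha> less_imp_le[OF y(1)] \<xi>]
      unfolding Q_def S_def D_def harmonic_exp_eq_series[OF \<alpha> yy] harmonic_exp_minus_eq_series[OF \<alpha> yy] .
    moreover have "AE \<omega> in lborel. reflection_coeff \<zeta> x0 y \<omega> \<xi> = ?h \<omega>"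
      using ae by eventually_elim (rule refl[OF _ \<xi>])
    ultimately show "\<exists>h. smooth h \<and> (AE \<omega> in lborel. reflection_coeff \<zeta> x0 y \<omega> \<xi> = h \<omega>)" by blast
  next
    show "AE \<omega> in lborel. \<forall>\<xi>\<in>ball 0 1.
       (let S = harmonic_exp \<alpha> x0 y \<omega> + harmonic_exp (\<lambda>x. - \<alpha> x) x0 y \<omega>;
            D = harmonic_exp \<alpha> x0 y \<omega> - harmonic_exp (\<lambda>x. - \<alpha> x) x0 y \<omega>;
            \<mu> = exp (2 * \<i> * of_real ((y - x0) * \<omega>)) * (cnj S / S);
            \<rho> = exp (- 2 * \<i> * of_real ((y - x0) * \<omega>)) * (D / cnj S)
        in reflection_coeff \<zeta> x0 y \<omega> \<xi> = \<mu> * ((\<xi> + \<rho>) / (1 + cnj \<rho> * \<xi>)))"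
      unfolding Let_def S_def[symmetric] D_def[symmetric] Q_def[symmetric]
      using ae
    proof eventually_elim
      case (elim \<omega>)
      have QQ: "Q \<omega> * exp (- 2 * \<i> * of_real ((y - x0) * \<omega>)) = 1"
        unfolding Q_def exp_add[symmetric] by simp
      have Qc: "cnj (exp (- 2 * \<i> * of_real ((y - x0) * \<omega>))) = Q \<omega>"
        unfolding Q_def exp_cnj by simp
      show ?case
        using refl[OF elim] moebius_form[OF Snz[of \<omega>] QQ Qc, of "D \<omega>"] by simp
    qed
  next
    assume "set_integrable lebesgue {x0<..<x1} (\<lambda>x. \<bar>\<alpha> x\<bar>\<^sup>2)"
    then have "(\<lambda>x. \<bar>\<alpha> x\<bar>\<^sup>2) absolutely_integrable_on {x0..x1}" by (simp only: absolutely_integrable_on_Ioo_iff)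
    then have sq: "(\<lambda>x. \<bar>\<alpha> x\<bar>\<^sup>2) absolutely_integrable_on {x0..y}"
      by (rule absolutely_integrable_on_subinterval) (use y in auto)
    then have sq': "(\<lambda>x. (\<alpha> x)\<^sup>2) integrable_on {x0..y}" by (simp add: absolutely_integrable_on_def)
    let ?F = "\<lambda>\<omega>. 2 * ln (cmod (S \<omega>) / 2)"
    have F: "- ln (1 - (cmod (Th \<alpha> x0 y \<omega>))\<^sup>2) = ?F \<omega>" for \<omega>
    proof -
      have p: "cmod (S \<omega>) > 0" using S2[of \<omega>] by linarith
      have "1 - (cmod (Th \<alpha> x0 y \<omega>))\<^sup>2 = 4 / (cmod (S \<omega>))\<^sup>2"
        unfolding Th SS DD by (rule hexp_coeff.quotient_norm[OF coeff yy])
      also have "\<dots> = inverse ((cmod (S \<omega>) / 2)\<^sup>2)" by (simp add: power_divide)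
      finally show ?thesis using p by (simp add: ln_inverse ln_realpow)
    qed
    have F0: "0 \<le> ?F \<omega>" for \<omega> using S2[of \<omega>] by simp
    \<comment> \<open>The entire extensions make S continuous in \<omega>; this gives the
      measurability needed to pass from the nonnegative integral to integrability.\<close>
    obtain E where E: "E holomorphic_on UNIV" "\<And>\<omega>. E (of_real \<omega>) = hexp_series x0 (modulated \<alpha> x0 \<omega>) y"
      using hexp_series_entire_extension[OF \<alpha> yy] by blast
    have cE: "continuous_on UNIV (\<lambda>\<omega>. hexp_series x0 (modulated \<alpha> x0 \<omega>) y)"
      unfolding E(2)[symmetric]
      by (rule continuous_on_compose2[OF holomorphic_on_imp_continuous_on[OF E(1)]]) (auto intro: continuous_intros)
    have \<alpha>m: "(\<lambda>s. - \<alpha> s) absolutely_integrable_on {x0..y}"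
      using absolutely_integrable_scaleR_left[OF \<alpha>, of "-1"] by simp
    obtain G where G: "G holomorphic_on UNIV" "\<And>\<omega>. G (of_real \<omega>) = hexp_series x0 (modulated (\<lambda>s. - \<alpha> s) x0 \<omega>) y"
      using hexp_series_entire_extension[OF \<alpha>m yy] by blast
    have cG: "continuous_on UNIV (\<lambda>\<omega>. hexp_series x0 (modulated (\<lambda>s. - \<alpha> s) x0 \<omega>) y)"
      unfolding G(2)[symmetric]
      by (rule continuous_on_compose2[OF holomorphic_on_imp_continuous_on[OF G(1)]]) (auto intro: continuous_intros)
    have "continuous_on UNIV S"
      unfolding S_def[abs_def] harmonic_exp_eq_series[OF \<alpha> yy] harmonic_exp_eq_series[OF \<alpha>m yy]
      by (intro continuous_on_add cE cG)
    then have cF: "continuous_on UNIV ?F" using Snz by (intro continuous_intros) auto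
    have Fm: "?F \<in> borel_measurable lborel" using borel_measurable_continuous_onI[OF cF] by simp
    have le: "(\<integral>\<^sup>+\<omega>. ennreal (?F \<omega>) \<partial>lborel) \<le> ennreal (pi * integral {x0..y} (\<lambda>s. (\<alpha> s)\<^sup>2))"
      unfolding SS by (rule nn_integral_ln_norm_S_le[OF y(1) \<alpha> sq'])
    have int: "integrable lborel ?F"
    proof (rule integrableI_bounded[OF Fm])
      show "(\<integral>\<^sup>+ \<omega>. ennreal (norm (?F \<omega>)) \<partial>lborel) < \<infinity>"
        using le_less_trans[OF le] F0 by simp
    qed
    then show "integrable lborel (\<lambda>\<omega>. - ln (1 - (cmod (Th \<alpha> x0 y \<omega>))\<^sup>2))" unfolding F .
    have "ennreal (LINT \<omega>|lborel. ?F \<omega>) \<le> ennreal (pi * integral {x0..y} (\<lambda>s. (\<alpha> s)\<^sup>2))"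
      using nn_integral_eq_integral[OF int] F0 le by simp
    moreover have "0 \<le> pi * integral {x0..y} (\<lambda>s. (\<alpha> s)\<^sup>2)"
      using integral_nonneg[OF sq'] by simp
    ultimately have "(LINT \<omega>|lborel. ?F \<omega>) \<le> pi * integral {x0..y} (\<lambda>s. (\<alpha> s)\<^sup>2)"
      by (simp add: ennreal_le_iff)
    then show "(LINT \<omega>|lborel. - ln (1 - (cmod (Th \<alpha> x0 y \<omega>))\<^sup>2)) \<le> pi * (LINT x:{x0<..<y}|lebesgue. \<bar>\<alpha> x\<bar>\<^sup>2)"
      unfolding F norm_int[OF sq] by simp
  qed
qed

end
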